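(* Let $\Omega\subset\mathbb{R}^N$ be a bounded domain with smooth boundary, $s\in(0,1)$, $N>2s$, $\mu\in(0,N)$, and let $1<p,q<2_\mu^*$. Let $a,b,c\in\mathbb{R}$ with $b\ge 0$, and suppose the largest eigenvalue $\mu_2$ of the matrix $A=\begin{pmatrix} a&b\\ b&c\end{pmatrix}$ satisfies $\mu_2<\lambda_{1,s}$. Then the system $$\begin{cases} (-\Delta)^s u = au+bv+\frac{2p}{p+q}\Big(\int_\Omega \frac{|v(y)|^q}{|x-y|^\mu}dy\Big)|u|^{p-2}u & \text{in }\Omega,\\ (-\Delta)^s v = bu+cv+\frac{2q}{p+q}\Big(\int_\Omega \frac{|u(y)|^p}{|x-y|^\mu}dy\Big)|v|^{q-2}v & \text{in }\Omega,\\ u=v=0 & \text{in }\mathbb{R}^N\setminus\Omega\end{cases}$$ admits a weak solution $(u,v)\in Y(\Omega)$ with $u>0$ and $v>0$ in $\Omega$.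
   Context: $2_\mu^*=\frac{2N-\mu}{N-2s}$. $(-\Delta)^s u(x)=-\mathrm{P.V.}\int_{\mathbb{R}^N}\frac{u(x)-u(y)}{|x-y|^{N+2s}}dy$ (normalization constant omitted). $X(\Omega)=\{u\in H^s(\mathbb{R}^N): u=0 \text{ a.e. in } \mathbb{R}^N\setminus\Omega\}$ with norm $\|u\|_X=\big(\int_{\mathbb{R}^{2N}}\frac{|u(x)-u(y)|^2}{|x-y|^{N+2s}}dxdy\big)^{1/2}$ and inner product $\langle u,\varphi\rangle_X=\int_{\mathbb{R}^{2N}}\frac{(u(x)-u(y))(\varphi(x)-\varphi(y))}{|x-y|^{N+2s}}dxdy$; $Y(\Omega)=X(\Omega)\times X(\Omega)$ with $\|(u,v)\|_Y^2=\|u\|_X^2+\|v\|_X^2$. $\lambda_{1,s}=\inf_{u\in X(\Omega)\setminus\{0\}}\|u\|_X^2/\|u\|_{L^2}^2$ is the first eigenvalue of $(-\Delta)^s$ with exterior Dirichlet condition. A weak solution is $(u,v)\in Y(\Omega)$ such that for all $(\varphi,\psi)\in Y(\Omega)$, $\langle u,\varphi\rangle_X+\langle v,\psi\rangle_X-\int_\Omega (A(u,v),(\varphi,\psi))_{\mathbb{R}^2}dx$ equals the integral of the nonlinear right-hand-side terms tested against $\varphi$ and $\psi$ respectively. *)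

theory Defs
  imports "HOL-Analysis.Analysis"
begin

fun dderiv_iter :: "'a::euclidean_space list \<Rightarrow> ('a \<Rightarrow> real) \<Rightarrow> ('a \<Rightarrow> real)" where
  "dderiv_iter [] f = f"
| "dderiv_iter (i # is) f = (\<lambda>x. frechet_derivative (dderiv_iter is f) (at x) i)"

definition smooth_on :: "'a::euclidean_space set \<Rightarrow> ('a \<Rightarrow> real) \<Rightarrow> bool" where
  "smooth_on S f \<longleftrightarrow> (\<forall>is. set is \<subseteq> Basis \<longrightarrow>
      (\<forall>x\<in>S. dderiv_iter is f differentiable (at x)) \<and> continuous_on S (dderiv_iter is f))"

definition smooth_boundary :: "'a::euclidean_space set \<Rightarrow> bool" where
  "smooth_boundary \<Omega> \<longleftrightarrow> (\<forall>x0\<in>frontier \<Omega>. \<exists>r>0. \<exists>g::'a \<Rightarrow> real.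
      smooth_on (ball x0 r) g \<and> frechet_derivative g (at x0) \<noteq> (\<lambda>_. 0) \<and>
      \<Omega> \<inter> ball x0 r = {y \<in> ball x0 r. g y < 0})"

definition bounded_smooth_domain :: "'a::euclidean_space set \<Rightarrow> bool" where
  "bounded_smooth_domain \<Omega> \<longleftrightarrow> open \<Omega> \<and> connected \<Omega> \<and> \<Omega> \<noteq> {} \<and> bounded \<Omega> \<and> smooth_boundary \<Omega>"

text \<open>Square of the Gagliardo seminorm (normalisation constant omitted).\<close>
definition gagliardo_sq :: "real \<Rightarrow> ('a::euclidean_space \<Rightarrow> real) \<Rightarrow> ennreal" where
  "gagliardo_sq s u = nn_integral lborel (\<lambda>x. nn_integral lborel (\<lambda>y. ennreal ((u x - u y)^2 / norm (x - y) powr (real DIM('a) + 2 * s))))"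

definition frac_sobolev :: "real \<Rightarrow> ('a::euclidean_space \<Rightarrow> real) set" where
  "frac_sobolev s = {u. u \<in> borel_measurable lborel \<and> integrable lborel (\<lambda>x. (u x)^2) \<and> gagliardo_sq s u < \<infinity>}"

definition Xspace :: "real \<Rightarrow> 'a::euclidean_space set \<Rightarrow> ('a \<Rightarrow> real) set" where
  "Xspace s \<Omega> = {u \<in> frac_sobolev s. AE x in lborel. x \<notin> \<Omega> \<longrightarrow> u x = 0}"

definition X_norm_sq :: "real \<Rightarrow> ('a::euclidean_space \<Rightarrow> real) \<Rightarrow> real" where
  "X_norm_sq s u = enn2real (gagliardo_sq s u)"

definition X_inner :: "real \<Rightarrow> ('a::euclidean_space \<Rightarrow> real) \<Rightarrow> ('a \<Rightarrow> real) \<Rightarrow> real" where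
  "X_inner s u \<phi> = (\<integral> z. (u (fst z) - u (snd z)) * (\<phi> (fst z) - \<phi> (snd z)) /
       norm (fst z - snd z) powr (real DIM('a) + 2 * s) \<partial>(lborel \<Otimes>\<^sub>M lborel))"

text \<open>First Dirichlet eigenvalue of the fractional Laplacian on Omega (Rayleigh quotient).\<close>
definition lambda1 :: "real \<Rightarrow> 'a::euclidean_space set \<Rightarrow> real" where
  "lambda1 s \<Omega> = Inf {X_norm_sq s u / (\<integral> x. (u x)^2 \<partial>lborel) | u.
       u \<in> Xspace s \<Omega> \<and> (\<integral> x. (u x)^2 \<partial>lborel) \<noteq> 0}"

definition matA :: "real \<Rightarrow> real \<Rightarrow> real \<Rightarrow> real^2^2" where
  "matA a b c = vector [vector [a, b], vector [b, c]]"

definition largest_eigenvalue :: "real^2^2 \<Rightarrow> real" where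
  "largest_eigenvalue M = Max {l. \<exists>w::real^2. w \<noteq> 0 \<and> M *v w = l *\<^sub>R w}"

definition crit_exp :: "nat \<Rightarrow> real \<Rightarrow> real \<Rightarrow> real" where
  "crit_exp N s \<mu> = (2 * real N - \<mu>) / (real N - 2 * s)"

definition weak_solution ::
  "real \<Rightarrow> real \<Rightarrow> real \<Rightarrow> real \<Rightarrow> real \<Rightarrow> real \<Rightarrow> real \<Rightarrow> 'a::euclidean_space set \<Rightarrow>
   ('a \<Rightarrow> real) \<Rightarrow> ('a \<Rightarrow> real) \<Rightarrow> bool" where
  "weak_solution s \<mu> p q a b c \<Omega> u v \<longleftrightarrow> u \<in> Xspace s \<Omega> \<and> v \<in> Xspace s \<Omega> \<and>
    (\<forall>\<phi>\<in>Xspace s \<Omega>. \<forall>\<psi>\<in>Xspace s \<Omega>.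
       X_inner s u \<phi> + X_inner s v \<psi>
         - (LINT x:\<Omega>|lborel. (a * u x + b * v x) * \<phi> x + (b * u x + c * v x) * \<psi> x)
       = (LINT x:\<Omega>|lborel. (2*p/(p+q)) * (LINT y:\<Omega>|lborel. \<bar>v y\<bar> powr q / norm (x - y) powr \<mu>)
              * (\<bar>u x\<bar> powr (p - 2) * u x) * \<phi> x)
       + (LINT x:\<Omega>|lborel. (2*q/(p+q)) * (LINT y:\<Omega>|lborel. \<bar>u y\<bar> powr p / norm (x - y) powr \<mu>)
              * (\<bar>v x\<bar> powr (q - 2) * v x) * \<psi> x))"

end

theory Submission
  imports Defs "HOL-Complex_Analysis.Great_Picard"
begin

text \<open>
  Write \<open>B(u,v)\<close> for the double integral of \<open>|u(x)|^p |v(y)|^q / |x-y|^\<mu>\<close> over \<open>\<Omega> \<times> \<Omega>\<close> and \<open>Q(u,v)\<close> for the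
  quadratic form \<open>||u||^2 + ||v||^2 - \<integral>(A(u,v),(u,v))\<close>, which is coercive because the largest
  eigenvalue of \<open>A\<close> lies below the first Dirichlet eigenvalue.  Subcriticality makes \<open>B\<close> bounded and
  continuous along bounded sequences converging almost everywhere, so \<open>B\<close> attains its maximum \<open>S\<close> on
  \<open>Q \<le> 1\<close>; since \<open>b \<ge> 0\<close> the maximiser may be taken nonnegative.  By homogeneity
  \<open>B \<le> S Q^((p+q)/2)\<close>, and as \<open>B\<close> lies above its tangent in each variable (convexity of \<open>|t|^p\<close>),
  differentiating this inequality gives the Euler-Lagrange equations; a rescaling removes the
  multiplier.  Each component is then a nonnegative supersolution, and testing with
  \<open>\<eta> (1 - u/\<delta>)^+\<close> as \<open>\<delta> \<rightarrow> 0\<close> shows that it is positive almost everywhere in \<open>\<Omega>\<close>.  Changing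
  the solution on a null set makes it positive everywhere in \<open>\<Omega>\<close>.

  All estimates rest on one inequality: the distance of \<open>u(x)\<close> to the mean of \<open>u\<close> over a set near \<open>x\<close>
  is controlled by the inner Gagliardo integral at \<open>x\<close>.  Balls far from \<open>\<Omega>\<close> give the Poincare
  inequality, balls of a radius depending on \<open>u(x)\<close> give the critical Sobolev inequality, and small
  balls give Rellich compactness.
\<close>

section \<open>Radial integrals\<close>

text \<open>\<open>choq_int\<close> is homogeneous of degree p+q > 2 and \<open>QF\<close> of degree
  2, so maximising under a constraint on \<open>QF\<close> gives a solution up to a positive
  multiplier, and no mountain pass level or Palais-Smale condition enters. Both Euler-Lagrange
  equations carry the same factor S, and the weights 2p/(p+q) and 2q/(p+q) are proportional to those
  of the two partial derivatives of B; hence one scaling serves u and v together. The problem is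
  symmetric under exchanging (u, p, a) with (v, q, c), so the equation and the positivity are argued
  for the first component only. The energy is merely lower semicontinuous, which is why the
  constraint is \<open>\<le> 1\<close> and not \<open>= 1\<close>. Since B vanishes as soon as one
  argument does, S > 0 keeps both components away from zero. In the maximum principle the limit of
  the test functions need not lie in X; the limit is therefore taken inside the integrals by Fatou's
  lemma, with a majorant independent of \<delta>.\<close>

lemma term_le_suminf_ennreal: "f (k::nat) \<le> (\<Sum>k. f k :: ennreal)"
  using sum_le_suminf[of f "{k}"] by auto

lemma powr_le_two_powr:
  fixes t \<alpha> :: real
  assumes "1/2 \<le> t" "t \<le> 2"
  shows "t powr \<alpha> \<le> 2 powr \<bar>\<alpha>\<bar>"
proof -
  have t: "t > 0" using assms by simp
  have "\<bar>ln t\<bar> \<le> ln 2"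
  proof -
    have "ln t \<le> ln 2" using assms t by simp
    moreover have "ln (1/2) \<le> ln t" using assms t by (subst ln_le_cancel_iff) auto
    ultimately show ?thesis by (simp add: ln_div)
  qed
  then have "\<bar>\<alpha>\<bar> * \<bar>ln t\<bar> \<le> \<bar>\<alpha>\<bar> * ln 2" by (intro mult_left_mono) auto
  then have "\<alpha> * ln t \<le> \<bar>\<alpha>\<bar> * ln 2" using abs_ge_self[of "\<alpha> * ln t"] by (simp add: abs_mult)
  then show ?thesis using t by (simp add: powr_def)
qed

text \<open>On the shell of radius about R h^k the kernel is comparable to (R h^k)^(-\<alpha>), and
  the surrounding ball has volume of order (R h^k)^N, so the contributions form a geometric series
  of ratio h^(N-\<alpha>). Shrinking shells (h = 1/2) treat the singularity and growing ones (h = 2)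
  the tail. The constant does not depend on the centre.\<close>

lemma nn_integral_dyadic_shells:
  fixes \<alpha> R h :: real
  assumes R: "R > 0" and h: "h > 0" and hN: "h powr (real DIM('a) - \<alpha>) < 1"
    and sh: "\<And>x y::'a::euclidean_space. y \<in> A x \<Longrightarrow> y \<noteq> x \<Longrightarrow> \<exists>k::nat. R * h ^ k / 2 \<le> norm (x - y) \<and> norm (x - y) < R * h ^ k"
  shows "\<exists>C\<ge>0. \<forall>x::'a. (\<integral>\<^sup>+y. ennreal (norm (x - y) powr -\<alpha>) * indicator (A x) y \<partial>lborel) \<le> ennreal C"
proof -
  define V where "V = unit_ball_vol (real DIM('a))"
  have V: "V \<ge> 0" unfolding V_def by simp
  \<comment> \<open>\<open>c k\<close> bounds the kernel on shell k; \<open>g k\<close> is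
    \<open>c k\<close> times the volume of the full ball of radius \<open>R * h^k\<close>. Replacing
    shells by balls overcounts harmlessly.\<close>
  define c where "c k = 2 powr \<bar>\<alpha>\<bar> * (R * h^k) powr - \<alpha>" for k
  define g where "g k = 2 powr \<bar>\<alpha>\<bar> * V * R powr (real DIM('a) - \<alpha>) * (h powr (real DIM('a) - \<alpha>)) ^ k" for k
  have cg: "c k * (V * (R * h^k) ^ DIM('a)) = g k" for k
  proof -
    have p: "R * h^k > 0" using R h by simp
    have "(R * h^k) powr -\<alpha> * (R * h^k) ^ DIM('a) = (R * h^k) powr (real DIM('a) - \<alpha>)"
      using p by (simp only: powr_realpow[OF p, symmetric] powr_add[symmetric]) (simp add: algebra_simps)
    also have "\<dots> = R powr (real DIM('a) - \<alpha>) * (h powr (real DIM('a) - \<alpha>)) ^ k"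
    proof -
      have "(h^k) powr (real DIM('a) - \<alpha>) = (h powr (real DIM('a) - \<alpha>)) ^ k"
        using h by (metis powr_power zero_less_power powr_powr powr_realpow powr_gt_zero mult.commute)
      then show ?thesis using R h by (simp add: powr_mult)
    qed
    finally show ?thesis unfolding c_def g_def by (simp add: algebra_simps)
  qed
  have g0: "g k \<ge> 0" for k unfolding g_def using V by simp
  have gs: "summable g" unfolding g_def using hN by (intro summable_mult summable_geometric) simp
  show ?thesis
  proof (intro exI[of _ "suminf g"] conjI allI)
    show "0 \<le> suminf g" by (intro suminf_nonneg gs g0)
    fix x :: 'a
    have "(\<integral>\<^sup>+y. ennreal (norm (x - y) powr -\<alpha>) * indicator (A x) y \<partial>lborel)
        \<le> (\<integral>\<^sup>+y. (\<Sum>k. ennreal (c k) * indicator (ball x (R * h ^ k)) y) \<partial>lborel)"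
    proof (rule nn_integral_mono)
      fix y :: 'a
      show "ennreal (norm (x - y) powr -\<alpha>) * indicator (A x) y \<le> (\<Sum>k. ennreal (c k) * indicator (ball x (R * h ^ k)) y)"
      proof (cases "y \<in> A x \<and> y \<noteq> x")
        case True
        then obtain k where k: "R * h ^ k / 2 \<le> norm (x - y)" "norm (x - y) < R * h ^ k"
          using sh by blast
        define t where "t = norm (x - y) / (R * h^k)"
        have p: "R * h^k > 0" using R h by simp
        have "t powr -\<alpha> \<le> 2 powr \<bar>\<alpha>\<bar>"
          using powr_le_two_powr[of t "-\<alpha>"] k p unfolding t_def by (simp add: field_simps)
        moreover have "norm (x - y) powr -\<alpha> = t powr -\<alpha> * (R * h^k) powr -\<alpha>"
          unfolding t_def using p R h by (subst powr_mult[symmetric]) auto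
        ultimately have "norm (x - y) powr -\<alpha> \<le> c k"
          unfolding c_def by (simp add: mult_right_mono)
        then have "ennreal (norm (x - y) powr -\<alpha>) * indicator (A x) y \<le> ennreal (c k) * indicator (ball x (R * h ^ k)) y"
          using k by (auto simp: dist_norm indicator_def intro!: ennreal_leI)
        also have "\<dots> \<le> (\<Sum>k. ennreal (c k) * indicator (ball x (R * h ^ k)) y)"
          by (rule term_le_suminf_ennreal)
        finally show ?thesis .
      qed auto
    qed
    also have "\<dots> = (\<Sum>k. \<integral>\<^sup>+y. ennreal (c k) * indicator (ball x (R * h ^ k)) y \<partial>lborel)"
      by (rule nn_integral_suminf, intro borel_measurable_times_ennreal borel_measurable_const borel_measurable_indicator) simp
    also have "\<dots> = (\<Sum>k. ennreal (g k))"
    proof (intro suminf_cong)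
      fix k
      have p: "R * h^k > 0" using R h by simp
      have "(\<integral>\<^sup>+y. ennreal (c k) * indicator (ball x (R * h ^ k)) y \<partial>lborel) = ennreal (c k) * ennreal (V * (R * h^k)^DIM('a))"
        using p by (simp add: nn_integral_cmult_indicator emeasure_ball V_def less_imp_le)
      also have "\<dots> = ennreal (g k)"
        unfolding cg[symmetric] by (rule ennreal_mult[symmetric]) (use p V in \<open>auto simp: c_def\<close>)
      finally show "(\<integral>\<^sup>+y. ennreal (c k) * indicator (ball x (R * h ^ k)) y \<partial>lborel) = ennreal (g k)" .
    qed
    also have "\<dots> = ennreal (suminf g)"
      by (rule suminf_ennreal2) (use g0 gs in auto)
    finally show "(\<integral>\<^sup>+y. ennreal (norm (x - y) powr -\<alpha>) * indicator (A x) y \<partial>lborel) \<le> ennreal (suminf g)" .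
  qed
qed

lemma nn_integral_powr_ball:
  fixes \<alpha> R :: real
  assumes R: "R > 0" and \<alpha>: "\<alpha> < real DIM('a::euclidean_space)"
  shows "\<exists>C\<ge>0. \<forall>x::'a. (\<integral>\<^sup>+y. ennreal (norm (x - y) powr -\<alpha>) * indicator (ball x R) y \<partial>lborel) \<le> ennreal C"
proof (rule nn_integral_dyadic_shells[where h = "1/2" and R = R])
  show "(1/2) powr (real DIM('a) - \<alpha>) < (1::real)" using \<alpha> gr_one_powr[of 2 "real DIM('a) - \<alpha>"] by (simp add: powr_divide)
  fix x y :: 'a assume y: "y \<in> ball x R" "y \<noteq> x"
  define d where "d = norm (x - y)"
  have d: "d > 0" "d < R" using y by (auto simp: d_def dist_norm)
  \<comment> \<open>\<open>P k\<close> is the lower bound that defines shell k. At the least such k,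
    the failure of \<open>P\<close> one index earlier is exactly the upper bound; for k = 0 the
    upper bound is \<open>d < R\<close>.\<close>
  define P where "P k \<longleftrightarrow> R * (1/2)^(Suc k) \<le> d" for k
  obtain n where "(1/2)^n < d / R" using real_arch_pow_inv[of "d/R" "1/2"] d R by auto
  then have "P n" unfolding P_def using d R
    by (simp add: field_simps)
  define k where "k = (LEAST n. P n)"
  have k: "P k" unfolding k_def by (rule LeastI) fact
  have "d < R * (1/2)^k"
  proof (cases k)
    case (Suc j)
    then have "\<not> P j" unfolding k_def by (metis lessI not_less_Least)
    then show ?thesis unfolding P_def Suc by simp
  qed (use d in simp)
  then show "\<exists>k. R * (1/2)^k / 2 \<le> norm (x - y) \<and> norm (x - y) < R * (1/2)^k"
    using k unfolding P_def d_def by (intro exI[of _ k]) auto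
qed (use R in auto)

lemma nn_integral_powr_outside_ball:
  fixes \<beta> R :: real
  assumes R: "R > 0" and \<beta>: "\<beta> > real DIM('a::euclidean_space)"
  shows "\<exists>C\<ge>0. \<forall>x::'a. (\<integral>\<^sup>+y. ennreal (norm (x - y) powr -\<beta>) * indicator (- ball x R) y \<partial>lborel) \<le> ennreal C"
\<comment> \<open>With \<open>2 * R\<close> as base radius the zeroth shell is R \<le> |x-y| < 2R,
  so the shells start exactly at the boundary of the excluded ball.\<close>
proof (rule nn_integral_dyadic_shells[where h = 2 and R = "2 * R"])
  show "2 powr (real DIM('a) - \<beta>) < (1::real)" using \<beta> by (simp add: powr_less_one)
  fix x y :: 'a assume y: "y \<in> - ball x R" "y \<noteq> x"
  define d where "d = norm (x - y)"
  have d: "d \<ge> R" using y by (auto simp: d_def dist_norm)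
  define P where "P k \<longleftrightarrow> d < 2 * R * 2^k" for k
  obtain n where "d / R < 2^n" using real_arch_pow[of 2 "d/R"] by auto
  then have "P n" unfolding P_def using d R
    by (simp add: field_simps)
  define k where "k = (LEAST n. P n)"
  have k: "P k" unfolding k_def by (rule LeastI) fact
  have "R * 2^k \<le> d"
  proof (cases k)
    case (Suc j)
    then have "\<not> P j" unfolding k_def by (metis lessI not_less_Least)
    then show ?thesis unfolding P_def Suc by simp
  qed (use d in simp)
  then show "\<exists>k. 2 * R * 2^k / 2 \<le> norm (x - y) \<and> norm (x - y) < 2 * R * 2^k"
    using k unfolding P_def d_def by (intro exI[of _ k]) auto
qed (use R in auto)

section \<open>The space X\<close>

abbreviation lborel2 :: "('a::euclidean_space \<times> 'a) measure" where
  "lborel2 \<equiv> lborel \<Otimes>\<^sub>M lborel"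

abbreviation L2sq :: "('a::euclidean_space \<Rightarrow> real) \<Rightarrow> real" where
  "L2sq u \<equiv> \<integral>x. (u x)\<^sup>2 \<partial>lborel"

text \<open>A signed square root of the Gagliardo integrand. It turns the seminorm into an L2 norm
  over \<open>lborel2\<close> and \<open>X_inner\<close> into the corresponding L2 product, so
  algebra and limits in X reduce to pointwise statements. Its value on the diagonal is 0.\<close>

definition gag_quot :: "real \<Rightarrow> ('a::euclidean_space \<Rightarrow> real) \<Rightarrow> 'a \<times> 'a \<Rightarrow> real" where
  "gag_quot s u z = (u (fst z) - u (snd z)) / norm (fst z - snd z) powr ((real DIM('a) + 2 * s) / 2)"

lemma gag_quot_mult:
  "gag_quot s u z * gag_quot s v z =
    (u (fst z) - u (snd z)) * (v (fst z) - v (snd z)) / norm (fst z - snd z :: 'a::euclidean_space) powr (real DIM('a) + 2 * s)"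
  unfolding gag_quot_def by (simp add: powr_add[symmetric])

lemma gag_quot_sq:
  "(gag_quot s u z)\<^sup>2 = (u (fst z) - u (snd z))\<^sup>2 / norm (fst z - snd z :: 'a::euclidean_space) powr (real DIM('a) + 2 * s)"
  unfolding power2_eq_square by (rule gag_quot_mult)

lemma measurable_gag_quot [measurable]:
  fixes u :: "'a::euclidean_space \<Rightarrow> real"
  assumes [measurable]: "u \<in> borel_measurable borel"
  shows "gag_quot s u \<in> borel_measurable lborel2"
proof -
  have [measurable]: "u \<in> borel_measurable lborel" by simp
  show ?thesis unfolding gag_quot_def by measurable
qed

lemma integrable_mult_of_sq:
  fixes f g :: "'a \<Rightarrow> real"
  assumes [measurable]: "f \<in> borel_measurable M" "g \<in> borel_measurable M"
    and "integrable M (\<lambda>x. (f x)\<^sup>2)" "integrable M (\<lambda>x. (g x)\<^sup>2)"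
  shows "integrable M (\<lambda>x. f x * g x)"
proof (rule Bochner_Integration.integrable_bound)
  show "integrable M (\<lambda>x. (f x)\<^sup>2 + (g x)\<^sup>2)" using assms by simp
  show "AE x in M. norm (f x * g x) \<le> norm ((f x)\<^sup>2 + (g x)\<^sup>2)"
  proof (rule AE_I2)
    fix x
    have "2 * \<bar>f x\<bar> * \<bar>g x\<bar> \<le> \<bar>f x\<bar>\<^sup>2 + \<bar>g x\<bar>\<^sup>2" by (rule sum_squares_bound)
    moreover have "0 \<le> \<bar>f x\<bar> * \<bar>g x\<bar>" by simp
    ultimately have "\<bar>f x\<bar> * \<bar>g x\<bar> \<le> \<bar>f x\<bar>\<^sup>2 + \<bar>g x\<bar>\<^sup>2" by linarith
    then show "norm (f x * g x) \<le> norm ((f x)\<^sup>2 + (g x)\<^sup>2)" by (simp add: abs_mult)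
  qed
qed simp

lemma gagliardo_sq_pair:
  fixes u :: "'a::euclidean_space \<Rightarrow> real"
  assumes [measurable]: "u \<in> borel_measurable borel"
  shows "gagliardo_sq s u = (\<integral>\<^sup>+ z. ennreal ((gag_quot s u z)\<^sup>2) \<partial>lborel2)"
proof -
  have "(\<integral>\<^sup>+ x. \<integral>\<^sup>+ y. ennreal ((gag_quot s u (x, y))\<^sup>2) \<partial>lborel \<partial>lborel)
      = (\<integral>\<^sup>+ z. ennreal ((gag_quot s u z)\<^sup>2) \<partial>lborel2)"
    by (rule lborel.nn_integral_fst) measurable
  then show ?thesis unfolding gagliardo_sq_def gag_quot_sq by simp
qed

lemma gagliardo_sq_finite_iff:
  fixes u :: "'a::euclidean_space \<Rightarrow> real"
  assumes [measurable]: "u \<in> borel_measurable borel"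
  shows "gagliardo_sq s u < \<infinity> \<longleftrightarrow> integrable lborel2 (\<lambda>z. (gag_quot s u z)\<^sup>2)"
  unfolding gagliardo_sq_pair[OF assms] by (subst integrable_iff_bounded) simp

lemma X_norm_sq_eq:
  fixes u :: "'a::euclidean_space \<Rightarrow> real"
  assumes [measurable]: "u \<in> borel_measurable borel"
  shows "X_norm_sq s u = (\<integral> z. (gag_quot s u z)\<^sup>2 \<partial>lborel2)"
  unfolding X_norm_sq_def gagliardo_sq_pair[OF assms] by (subst integral_eq_nn_integral) auto

lemma X_inner_eq:
  "X_inner s u v = (\<integral> z. gag_quot s u z * gag_quot s v z \<partial>lborel2)"
  unfolding X_inner_def gag_quot_mult ..

lemma X_norm_sq_nonneg: "X_norm_sq s u \<ge> 0"
  unfolding X_norm_sq_def by simp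

lemma Xspace_iff:
  "u \<in> Xspace s \<Omega> \<longleftrightarrow> u \<in> borel_measurable borel \<and> integrable lborel (\<lambda>x. (u x)\<^sup>2) \<and>
     integrable lborel2 (\<lambda>z. (gag_quot s u z)\<^sup>2) \<and> (AE x in lborel. x \<notin> \<Omega> \<longrightarrow> u x = 0)"
  unfolding Xspace_def frac_sobolev_def using gagliardo_sq_finite_iff[of u s] by auto

lemma Xspace_borel: "u \<in> Xspace s \<Omega> \<Longrightarrow> u \<in> borel_measurable borel"
  by (simp add: Xspace_iff)

lemma Xspace_sq: "u \<in> Xspace s \<Omega> \<Longrightarrow> integrable lborel (\<lambda>x. (u x)\<^sup>2)"
  by (simp add: Xspace_iff)

lemma Xspace_gag: "u \<in> Xspace s \<Omega> \<Longrightarrow> integrable lborel2 (\<lambda>z. (gag_quot s u z)\<^sup>2)"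
  by (simp add: Xspace_iff)

lemma Xspace_AE: "u \<in> Xspace s \<Omega> \<Longrightarrow> AE x in lborel. x \<notin> \<Omega> \<longrightarrow> u x = 0"
  by (simp add: Xspace_iff)

lemma gagliardo_sq_Xspace: "u \<in> Xspace s \<Omega> \<Longrightarrow> gagliardo_sq s u = ennreal (X_norm_sq s u)"
  unfolding X_norm_sq_def Xspace_def frac_sobolev_def by (simp add: less_top)

lemma Xspace_gag_mult:
  assumes "u \<in> Xspace s \<Omega>" "v \<in> Xspace s \<Omega>"
  shows "integrable lborel2 (\<lambda>z. gag_quot s u z * gag_quot s v z)"
  by (intro integrable_mult_of_sq measurable_gag_quot Xspace_borel[OF assms(1)] Xspace_borel[OF assms(2)]
      Xspace_gag[OF assms(1)] Xspace_gag[OF assms(2)])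

lemma Xspace_mult:
  assumes "u \<in> Xspace s \<Omega>" "v \<in> Xspace s \<Omega>"
  shows "integrable lborel (\<lambda>z. u z * v z)"
  using assms by (intro integrable_mult_of_sq) (auto simp: Xspace_iff)

lemma sq_sum_le: "((x::real) + y)\<^sup>2 \<le> 2 * x\<^sup>2 + 2 * y\<^sup>2"
  using sum_squares_bound[of x y] by (simp add: power2_sum)

text \<open>Bounds on values and on differences pass to squares and to squared quotients. Two
  dominating functions are allowed because sums, and products of a fixed function with a Lipschitz
  function of \<open>u\<close>, are controlled by both factors at once.\<close>

lemma Xspace_dominated:
  fixes w :: "'a::euclidean_space \<Rightarrow> real"
  assumes u: "u \<in> Xspace s \<Omega>" and v: "v \<in> Xspace s \<Omega>"
    and [measurable]: "w \<in> borel_measurable borel"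
    and le: "\<And>x. \<bar>w x\<bar> \<le> C * (\<bar>u x\<bar> + \<bar>v x\<bar>)"
    and dif: "\<And>x y. \<bar>w x - w y\<bar> \<le> C * (\<bar>u x - u y\<bar> + \<bar>v x - v y\<bar>)"
  shows "w \<in> Xspace s \<Omega>"
  unfolding Xspace_iff
proof (intro conjI)
  have bd: "r\<^sup>2 \<le> 2 * C\<^sup>2 * a\<^sup>2 + 2 * C\<^sup>2 * b\<^sup>2" if "\<bar>r\<bar> \<le> C * (\<bar>a\<bar> + \<bar>b\<bar>)" for a b r :: real
  proof -
    have "r\<^sup>2 \<le> (C * (\<bar>a\<bar> + \<bar>b\<bar>))\<^sup>2" using that by (metis abs_ge_zero power2_abs power_mono)
    also have "\<dots> = C\<^sup>2 * (\<bar>a\<bar> + \<bar>b\<bar>)\<^sup>2" by (simp add: power_mult_distrib)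
    also have "\<dots> \<le> C\<^sup>2 * (2 * a\<^sup>2 + 2 * b\<^sup>2)"
      using sq_sum_le[of "\<bar>a\<bar>" "\<bar>b\<bar>"] by (intro mult_left_mono) auto
    finally show ?thesis by (simp add: algebra_simps)
  qed
  show "integrable lborel (\<lambda>x. (w x)\<^sup>2)"
  proof (rule Bochner_Integration.integrable_bound)
    show "integrable lborel (\<lambda>x. 2 * C\<^sup>2 * (u x)\<^sup>2 + 2 * C\<^sup>2 * (v x)\<^sup>2)"
      by (intro Bochner_Integration.integrable_add integrable_mult_right Xspace_sq[OF u] Xspace_sq[OF v])
    show "AE x in lborel. norm ((w x)\<^sup>2) \<le> norm (2 * C\<^sup>2 * (u x)\<^sup>2 + 2 * C\<^sup>2 * (v x)\<^sup>2)"
      using bd[OF le] by (intro AE_I2) (simp add: order_trans[OF _ abs_ge_self])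
  qed simp
  show "integrable lborel2 (\<lambda>z. (gag_quot s w z)\<^sup>2)"
  proof (rule Bochner_Integration.integrable_bound)
    show "integrable lborel2 (\<lambda>x. 2 * C\<^sup>2 * (gag_quot s u x)\<^sup>2 + 2 * C\<^sup>2 * (gag_quot s v x)\<^sup>2)"
      by (intro Bochner_Integration.integrable_add integrable_mult_right Xspace_gag[OF u] Xspace_gag[OF v])
    show "AE x in lborel2. norm ((gag_quot s w x)\<^sup>2) \<le> norm (2 * C\<^sup>2 * (gag_quot s u x)\<^sup>2 + 2 * C\<^sup>2 * (gag_quot s v x)\<^sup>2)"
    proof (rule AE_I2)
      fix z
      have "\<bar>gag_quot s w z\<bar> \<le> C * (\<bar>gag_quot s u z\<bar> + \<bar>gag_quot s v z\<bar>)"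
        using divide_right_mono[OF dif[of "fst z" "snd z"], of "norm (fst z - snd z) powr ((real DIM('a) + 2 * s) / 2)"]
        unfolding gag_quot_def by (simp add: add_divide_distrib[symmetric])
      from bd[OF this] show "norm ((gag_quot s w z)\<^sup>2) \<le> norm (2 * C\<^sup>2 * (gag_quot s u z)\<^sup>2 + 2 * C\<^sup>2 * (gag_quot s v z)\<^sup>2)"
        by (simp add: order_trans[OF _ abs_ge_self])
    qed
  qed measurable
  show "AE x in lborel. x \<notin> \<Omega> \<longrightarrow> w x = 0"
    using Xspace_AE[OF u] Xspace_AE[OF v]
  proof eventually_elim
    case (elim x) then show ?case using le[of x] by auto
  qed
qed simp

lemma Xspace_add_mult:
  assumes u: "u \<in> Xspace s \<Omega>" and v: "v \<in> Xspace s \<Omega>"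
  shows "(\<lambda>x. c * u x + d * v x) \<in> Xspace s \<Omega>"
proof (rule Xspace_dominated[OF u v, where C = "\<bar>c\<bar> + \<bar>d\<bar>"])
  have [measurable]: "u \<in> borel_measurable borel" "v \<in> borel_measurable borel"
    using u v by (auto intro: Xspace_borel)
  show "(\<lambda>x. c * u x + d * v x) \<in> borel_measurable borel" by measurable
  have *: "\<bar>c * a + d * b\<bar> \<le> (\<bar>c\<bar> + \<bar>d\<bar>) * (\<bar>a\<bar> + \<bar>b\<bar>)" for a b :: real
  proof -
    have "\<bar>c * a + d * b\<bar> \<le> \<bar>c\<bar> * \<bar>a\<bar> + \<bar>d\<bar> * \<bar>b\<bar>" by (metis abs_mult abs_triangle_ineq)
    moreover have "0 \<le> \<bar>c\<bar> * \<bar>b\<bar>" "0 \<le> \<bar>d\<bar> * \<bar>a\<bar>" by auto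
    ultimately show ?thesis unfolding distrib_left distrib_right by linarith
  qed
  show "\<bar>c * u x + d * v x\<bar> \<le> (\<bar>c\<bar> + \<bar>d\<bar>) * (\<bar>u x\<bar> + \<bar>v x\<bar>)" for x by (rule *)
  show "\<bar>c * u x + d * v x - (c * u y + d * v y)\<bar> \<le> (\<bar>c\<bar> + \<bar>d\<bar>) * (\<bar>u x - u y\<bar> + \<bar>v x - v y\<bar>)" for x y
    using *[of "u x - u y" "v x - v y"] by (simp add: algebra_simps)
qed

lemma Xspace_cmult: "u \<in> Xspace s \<Omega> \<Longrightarrow> (\<lambda>x. c * u x) \<in> Xspace s \<Omega>"
  using Xspace_add_mult[of u s \<Omega> u c 0] by simp

lemma Xspace_abs:
  assumes u: "u \<in> Xspace s \<Omega>"
  shows "(\<lambda>x. \<bar>u x\<bar>) \<in> Xspace s \<Omega>"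
proof (rule Xspace_dominated[OF u u, where C = 1])
  have [measurable]: "u \<in> borel_measurable borel" using u by (auto intro: Xspace_borel)
  show "(\<lambda>x. \<bar>u x\<bar>) \<in> borel_measurable borel" by measurable
  show "\<bar>\<bar>u x\<bar> - \<bar>u y\<bar>\<bar> \<le> 1 * (\<bar>u x - u y\<bar> + \<bar>u x - u y\<bar>)" for x y
    by (rule order_trans[OF abs_triangle_ineq3]) simp
qed simp

text \<open>Normal contractions do not increase the energy. The instances of interest are the
  absolute value and the truncation of |u| at a height.\<close>

lemma X_norm_sq_mono:
  fixes w :: "'a::euclidean_space \<Rightarrow> real"
  assumes u: "u \<in> Xspace s \<Omega>" and w: "w \<in> borel_measurable borel"
    and dif: "\<And>x y. \<bar>w x - w y\<bar> \<le> \<bar>u x - u y\<bar>"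
  shows "X_norm_sq s w \<le> X_norm_sq s u"
  unfolding X_norm_sq_eq[OF w] X_norm_sq_eq[OF Xspace_borel[OF u]]
proof (rule integral_mono')
  show "integrable lborel2 (\<lambda>z. (gag_quot s u z)\<^sup>2)" by (rule Xspace_gag[OF u])
  fix z
  have "\<bar>gag_quot s w z\<bar> \<le> \<bar>gag_quot s u z\<bar>"
    using divide_right_mono[OF dif[of "fst z" "snd z"], of "norm (fst z - snd z) powr ((real DIM('a) + 2 * s) / 2)"]
    unfolding gag_quot_def by simp
  then show "(gag_quot s w z)\<^sup>2 \<le> (gag_quot s u z)\<^sup>2" by (simp add: abs_le_square_iff)
qed simp

lemma X_norm_sq_cmult: "X_norm_sq s (\<lambda>x. c * u x) = c\<^sup>2 * X_norm_sq s u" if "u \<in> Xspace s \<Omega>" for u :: "'a::euclidean_space \<Rightarrow> real"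
proof -
  have "gag_quot s (\<lambda>x. c * u x) z = c * gag_quot s u z" for z
    unfolding gag_quot_def by (simp add: algebra_simps)
  then show ?thesis
    by (simp add: X_norm_sq_eq[OF Xspace_borel[OF Xspace_cmult[OF that]]] X_norm_sq_eq[OF Xspace_borel[OF that]] power_mult_distrib)
qed

lemma X_inner_cmult_left: "X_inner s (\<lambda>x. c * u x) v = c * X_inner s u v"
proof -
  have eq: "gag_quot s (\<lambda>x. c * u x) z * gag_quot s v z = c * (gag_quot s u z * gag_quot s v z)" for z
    unfolding gag_quot_def by (simp add: algebra_simps)
  show ?thesis unfolding X_inner_eq eq by simp
qed

lemma X_norm_sq_add:
  fixes u \<phi> :: "'a::euclidean_space \<Rightarrow> real"
  assumes u: "u \<in> Xspace s \<Omega>" and p: "\<phi> \<in> Xspace s \<Omega>"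
  shows "X_norm_sq s (\<lambda>x. u x + t * \<phi> x) = X_norm_sq s u + 2 * t * X_inner s u \<phi> + t\<^sup>2 * X_norm_sq s \<phi>"
proof -
  have [measurable]: "u \<in> borel_measurable borel" "\<phi> \<in> borel_measurable borel"
    using u p by (auto intro: Xspace_borel)
  have m: "(\<lambda>x. u x + t * \<phi> x) \<in> borel_measurable borel" by measurable
  have eq: "(gag_quot s (\<lambda>x. u x + t * \<phi> x) z)\<^sup>2 = (gag_quot s u z)\<^sup>2 + 2 * t * (gag_quot s u z * gag_quot s \<phi> z) + t\<^sup>2 * (gag_quot s \<phi> z)\<^sup>2" for z
  proof -
    have "gag_quot s (\<lambda>x. u x + t * \<phi> x) z = gag_quot s u z + t * gag_quot s \<phi> z"
      unfolding gag_quot_def by (simp add: algebra_simps add_divide_distrib diff_divide_distrib)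
    then show ?thesis by (simp add: power2_eq_square algebra_simps)
  qed
  show ?thesis
    unfolding X_norm_sq_eq[OF m] eq X_inner_eq X_norm_sq_eq[OF Xspace_borel[OF u]] X_norm_sq_eq[OF Xspace_borel[OF p]]
    using Xspace_gag[OF u] Xspace_gag[OF p] Xspace_gag_mult[OF u p] by simp
qed

section \<open>Deviation from averages\<close>

text \<open>Fatou's lemma with bounds that may vary along the sequence. Convergent bounds express
  lower semicontinuity of the energy; constant ones give the variant
  \<open>nn_integral_le_of_tendsto\<close>.\<close>

lemma nn_integral_le_limit:
  fixes f :: "nat \<Rightarrow> 'a \<Rightarrow> ennreal"
  assumes [measurable]: "\<And>n. f n \<in> borel_measurable M"
    and lim: "AE x in M. (\<lambda>n. f n x) \<longlonglongrightarrow> g x"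
    and le: "\<And>n. (\<integral>\<^sup>+x. f n x \<partial>M) \<le> c n" and c: "c \<longlonglongrightarrow> C"
  shows "(\<integral>\<^sup>+x. g x \<partial>M) \<le> C"
proof -
  have "(\<integral>\<^sup>+x. g x \<partial>M) = (\<integral>\<^sup>+x. liminf (\<lambda>n. f n x) \<partial>M)"
  proof (rule nn_integral_cong_AE)
    show "AE x in M. g x = liminf (\<lambda>n. f n x)"
      using lim by eventually_elim (simp add: lim_imp_Liminf)
  qed
  also have "\<dots> \<le> liminf (\<lambda>n. \<integral>\<^sup>+x. f n x \<partial>M)" by (rule nn_integral_liminf) simp
  also have "\<dots> \<le> liminf c" using le by (intro Liminf_mono) auto
  also have "\<dots> = C" by (rule lim_imp_Liminf[OF sequentially_bot c])
  finally show ?thesis .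
qed

lemmas nn_integral_le_of_tendsto = nn_integral_le_limit[OF _ _ _ tendsto_const]

section \<open>Lipschitz functions in X and a positive bounded one\<close>

lemma Lipschitz_in_Xspace:
  fixes \<eta> :: "'a::euclidean_space \<Rightarrow> real"
  assumes s: "0 < s" "s < 1" and \<Omega>: "bounded \<Omega>" "open \<Omega>"
    and L: "\<And>x y. \<bar>\<eta> x - \<eta> y\<bar> \<le> norm (x - y)"
    and B: "\<And>x. \<bar>\<eta> x\<bar> \<le> B" and z: "\<And>x. x \<notin> \<Omega> \<Longrightarrow> \<eta> x = 0"
  shows "\<eta> \<in> Xspace s \<Omega>"
proof -
  have [measurable]: "\<Omega> \<in> sets borel" using \<Omega> by auto
  have "continuous_on UNIV \<eta>"
    unfolding continuous_on_iff dist_norm real_norm_def by (metis L norm_minus_commute order_le_less_trans)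
  then have m[measurable]: "\<eta> \<in> borel_measurable borel" by (rule borel_measurable_continuous_onI)
  have fin: "emeasure lborel \<Omega> < \<infinity>" using emeasure_bounded_finite[OF \<Omega>(1)] by simp
  have B0: "B \<ge> 0" using B[of 0] by simp
  have sq: "integrable lborel (\<lambda>x. (\<eta> x)\<^sup>2)"
  proof (rule Bochner_Integration.integrable_bound)
    show "integrable lborel (\<lambda>x. B\<^sup>2 * indicator \<Omega> x)" using fin by auto
    show "AE x in lborel. norm ((\<eta> x)\<^sup>2) \<le> norm (B\<^sup>2 * indicator \<Omega> x)"
    proof (rule AE_I2)
      fix x show "norm ((\<eta> x)\<^sup>2) \<le> norm (B\<^sup>2 * indicator \<Omega> x)"
        using z[of x] B[of x] B0 by (cases "x \<in> \<Omega>") (auto simp: abs_le_square_iff[symmetric])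
    qed
  qed simp
  \<comment> \<open>The exponent \<alpha> comes from the Lipschitz bound near the diagonal and is
    below N because s < 1; \<beta> comes from boundedness far from the diagonal and exceeds N
    because s > 0.\<close>
  define \<alpha> where "\<alpha> = real DIM('a) + 2 * s - 2"
  define \<beta> where "\<beta> = real DIM('a) + 2 * s"
  obtain C1 where C1: "C1 \<ge> 0" "\<And>x::'a. (\<integral>\<^sup>+y. ennreal (norm (x - y) powr -\<alpha>) * indicator (ball x 1) y \<partial>lborel) \<le> ennreal C1"
    using nn_integral_powr_ball[of 1 \<alpha>, where 'a='a] s unfolding \<alpha>_def by auto
  obtain C2 where C2: "C2 \<ge> 0" "\<And>x::'a. (\<integral>\<^sup>+y. ennreal (norm (x - y) powr -\<beta>) * indicator (- ball x 1) y \<partial>lborel) \<le> ennreal C2"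
    using nn_integral_powr_outside_ball[of 1 \<beta>, where 'a='a] s unfolding \<beta>_def by auto
  define F where "F z = ennreal (norm (fst z - snd z) powr -\<alpha>) * indicator (ball (fst z) 1) (snd z)
      + ennreal (4 * B\<^sup>2) * (ennreal (norm (fst z - snd z) powr -\<beta>) * indicator (- ball (fst z) 1) (snd z))" for z :: "'a \<times> 'a"
  have ballset: "{z. snd z \<in> ball (fst z) 1} \<in> sets (lborel \<Otimes>\<^sub>M (lborel :: 'a measure))"
  proof -
    have "{z \<in> space (lborel \<Otimes>\<^sub>M (lborel :: 'a measure)). norm (fst z - snd z) < 1} \<in> sets (lborel \<Otimes>\<^sub>M (lborel :: 'a measure))"
      by measurable
    then show ?thesis by (simp add: space_pair_measure dist_norm)
  qed
  have ballset': "{z. snd z \<in> - ball (fst z) 1} \<in> sets (lborel \<Otimes>\<^sub>M (lborel :: 'a measure))"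
  proof -
    have "{z \<in> space (lborel \<Otimes>\<^sub>M (lborel :: 'a measure)). \<not> norm (fst z - snd z) < 1} \<in> sets (lborel \<Otimes>\<^sub>M (lborel :: 'a measure))"
      by measurable
    then show ?thesis by (simp add: space_pair_measure dist_norm)
  qed
  have eq1: "(\<lambda>z. indicator (ball (fst z) 1) (snd z) :: ennreal) = indicator {z::'a\<times>'a. snd z \<in> ball (fst z) (1::real)}"
    by (auto simp: indicator_def)
  have ind1[measurable]: "(\<lambda>z. indicator (ball (fst z) 1) (snd z) :: ennreal) \<in> borel_measurable (lborel \<Otimes>\<^sub>M (lborel :: 'a measure))"
    by (subst eq1) (rule borel_measurable_indicator[OF ballset])
  have eq2: "(\<lambda>z. indicator (- ball (fst z) 1) (snd z) :: ennreal) = indicator {z::'a\<times>'a. snd z \<in> - ball (fst z) (1::real)}"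
    by (auto simp: indicator_def)
  have ind2[measurable]: "(\<lambda>z. indicator (- ball (fst z) 1) (snd z) :: ennreal) \<in> borel_measurable (lborel \<Otimes>\<^sub>M (lborel :: 'a measure))"
    by (subst eq2) (rule borel_measurable_indicator[OF ballset'])
  have Fm[measurable]: "F \<in> borel_measurable lborel2"
    unfolding F_def by measurable
  have Fsym: "F (x, y) = F (y, x)" for x y
    unfolding F_def by (simp add: norm_minus_commute dist_commute indicator_def)
  have FC: "(\<integral>\<^sup>+y. F (x, y) \<partial>lborel) \<le> ennreal (C1 + 4 * B\<^sup>2 * C2)" for x
  proof -
    have [measurable]: "(\<lambda>y. indicator (ball x 1) y :: ennreal) \<in> borel_measurable lborel"
       "(\<lambda>y. indicator (- ball x 1) y :: ennreal) \<in> borel_measurable lborel"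
      by (intro borel_measurable_indicator, simp)+
    have "(\<integral>\<^sup>+y. F (x, y) \<partial>lborel) = (\<integral>\<^sup>+y. ennreal (norm (x - y) powr -\<alpha>) * indicator (ball x 1) y \<partial>lborel) +
        ennreal (4 * B\<^sup>2) * (\<integral>\<^sup>+y. ennreal (norm (x - y) powr -\<beta>) * indicator (- ball x 1) y \<partial>lborel)"
      unfolding F_def fst_conv snd_conv
      by (subst nn_integral_add, measurable, subst nn_integral_cmult) measurable
    also have "\<dots> \<le> ennreal C1 + ennreal (4 * B\<^sup>2) * ennreal C2"
      by (intro add_mono mult_left_mono C1 C2) auto
    also have "\<dots> = ennreal (C1 + 4 * B\<^sup>2 * C2)"
      using C1(1) C2(1) by (simp add: ennreal_mult ennreal_plus)
    finally show ?thesis .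
  qed
  define D where "D = ennreal (C1 + 4 * B\<^sup>2 * C2) * emeasure lborel \<Omega>"
  have D: "D < \<infinity>" unfolding D_def using fin by (simp add: ennreal_mult_less_top)
  have D1: "(\<integral>\<^sup>+x. (\<integral>\<^sup>+y. indicator \<Omega> x * F (x, y) \<partial>lborel) \<partial>lborel) \<le> D"
  proof -
    have "(\<integral>\<^sup>+x. (\<integral>\<^sup>+y. indicator \<Omega> x * F (x, y) \<partial>lborel) \<partial>lborel)
       = (\<integral>\<^sup>+x. indicator \<Omega> x * (\<integral>\<^sup>+y. F (x, y) \<partial>lborel) \<partial>lborel)"
      by (intro nn_integral_cong nn_integral_cmult) measurable
    also have "\<dots> \<le> (\<integral>\<^sup>+x. ennreal (C1 + 4 * B\<^sup>2 * C2) * indicator \<Omega> x \<partial>lborel)"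
      by (subst mult.commute, intro nn_integral_mono mult_right_mono FC) auto
    also have "\<dots> = D" unfolding D_def by (subst nn_integral_cmult_indicator) auto
    finally show ?thesis .
  qed
  \<comment> \<open>The integrand vanishes unless one of the two points lies in \<Omega>. By
    symmetry of \<open>F\<close> both alternatives contribute the same integral, bounded by
    \<open>D\<close> because \<Omega> has finite measure.\<close>
  have "gagliardo_sq s \<eta> \<le> (\<integral>\<^sup>+z. indicator \<Omega> (fst z) * F z + indicator \<Omega> (snd z) * F z \<partial>lborel2)"
    unfolding gagliardo_sq_pair[OF m]
  proof (rule nn_integral_mono)
    fix z :: "'a \<times> 'a"
    obtain x y where zz: "z = (x, y)" by (cases z)
    have le: "ennreal ((gag_quot s \<eta> z)\<^sup>2) \<le> F z"
    proof (cases "y \<in> ball x 1")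
      case True
      have "(gag_quot s \<eta> z)\<^sup>2 \<le> norm (x - y) powr -\<alpha>"
      proof (cases "x = y")
        case False
        have "(\<eta> x - \<eta> y)\<^sup>2 \<le> (norm (x - y))\<^sup>2"
          using L[of x y] by (simp add: abs_le_square_iff[symmetric])
        then have "(gag_quot s \<eta> z)\<^sup>2 \<le> (norm (x - y))\<^sup>2 / norm (x - y) powr (real DIM('a) + 2 * s)"
          unfolding gag_quot_sq zz by (simp add: divide_right_mono)
        also have "\<dots> = norm (x - y) powr -\<alpha>"
          unfolding \<alpha>_def using False powr_diff[of "norm (x - y)" 2 "real DIM('a) + 2 * s"] by simp
        finally show ?thesis .
      qed (simp add: zz gag_quot_def)
      then show ?thesis using True unfolding F_def zz by (simp add: ennreal_leI)
    next
      case False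
      then have xy: "x \<noteq> y" by auto
      have "\<bar>\<eta> x - \<eta> y\<bar> \<le> \<bar>2 * B\<bar>" using B[of x] B[of y] by linarith
      then have "(\<eta> x - \<eta> y)\<^sup>2 \<le> 4 * B\<^sup>2" unfolding abs_le_square_iff by (simp add: power_mult_distrib)
      then have "(gag_quot s \<eta> z)\<^sup>2 \<le> 4 * B\<^sup>2 / norm (x - y) powr \<beta>"
        unfolding gag_quot_sq zz \<beta>_def by (simp add: divide_right_mono)
      also have "\<dots> = 4 * B\<^sup>2 * norm (x - y) powr -\<beta>" by (simp add: powr_minus_divide)
      finally show ?thesis using False unfolding F_def zz
        by (simp add: ennreal_leI ennreal_mult[symmetric])
    qed
    show "ennreal ((gag_quot s \<eta> z)\<^sup>2) \<le> indicator \<Omega> (fst z) * F z + indicator \<Omega> (snd z) * F z"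
    proof (cases "x \<in> \<Omega> \<or> y \<in> \<Omega>")
      case True
      then show ?thesis
        by (intro order_trans[OF le]) (auto simp: zz indicator_def)
    next
      case False
      then have "gag_quot s \<eta> z = 0" using z by (simp add: zz gag_quot_def)
      then show ?thesis by simp
    qed
  qed
  also have "\<dots> = (\<integral>\<^sup>+z. indicator \<Omega> (fst z) * F z \<partial>lborel2) + (\<integral>\<^sup>+z. indicator \<Omega> (snd z) * F z \<partial>lborel2)"
    by (rule nn_integral_add) measurable
  also have "(\<integral>\<^sup>+z. indicator \<Omega> (fst z) * F z \<partial>lborel2) = (\<integral>\<^sup>+x. (\<integral>\<^sup>+y. indicator \<Omega> x * F (x, y) \<partial>lborel) \<partial>lborel)"
  proof -
    have "(\<lambda>z. indicator \<Omega> (fst z) * F z) \<in> borel_measurable lborel2" by measurable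
    from lborel.nn_integral_fst[OF this] show ?thesis by simp
  qed
  also have "(\<integral>\<^sup>+z. indicator \<Omega> (snd z) * F z \<partial>lborel2) = (\<integral>\<^sup>+x. (\<integral>\<^sup>+y. indicator \<Omega> x * F (x, y) \<partial>lborel) \<partial>lborel)"
  proof -
    have "(\<lambda>z. indicator \<Omega> (snd z) * F z) \<in> borel_measurable lborel2" by measurable
    from lborel_pair.nn_integral_snd[OF this]
    have "(\<integral>\<^sup>+z. indicator \<Omega> (snd z) * F z \<partial>lborel2) = (\<integral>\<^sup>+y. (\<integral>\<^sup>+x. indicator \<Omega> y * F (x, y) \<partial>lborel) \<partial>lborel)" by simp
    also have "\<dots> = (\<integral>\<^sup>+x. (\<integral>\<^sup>+y. indicator \<Omega> x * F (x, y) \<partial>lborel) \<partial>lborel)"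
      by (intro nn_integral_cong arg_cong2[where f="(*)"] refl Fsym)
    finally show ?thesis .
  qed
  also have "(\<integral>\<^sup>+x. (\<integral>\<^sup>+y. indicator \<Omega> x * F (x, y) \<partial>lborel) \<partial>lborel) + (\<integral>\<^sup>+x. (\<integral>\<^sup>+y. indicator \<Omega> x * F (x, y) \<partial>lborel) \<partial>lborel) \<le> D + D"
    by (intro add_mono D1)
  also have "\<dots> < \<infinity>" using D by (simp add: ennreal_add_less_top)
  finally have "gagliardo_sq s \<eta> < \<infinity>" .
  then show ?thesis
    unfolding Xspace_iff gagliardo_sq_finite_iff[OF m] using sq m z by auto
qed

text \<open>The distance to the complement, cut at 1, is 1-Lipschitz. It serves as a competitor
  showing that the maximum is positive and as the cut-off in the maximum principle.\<close>

lemma Xspace_positive_function: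
  fixes \<Omega> :: "'a::euclidean_space set"
  assumes s: "0 < s" "s < 1" and \<Omega>: "bounded \<Omega>" "open \<Omega>"
  shows "\<exists>\<eta> B. \<eta> \<in> Xspace s \<Omega> \<and> (\<forall>x\<in>\<Omega>. \<eta> x > 0) \<and> (\<forall>x. 0 \<le> \<eta> x \<and> \<eta> x \<le> B)"
proof -
  define \<eta> where "\<eta> x = min 1 (infdist x (- \<Omega>))" for x
  \<comment> \<open>\<open>infdist\<close> to the empty set is 0, so positivity in \<Omega> depends
    on a nonempty complement.\<close>
  have ne: "- \<Omega> \<noteq> {}" using \<Omega>(1) by (metis Compl_UNIV_eq Diff_cancel not_bounded_UNIV double_complement)
  have b: "0 \<le> \<eta> x" "\<eta> x \<le> 1" for x unfolding \<eta>_def by (auto simp: infdist_nonneg)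
  have "\<eta> \<in> Xspace s \<Omega>"
  proof (rule Lipschitz_in_Xspace[OF s \<Omega>, where B = 1])
    show "\<bar>\<eta> x - \<eta> y\<bar> \<le> norm (x - y)" for x y
      using infdist_triangle_abs[of x "- \<Omega>" y] unfolding \<eta>_def dist_norm by linarith
    show "\<bar>\<eta> x\<bar> \<le> 1" for x using b[of x] by simp
    show "\<eta> x = 0" if "x \<notin> \<Omega>" for x using that by (simp add: \<eta>_def)
  qed
  moreover have "\<eta> x > 0" if "x \<in> \<Omega>" for x
  proof -
    have "infdist x (- \<Omega>) \<noteq> 0"
      using that in_closed_iff_infdist_zero[of "- \<Omega>" x] ne \<Omega>(2) by auto
    then show ?thesis unfolding \<eta>_def using infdist_nonneg[of x "- \<Omega>"] by auto
  qed
  ultimately show ?thesis using b by blast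
qed

section \<open>The inner Gagliardo integral, deviation from a mean and the Poincare
  inequality\<close>

definition gag_fun :: "real \<Rightarrow> ('a::euclidean_space \<Rightarrow> real) \<Rightarrow> 'a \<Rightarrow> ennreal" where
  "gag_fun s u x = (\<integral>\<^sup>+y. ennreal ((gag_quot s u (x, y))\<^sup>2) \<partial>lborel)"

lemma measurable_gag_fun [measurable]:
  assumes [measurable]: "u \<in> borel_measurable borel"
  shows "gag_fun s u \<in> borel_measurable borel"
proof -
  have "(\<lambda>x. \<integral>\<^sup>+y. ennreal ((gag_quot s u (x, y))\<^sup>2) \<partial>lborel) \<in> borel_measurable lborel"
    by (rule lborel.borel_measurable_nn_integral_fst) measurable
  then show ?thesis unfolding gag_fun_def[abs_def] by simp
qed

lemma nn_integral_gag_fun: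
  assumes [measurable]: "u \<in> borel_measurable borel"
  shows "(\<integral>\<^sup>+x. gag_fun s u x \<partial>lborel) = gagliardo_sq s u"
  unfolding gag_fun_def gagliardo_sq_pair[OF assms] by (rule lborel.nn_integral_fst) measurable

text \<open>By Jensen's inequality the squared deviation is at most the mean over \<open>S\<close>
  of (u(x)-u(y))^2. Since |x-y| \<le> d on \<open>S\<close>, inserting the factor (d/|x-y|)^(N+2s)
  \<ge> 1 turns this mean into the inner Gagliardo integral.\<close>

lemma average_deviation_le:
  fixes u :: "'a::euclidean_space \<Rightarrow> real"
  assumes [measurable]: "u \<in> borel_measurable borel" and sq: "integrable lborel (\<lambda>x. (u x)\<^sup>2)"
    and S[measurable]: "S \<in> sets borel" and m: "emeasure lborel S = ennreal m" "m > 0"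
    and d: "\<And>y. y \<in> S \<Longrightarrow> norm (x - y) \<le> d" and s: "s \<ge> 0"
  shows "ennreal ((u x - (\<integral>y. u y * indicator S y \<partial>lborel) / m)\<^sup>2) \<le> ennreal (d powr (real DIM('a) + 2 * s) / m) * gag_fun s u x"
proof -
  have iS: "integrable lborel (indicator S :: 'a \<Rightarrow> real)" using m by simp
  have mS: "(\<integral>y. indicator S y \<partial>lborel) = m" using m by (simp add: measure_def)
  have iu: "integrable lborel (\<lambda>y. u y * indicator S y)"
  proof (rule integrable_mult_of_sq)
    have "(indicator S y :: real)\<^sup>2 = indicator S y" for y by (simp add: indicator_def)
    then show "integrable lborel (\<lambda>y. (indicator S y :: real)\<^sup>2)" using iS by simp
  qed (use sq in auto)
  have iu2: "integrable lborel (\<lambda>y. (u y)\<^sup>2 * indicator S y)"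
    using integrable_mult_indicator[OF _ sq, of S] by (simp add: mult.commute)
  define f where "f y = (u x - u y) * indicator S y" for y
  have f_eq: "f y = u x * indicator S y - u y * indicator S y" for y by (simp add: f_def algebra_simps)
  have fi: "integrable lborel f" unfolding f_eq[abs_def] using iS iu by simp
  have f2_eq: "(f y)\<^sup>2 = (u x)\<^sup>2 * indicator S y - 2 * u x * (u y * indicator S y) + (u y)\<^sup>2 * indicator S y" for y
    by (simp add: f_def indicator_def power2_eq_square algebra_simps)
  have f2i: "integrable lborel (\<lambda>y. (f y)\<^sup>2)" unfolding f2_eq[abs_def] using iS iu iu2 by simp
  define c where "c = u x - (\<integral>y. u y * indicator S y \<partial>lborel) / m"
  have If: "(\<integral>y. f y \<partial>lborel) = m * c"
    unfolding f_eq c_def using iS iu mS m by (simp add: field_simps)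
  \<comment> \<open>The integrand is (f-c)^2 on \<open>S\<close> and 0 elsewhere. As
    \<open>f\<close> has mean \<open>c\<close> on \<open>S\<close>, expanding gives Jensen's
    inequality.\<close>
  have "0 \<le> (\<integral>y. (f y)\<^sup>2 - 2 * c * f y + c\<^sup>2 * indicator S y \<partial>lborel)"
  proof (rule integral_nonneg_AE, rule AE_I2)
    fix y show "0 \<le> (f y)\<^sup>2 - 2 * c * f y + c\<^sup>2 * indicator S y"
    proof (cases "y \<in> S")
      case True
      then show ?thesis using zero_le_power2[of "f y - c"] by (simp add: power2_diff algebra_simps)
    qed (simp add: f_def)
  qed
  also have "\<dots> = (\<integral>y. (f y)\<^sup>2 \<partial>lborel) - m * c\<^sup>2"
    using fi f2i iS mS If by (simp add: power2_eq_square algebra_simps)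
  finally have le: "c\<^sup>2 \<le> (\<integral>y. (f y)\<^sup>2 \<partial>lborel) / m" using m by (simp add: field_simps)
  let ?D = "d powr (real DIM('a) + 2 * s)"
  have "ennreal (\<integral>y. (f y)\<^sup>2 \<partial>lborel) = (\<integral>\<^sup>+y. ennreal ((f y)\<^sup>2) \<partial>lborel)"
    by (rule nn_integral_eq_integral[symmetric, OF f2i]) simp
  also have "\<dots> \<le> (\<integral>\<^sup>+y. ennreal ?D * ennreal ((gag_quot s u (x, y))\<^sup>2) \<partial>lborel)"
  proof (rule nn_integral_mono)
    fix y
    show "ennreal ((f y)\<^sup>2) \<le> ennreal ?D * ennreal ((gag_quot s u (x, y))\<^sup>2)"
    proof (cases "y \<in> S \<and> x \<noteq> y")
      case True
      then have le: "norm (x - y) powr (real DIM('a) + 2 * s) \<le> ?D"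
        using d s by (intro powr_mono2) auto
      have pos: "norm (x - y) powr (real DIM('a) + 2 * s) > 0" using True by simp
      have "(f y)\<^sup>2 = norm (x - y) powr (real DIM('a) + 2 * s) * (gag_quot s u (x, y))\<^sup>2"
        using True pos unfolding gag_quot_sq by (simp add: f_def)
      also have "\<dots> \<le> ?D * (gag_quot s u (x, y))\<^sup>2"
        using le by (rule mult_right_mono) simp
      finally show ?thesis by (simp add: ennreal_mult[symmetric] ennreal_leI)
    qed (auto simp: f_def)
  qed
  also have "\<dots> = ennreal ?D * gag_fun s u x"
    unfolding gag_fun_def by (rule nn_integral_cmult) measurable
  finally have le2: "ennreal (\<integral>y. (f y)\<^sup>2 \<partial>lborel) \<le> ennreal ?D * gag_fun s u x" .
  have "ennreal (c\<^sup>2) \<le> ennreal ((\<integral>y. (f y)\<^sup>2 \<partial>lborel) * (1 / m))"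
    using le by (intro ennreal_leI) simp
  also have "\<dots> = ennreal (\<integral>y. (f y)\<^sup>2 \<partial>lborel) * ennreal (1 / m)"
    using m by (intro ennreal_mult) auto
  also have "\<dots> \<le> ennreal ?D * gag_fun s u x * ennreal (1 / m)"
    by (intro mult_right_mono le2) simp
  also have "\<dots> = ennreal (?D / m) * gag_fun s u x"
    using m by (simp add: divide_inverse ennreal_mult mult_ac)
  finally show ?thesis unfolding c_def .
qed

lemma fractional_Poincare:
  fixes \<Omega> :: "'a::euclidean_space set"
  assumes s: "0 < s" and \<Omega>: "bounded \<Omega>"
  shows "\<exists>C\<ge>0. \<forall>u\<in>Xspace s \<Omega>. L2sq u \<le> C * X_norm_sq s u"
proof -
  obtain R where R: "R > 0" "\<And>x. x \<in> \<Omega> \<Longrightarrow> norm x < R" using bounded_pos_less[THEN iffD1, OF \<Omega>] by auto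
  define e :: 'a where "e = (SOME i. i \<in> Basis)"
  have e: "e \<in> Basis" unfolding e_def by (rule SOME_Basis)
  \<comment> \<open>A unit ball centred at distance R+2 from the origin misses the ball of radius R
    containing \<Omega>, and each of its points is within 2R+3 of each point of \<Omega>. The mean
    of \<open>u\<close> over it is 0, so the deviation is \<open>u x\<close> itself.\<close>
  define p where "p = (R + 2) *\<^sub>R e"
  have np: "norm p = R + 2" using R e by (simp add: p_def)
  define S where "S = ball p 1"
  have S\<Omega>: "y \<notin> \<Omega>" if "y \<in> S" for y
  proof
    assume "y \<in> \<Omega>"
    then have "norm y < R" using R by auto
    moreover have "norm (p - y) < 1" using that by (simp add: S_def dist_norm)
    ultimately show False using np norm_triangle_sub[of p y] by linarith
  qed
  define m where "m = unit_ball_vol (real DIM('a))"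
  have m: "m > 0" "emeasure lborel S = ennreal m" unfolding m_def S_def by (auto simp: emeasure_ball)
  define D where "D = (2 * R + 3) powr (real DIM('a) + 2 * s) / m"
  have D: "D \<ge> 0" unfolding D_def using m by simp
  show ?thesis
  proof (intro exI[of _ D] conjI ballI D)
    fix u :: "'a \<Rightarrow> real" assume u: "u \<in> Xspace s \<Omega>"
    have um[measurable]: "u \<in> borel_measurable borel" by (rule Xspace_borel[OF u])
    have "(\<integral>y. u y * indicator S y \<partial>lborel) = (\<integral>y. 0 \<partial>(lborel::'a measure))"
    proof (rule integral_cong_AE)
      show "(\<lambda>y. u y * indicator S y) \<in> borel_measurable lborel" unfolding S_def by measurable auto
      show "AE y in lborel. u y * indicator S y = 0"
        using Xspace_AE[OF u] by eventually_elim (use S\<Omega> in \<open>auto simp: indicator_def\<close>)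
    qed simp
    then have av: "(\<integral>y. u y * indicator S y \<partial>lborel) = 0" by simp
    have pt: "ennreal ((u x)\<^sup>2) \<le> ennreal D * gag_fun s u x" if "x \<in> \<Omega>" for x
    proof -
      have "norm (x - y) \<le> 2 * R + 3" if "y \<in> S" for y
      proof -
        have "norm (p - y) < 1" using that by (simp add: S_def dist_norm)
        moreover have "norm x < R" using \<open>x \<in> \<Omega>\<close> R by auto
        moreover have "norm (x - y) \<le> norm x + norm (p - y) + norm p"
          using norm_triangle_ineq[of x "p - y"] norm_triangle_ineq4[of "x + (p - y)" p] by simp
        ultimately show ?thesis using np by linarith
      qed
      from average_deviation_le[OF um Xspace_sq[OF u] _ m(2,1) this] s
      show ?thesis unfolding D_def av by (simp add: S_def)
    qed
    have "ennreal (L2sq u) = (\<integral>\<^sup>+x. ennreal ((u x)\<^sup>2) \<partial>lborel)"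
      by (rule nn_integral_eq_integral[symmetric, OF Xspace_sq[OF u]]) simp
    also have "\<dots> \<le> (\<integral>\<^sup>+x. ennreal D * gag_fun s u x \<partial>lborel)"
    proof (rule nn_integral_mono_AE)
      show "AE x in lborel. ennreal ((u x)\<^sup>2) \<le> ennreal D * gag_fun s u x"
        using Xspace_AE[OF u]
      proof eventually_elim
        case (elim x) then show ?case using pt[of x] by (cases "x \<in> \<Omega>") auto
      qed
    qed
    also have "\<dots> = ennreal D * gagliardo_sq s u"
      unfolding nn_integral_gag_fun[OF um, symmetric] by (rule nn_integral_cmult) measurable
    also have "\<dots> = ennreal (D * X_norm_sq s u)"
      unfolding gagliardo_sq_Xspace[OF u] using D X_norm_sq_nonneg[of s u] by (simp add: ennreal_mult)
    finally show "L2sq u \<le> D * X_norm_sq s u"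
      using D X_norm_sq_nonneg[of s u] by (simp add: ennreal_le_iff)
  qed
qed

section \<open>The critical Sobolev inequality\<close>

definition sob_exp :: "'a::euclidean_space itself \<Rightarrow> real \<Rightarrow> real" where
  "sob_exp _ s = 2 * real DIM('a) / (real DIM('a) - 2 * s)"

abbreviation sob_int :: "real \<Rightarrow> ('a::euclidean_space \<Rightarrow> real) \<Rightarrow> ennreal" where
  "sob_int s u \<equiv> \<integral>\<^sup>+x. ennreal (\<bar>u x\<bar> powr sob_exp TYPE('a) s) \<partial>lborel"

text \<open>If \<open>I\<close> is the integral of w^r, a ball around x of volume proportional to I
  / w(x)^r has mean of \<open>w\<close> at most w(x)/2, so the deviation controls w(x)/2. The radius
  enters through \<open>I\<close> and w(x) only, and the powers of w(x) combine to w(x)^r \<le> C0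
  I^\<theta> \<open>gag_fun s w x\<close>. Integration gives I \<le> C0 I^\<theta> E. Boundedness of
  \<open>w\<close> makes \<open>I\<close> finite beforehand, so that I^\<theta> can be
  absorbed.\<close>

lemma sobolev_bounded:
  fixes w :: "'a::euclidean_space \<Rightarrow> real" and s :: real
  defines "r \<equiv> sob_exp TYPE('a) s" and "V \<equiv> unit_ball_vol (real DIM('a))" and "\<theta> \<equiv> 2 * s / real DIM('a)"
  assumes s: "0 < s" "2 * s < real DIM('a)"
    and wm[measurable]: "w \<in> borel_measurable borel" and sq: "integrable lborel (\<lambda>x. (w x)\<^sup>2)"
    and w: "\<And>x. 0 \<le> w x" "\<And>x. w x \<le> M"
    and E: "gagliardo_sq s w \<le> ennreal E" "E \<ge> 0"
  shows "(\<integral>\<^sup>+x. ennreal (w x powr r) \<partial>lborel) \<le> ennreal ((4 powr (r - 1) / V powr (1 + \<theta>) * E) powr (1 / (1 - \<theta>)))"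
proof -
  have N: "real DIM('a) > 0" by simp
  have V: "V > 0" unfolding V_def by simp
  have \<theta>: "0 < \<theta>" "\<theta> < 1" unfolding \<theta>_def using s by auto
  have r: "r > 2" unfolding r_def sob_exp_def using s by (simp add: field_simps)
  \<comment> \<open>This identity characterises the critical exponent: with it the powers of the
    level \<open>l\<close> cancel exactly in the pointwise bound.\<close>
  have r2: "r - 2 = r * \<theta>" unfolding r_def sob_exp_def \<theta>_def using s by (simp add: field_simps)
  have M: "M \<ge> 0" using w(1)[of 0] w(2)[of 0] by linarith
  have int: "integrable lborel (\<lambda>x. w x powr r)"
  proof (rule Bochner_Integration.integrable_bound)
    show "integrable lborel (\<lambda>x. M powr (r - 2) * (w x)\<^sup>2)" using sq by simp
    show "AE x in lborel. norm (w x powr r) \<le> norm (M powr (r - 2) * (w x)\<^sup>2)"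
    proof (rule AE_I2)
      fix x
      show "norm (w x powr r) \<le> norm (M powr (r - 2) * (w x)\<^sup>2)"
      proof (cases "w x = 0")
        case False
        then have p: "w x > 0" using w(1)[of x] by simp
        have "w x powr r = w x powr (r - 2) * (w x)\<^sup>2"
          using p powr_add[of "w x" "r - 2" 2] by simp
        also have "\<dots> \<le> M powr (r - 2) * (w x)\<^sup>2"
          using w(2)[of x] p r by (intro mult_right_mono powr_mono2) auto
        finally show ?thesis by simp
      qed simp
    qed
  qed simp
  define I where "I = (\<integral>x. w x powr r \<partial>lborel)"
  have I_eq: "(\<integral>\<^sup>+x. ennreal (w x powr r) \<partial>lborel) = ennreal I"
    unfolding I_def by (rule nn_integral_eq_integral[OF int]) simp
  have I0: "I \<ge> 0" unfolding I_def by simp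
  define C0 where "C0 = 4 powr (r - 1) / V powr (1 + \<theta>)"
  have C0: "C0 > 0" unfolding C0_def using V by simp
  show ?thesis
  proof (cases "I = 0")
    case True then show ?thesis unfolding I_eq by simp
  next
    case False
    then have I: "I > 0" using I0 by simp
    have pt: "ennreal (w x powr r) \<le> ennreal (C0 * I powr \<theta>) * gag_fun s w x" for x
    proof (cases "w x = 0")
      case True then show ?thesis by simp
    next
      case False
      then have wx: "w x > 0" using w(1)[of x] by simp
      define l where "l = w x / 4"
      have l: "l > 0" unfolding l_def using wx by simp
      \<comment> \<open>The volume \<open>m\<close> of the ball is chosen so that the mean of \<open>w\<close> over it is at most \<open>w x / 2\<close>.\<close>
      define m where "m = I / l powr r"
      have m: "m > 0" unfolding m_def using I l by simp
      define \<rho> where "\<rho> = (m / V) powr (1 / real DIM('a))"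
      have \<rho>: "\<rho> > 0" unfolding \<rho>_def using m V by simp
      have "\<rho> ^ DIM('a) = m / V"
        unfolding \<rho>_def using m V by (simp add: powr_power)
      then have em: "emeasure lborel (ball x \<rho>) = ennreal m"
        using \<rho> V by (simp add: emeasure_ball V_def[symmetric])
      have B[measurable]: "ball x \<rho> \<in> sets borel" by simp
      have iB: "integrable lborel (indicator (ball x \<rho>) :: 'a \<Rightarrow> real)" using em by simp
      define av where "av = (\<integral>y. w y * indicator (ball x \<rho>) y \<partial>lborel) / m"
      \<comment> \<open>Below the level \<open>l\<close> the integrand is at most \<open>l\<close>
        on the ball; above it w = w^(1-r) w^r \<le> l^(1-r) w^r because r > 1. The choice of
        \<open>m\<close> makes both parts contribute l m.\<close>
      have "(\<integral>y. w y * indicator (ball x \<rho>) y \<partial>lborel) \<le> (\<integral>y. l * indicator (ball x \<rho>) y + l powr (1 - r) * w y powr r \<partial>lborel)"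
      proof (rule integral_mono')
        show "integrable lborel (\<lambda>y. l * indicator (ball x \<rho>) y + l powr (1 - r) * w y powr r)"
          using iB int by simp
        fix y
        show "0 \<le> l * indicator (ball x \<rho>) y + l powr (1 - r) * w y powr r" using l by simp
        show "w y * indicator (ball x \<rho>) y \<le> l * indicator (ball x \<rho>) y + l powr (1 - r) * w y powr r"
        proof (cases "w y \<le> l")
          case True
          then have "w y * indicator (ball x \<rho>) y \<le> l * indicator (ball x \<rho>) y" by (rule mult_right_mono) simp
          then show ?thesis by (simp add: add_increasing2)
        next
          case False
          then have wy: "w y > 0" using l by simp
          have "w y = w y powr (1 - r) * w y powr r" using wy by (simp add: powr_add[symmetric])
          also have "\<dots> \<le> l powr (1 - r) * w y powr r"
            using False l r by (intro mult_right_mono powr_mono2') auto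
          finally have "w y \<le> l powr (1 - r) * w y powr r" .
          moreover have "w y * indicator (ball x \<rho>) y \<le> w y" using wy by (simp add: indicator_def)
          moreover have "0 \<le> l * indicator (ball x \<rho>) y" using l by simp
          ultimately show ?thesis by linarith
        qed
      qed
      also have "\<dots> = l * m + l powr (1 - r) * I"
        using iB int em m unfolding I_def by (simp add: measure_def)
      also have "l powr (1 - r) * I = l * m"
        unfolding m_def using l by (simp add: powr_diff)
      finally have "av \<le> 2 * l" unfolding av_def using m by (simp add: field_simps)
      then have "w x / 2 \<le> w x - av" unfolding l_def by simp
      then have "(w x / 2)\<^sup>2 \<le> (w x - av)\<^sup>2" using wx by (intro power_mono) auto
      then have "ennreal ((w x)\<^sup>2 / 4) \<le> ennreal ((w x - av)\<^sup>2)" by (intro ennreal_leI) (simp add: power_divide)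
      also have "\<dots> \<le> ennreal (\<rho> powr (real DIM('a) + 2 * s) / m) * gag_fun s w x"
        unfolding av_def using s by (intro average_deviation_le wm sq B em m) (auto simp: dist_norm)
      finally have 1: "ennreal ((w x)\<^sup>2 / 4) \<le> ennreal (\<rho> powr (real DIM('a) + 2 * s) / m) * gag_fun s w x" .
      have 2: "\<rho> powr (real DIM('a) + 2 * s) / m = I powr \<theta> / (V powr (1 + \<theta>) * l powr (r - 2))"
      proof -
        have "\<rho> powr (real DIM('a) + 2 * s) = (m / V) powr (1 + \<theta>)"
          unfolding \<rho>_def powr_powr \<theta>_def by (simp add: field_simps)
        also have "\<dots> = m * m powr \<theta> / V powr (1 + \<theta>)"
          using m V by (simp add: powr_divide powr_add)
        finally have "\<rho> powr (real DIM('a) + 2 * s) / m = m powr \<theta> / V powr (1 + \<theta>)" using m by simp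
        also have "m powr \<theta> = I powr \<theta> / l powr (r - 2)"
          unfolding m_def r2 using I l by (simp add: powr_divide powr_powr)
        finally show ?thesis by (simp add: field_simps)
      qed
      have "w x powr r = 4 * w x powr (r - 2) * ((w x)\<^sup>2 / 4)"
        using wx powr_add[of "w x" "r - 2" 2] by simp
      then have "ennreal (w x powr r) = ennreal (4 * w x powr (r - 2)) * ennreal ((w x)\<^sup>2 / 4)"
        by (simp add: ennreal_mult[symmetric])
      also have "\<dots> \<le> ennreal (4 * w x powr (r - 2)) * (ennreal (\<rho> powr (real DIM('a) + 2 * s) / m) * gag_fun s w x)"
        by (rule mult_left_mono[OF 1]) simp
      also have "\<dots> = ennreal (4 * w x powr (r - 2) * (\<rho> powr (real DIM('a) + 2 * s) / m)) * gag_fun s w x"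
        using m by (subst ennreal_mult) (auto simp: mult.assoc)
      also have "4 * w x powr (r - 2) * (\<rho> powr (real DIM('a) + 2 * s) / m) = C0 * I powr \<theta>"
      proof -
        have "w x = 4 * l" unfolding l_def by simp
        then have "w x powr (r - 2) = 4 powr (r - 2) * l powr (r - 2)" using l by (simp add: powr_mult)
        moreover have "4 powr (r - 1) = 4 * 4 powr (r - 2)" using powr_add[of 4 1 "r - 2"] by simp
        ultimately show ?thesis unfolding 2 C0_def using l V by (simp add: field_simps)
      qed
      finally show ?thesis .
    qed
    have "ennreal I \<le> (\<integral>\<^sup>+x. ennreal (C0 * I powr \<theta>) * gag_fun s w x \<partial>lborel)"
      unfolding I_eq[symmetric] by (intro nn_integral_mono pt)
    also have "\<dots> = ennreal (C0 * I powr \<theta>) * gagliardo_sq s w"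
      unfolding nn_integral_gag_fun[OF wm, symmetric] by (rule nn_integral_cmult) measurable
    also have "\<dots> \<le> ennreal (C0 * I powr \<theta>) * ennreal E" by (intro mult_left_mono E) simp
    also have "\<dots> = ennreal (C0 * I powr \<theta> * E)" using C0 E by (simp add: ennreal_mult)
    finally have "I \<le> C0 * I powr \<theta> * E" using C0 E by (subst (asm) ennreal_le_iff) auto
    then have "I / I powr \<theta> \<le> C0 * E" using I by (simp add: field_simps)
    moreover have "I / I powr \<theta> = I powr (1 - \<theta>)" using I by (simp add: powr_diff)
    ultimately have "I powr (1 - \<theta>) \<le> C0 * E" by simp
    then have "(I powr (1 - \<theta>)) powr (1 / (1 - \<theta>)) \<le> (C0 * E) powr (1 / (1 - \<theta>))"
      using \<theta> by (intro powr_mono2) auto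
    then have "I \<le> (C0 * E) powr (1 / (1 - \<theta>))" using \<theta> I by (simp add: powr_powr)
    then show ?thesis unfolding I_eq C0_def by (rule ennreal_leI)
  qed
qed

text \<open>Truncations of |u| at height n are bounded and have no larger energy, so the bounded
  case applies with a constant independent of n; Fatou's lemma removes the truncation.\<close>

lemma fractional_Sobolev:
  fixes \<Omega> :: "'a::euclidean_space set"
  assumes s: "0 < s" "2 * s < real DIM('a)"
  shows "\<exists>C\<ge>0. \<forall>u\<in>Xspace s \<Omega>. X_norm_sq s u \<le> E \<longrightarrow>
     sob_int s u \<le> ennreal C"
proof -
  define r where "r = sob_exp TYPE('a) s"
  define V where "V = unit_ball_vol (real DIM('a))"
  define \<theta> where "\<theta> = 2 * s / real DIM('a)"
  \<comment> \<open>The sign of \<open>E\<close> is not prescribed in the statement;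
    \<open>max E 0\<close> keeps the base of the power nonnegative.\<close>
  define C where "C = (4 powr (r - 1) / V powr (1 + \<theta>) * max E 0) powr (1 / (1 - \<theta>))"
  show ?thesis
  proof (intro exI[of _ C] conjI ballI impI)
    show "C \<ge> 0" unfolding C_def by simp
    fix u :: "'a \<Rightarrow> real" assume u: "u \<in> Xspace s \<Omega>" and E: "X_norm_sq s u \<le> E"
    have um[measurable]: "u \<in> borel_measurable borel" by (rule Xspace_borel[OF u])
    define w where "w n x = min \<bar>u x\<bar> (real n)" for n x
    have wm[measurable]: "w n \<in> borel_measurable borel" for n unfolding w_def by measurable
    have wd: "\<bar>w n x - w n y\<bar> \<le> \<bar>u x - u y\<bar>" for n x y unfolding w_def by linarith
    have wX: "w n \<in> Xspace s \<Omega>" for n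
    proof (rule Xspace_dominated[OF u u wm, where C = 1])
      show "\<bar>w n x\<bar> \<le> 1 * (\<bar>u x\<bar> + \<bar>u x\<bar>)" for x unfolding w_def by simp
      show "\<bar>w n x - w n y\<bar> \<le> 1 * (\<bar>u x - u y\<bar> + \<bar>u x - u y\<bar>)" for x y
        by (rule order_trans[OF wd]) simp
    qed
    show "sob_int s u \<le> ennreal C"
      unfolding r_def[symmetric]
    proof (rule nn_integral_le_of_tendsto[where f = "\<lambda>n x. ennreal (w n x powr r)"])
      show "AE x in lborel. (\<lambda>n. ennreal (w n x powr r)) \<longlonglongrightarrow> ennreal (\<bar>u x\<bar> powr r)"
      proof (rule AE_I2)
        fix x
        obtain n0 :: nat where n0: "\<bar>u x\<bar> \<le> real n0" using real_arch_simple by blast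
        show "(\<lambda>n. ennreal (w n x powr r)) \<longlonglongrightarrow> ennreal (\<bar>u x\<bar> powr r)"
          by (rule tendsto_eventually, rule eventually_sequentiallyI[of n0]) (use n0 in \<open>auto simp: w_def min_def\<close>)
      qed
      fix n
      have "gagliardo_sq s (w n) \<le> ennreal (max E 0)"
        unfolding gagliardo_sq_Xspace[OF wX] using X_norm_sq_mono[OF u wm wd, of n] E by (intro ennreal_leI) simp
      moreover have "0 \<le> w n x" "w n x \<le> real n" for x by (auto simp: w_def)
      ultimately show "(\<integral>\<^sup>+x. ennreal (w n x powr r) \<partial>lborel) \<le> ennreal C"
        unfolding C_def r_def V_def \<theta>_def
        by (intro sobolev_bounded[OF s wm Xspace_sq[OF wX]]) auto
    qed measurable
  qed
qed

section \<open>Convergence of integrals and Rellich compactness\<close>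

text \<open>A bounded moment of order 1+e gives uniform integrability: cutting at height L changes
  each integral by at most C L^(-e), uniformly in n. The cut functions converge by dominated
  convergence on the finite measure set \<open>A\<close>.\<close>

lemma Vitali_bounded_moment:
  fixes h :: "nat \<Rightarrow> 'a \<Rightarrow> real" and g :: "'a \<Rightarrow> real"
  assumes [measurable]: "\<And>n. h n \<in> borel_measurable M" "g \<in> borel_measurable M" "A \<in> sets M"
    and A: "emeasure M A < \<infinity>" and h0: "\<And>n x. 0 \<le> h n x" and g0: "\<And>x. 0 \<le> g x"
    and hA: "\<And>n x. x \<in> space M \<Longrightarrow> x \<notin> A \<Longrightarrow> h n x = 0"
    and lim: "AE x in M. (\<lambda>n. h n x) \<longlonglongrightarrow> g x"
    and e: "e > 0" and C: "C \<ge> 0" "\<And>n. (\<integral>\<^sup>+x. ennreal (h n x powr (1 + e)) \<partial>M) \<le> ennreal C"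
  shows "integrable M g" "(\<lambda>n. \<integral>x. h n x \<partial>M) \<longlonglongrightarrow> (\<integral>x. g x \<partial>M)"
proof -
  have gC: "(\<integral>\<^sup>+x. ennreal (g x powr (1 + e)) \<partial>M) \<le> ennreal C"
  proof (rule nn_integral_le_of_tendsto[where f = "\<lambda>n x. ennreal (h n x powr (1 + e))"])
    show "AE x in M. (\<lambda>n. ennreal (h n x powr (1 + e))) \<longlonglongrightarrow> ennreal (g x powr (1 + e))"
      using lim
    proof eventually_elim
      case (elim x)
      then show ?case using e h0 by (intro tendsto_ennrealI tendsto_powr' tendsto_const) auto
    qed
  qed (use C in auto)
  have gA: "AE x in M. x \<notin> A \<longrightarrow> g x = 0"
    using lim AE_space
  proof eventually_elim
    case (elim x)
    show ?case
    proof
      assume "x \<notin> A"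
      then have "(\<lambda>n. h n x) = (\<lambda>n. 0)" using hA elim by auto
      then show "g x = 0" using elim(1) by (simp add: LIMSEQ_const_iff)
    qed
  qed
  have iA: "integrable M (indicator A :: 'a \<Rightarrow> real)" using A by simp
  \<comment> \<open>Stated for a generic \<open>f\<close>, since it is applied to every
    \<open>h n\<close> and also to the limit \<open>g\<close>, whose moment is bounded by Fatou's
    lemma.\<close>
  have int: "integrable M f \<and> (\<forall>L>0. \<bar>(\<integral>x. f x \<partial>M) - (\<integral>x. min (f x) L \<partial>M)\<bar> \<le> L powr - e * C)"
    if [measurable]: "f \<in> borel_measurable M" and f0: "\<And>x. 0 \<le> f x"
      and fA: "AE x in M. x \<notin> A \<longrightarrow> f x = 0"
      and fC: "(\<integral>\<^sup>+x. ennreal (f x powr (1 + e)) \<partial>M) \<le> ennreal C" for f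
  proof -
    have i1: "integrable M (\<lambda>x. f x powr (1 + e))"
      by (rule integrableI_bounded) (use fC in \<open>auto simp: order_le_less_trans\<close>)
    have I1: "(\<integral>x. f x powr (1 + e) \<partial>M) \<le> C"
    proof -
      have "ennreal (\<integral>x. f x powr (1 + e) \<partial>M) \<le> ennreal C"
        using nn_integral_eq_integral[OF i1] fC by simp
      then show ?thesis using C(1) by (simp add: ennreal_le_iff)
    qed
    have fi: "integrable M f"
    proof (rule Bochner_Integration.integrable_bound)
      show "integrable M (\<lambda>x. indicator A x + f x powr (1 + e))" using i1 iA by simp
      show "AE x in M. norm (f x) \<le> norm (indicator A x + f x powr (1 + e))"
        using fA
      proof eventually_elim
        case (elim x)
        show ?case
        proof (cases "f x \<le> 1")
          case True then show ?thesis using elim f0[of x] by (cases "x \<in> A") (auto simp: add_increasing2)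
        next
          case False
          then have "f x powr 1 \<le> f x powr (1 + e)" using e by (intro powr_mono) auto
          then have "f x \<le> f x powr (1 + e)" using False by simp
          moreover have "0 \<le> (indicator A x :: real)" by simp
          ultimately show ?thesis using f0[of x] by (simp del: indicator_pos_le)
        qed
      qed
    qed simp
    have "\<bar>(\<integral>x. f x \<partial>M) - (\<integral>x. min (f x) L \<partial>M)\<bar> \<le> L powr - e * C" if L: "L > 0" for L
    proof -
      have mi: "integrable M (\<lambda>x. min (f x) L)"
        by (rule Bochner_Integration.integrable_bound[OF fi]) (use L f0 in auto)
      have "(\<integral>x. f x \<partial>M) \<le> (\<integral>x. min (f x) L + L powr - e * f x powr (1 + e) \<partial>M)"
      proof (rule integral_mono[OF fi])
        show "integrable M (\<lambda>x. min (f x) L + L powr - e * f x powr (1 + e))" using mi i1 by simp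
        fix x
        show "f x \<le> min (f x) L + L powr - e * f x powr (1 + e)"
        proof (cases "f x \<le> L")
          case False
          then have fx: "f x > 0" using L by simp
          have "1 = L powr - e * L powr e" using L by (simp add: powr_minus)
          also have "\<dots> \<le> L powr - e * f x powr e" using False L e by (intro mult_left_mono powr_mono2) auto
          finally have "f x * 1 \<le> f x * (L powr - e * f x powr e)" using fx by (intro mult_left_mono) auto
          also have "\<dots> = L powr - e * f x powr (1 + e)" using fx by (simp add: powr_add)
          finally show ?thesis using L False by simp
        qed simp
      qed
      also have "\<dots> = (\<integral>x. min (f x) L \<partial>M) + L powr - e * (\<integral>x. f x powr (1 + e) \<partial>M)"
        using mi i1 by simp
      also have "\<dots> \<le> (\<integral>x. min (f x) L \<partial>M) + L powr - e * C"
        using I1 by (intro add_left_mono mult_left_mono) auto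
      finally have "(\<integral>x. f x \<partial>M) \<le> (\<integral>x. min (f x) L \<partial>M) + L powr - e * C" .
      moreover have "(\<integral>x. min (f x) L \<partial>M) \<le> (\<integral>x. f x \<partial>M)"
        by (rule integral_mono[OF mi fi]) simp
      ultimately show ?thesis by simp
    qed
    then show ?thesis using fi by blast
  qed
  note gint = int[OF _ g0 gA gC]
  show "integrable M g" using gint by simp
  have hint: "integrable M (h n) \<and> (\<forall>L>0. \<bar>(\<integral>x. h n x \<partial>M) - (\<integral>x. min (h n x) L \<partial>M)\<bar> \<le> L powr - e * C)" for n
    using hA h0 C(2) AE_space by (intro int) (auto elim: eventually_mono)
  show "(\<lambda>n. \<integral>x. h n x \<partial>M) \<longlonglongrightarrow> (\<integral>x. g x \<partial>M)"
    unfolding LIMSEQ_iff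
  proof (intro allI impI)
    fix \<epsilon> :: real assume \<epsilon>: "\<epsilon> > 0"
    \<comment> \<open>Solves L^(-e) (C+1) = \<epsilon>/4; the summand 1 covers C = 0. Two cut errors
      and one convergence error then add up to less than \<epsilon>.\<close>
    define L where "L = (4 * (C + 1) / \<epsilon>) powr (1 / e)"
    have L: "L > 0" unfolding L_def using \<epsilon> C by simp
    have Leq: "L powr - e = \<epsilon> / (4 * (C + 1))"
      unfolding L_def powr_powr using e \<epsilon> C by (simp add: powr_minus)
    have Le: "L powr - e * C \<le> \<epsilon> / 4"
      unfolding Leq using \<epsilon> C(1) by (simp add: field_simps)
    have "(\<lambda>n. \<integral>x. min (h n x) L \<partial>M) \<longlonglongrightarrow> (\<integral>x. min (g x) L \<partial>M)"
    proof (rule integral_dominated_convergence[where w = "\<lambda>x. L * indicator A x"])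
      show "integrable M (\<lambda>x. L * indicator A x)" using iA by simp
      show "AE x in M. (\<lambda>n. min (h n x) L) \<longlonglongrightarrow> min (g x) L"
        using lim by eventually_elim (intro tendsto_min tendsto_const)
      show "AE x in M. norm (min (h n x) L) \<le> L * indicator A x" for n
        using AE_space
      proof eventually_elim
        case (elim x)
        then show ?case using hA[of x n] h0[of n x] L by (cases "x \<in> A") auto
      qed
    qed measurable
    then obtain n0 where n0: "\<And>n. n \<ge> n0 \<Longrightarrow> \<bar>(\<integral>x. min (h n x) L \<partial>M) - (\<integral>x. min (g x) L \<partial>M)\<bar> < \<epsilon> / 4"
      unfolding LIMSEQ_iff using \<epsilon> by (metis real_norm_def zero_less_divide_iff zero_less_numeral)
    show "\<exists>n0. \<forall>n\<ge>n0. norm ((\<integral>x. h n x \<partial>M) - (\<integral>x. g x \<partial>M)) < \<epsilon>"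
    proof (intro exI[of _ n0] allI impI)
      fix n assume "n \<ge> n0"
      have "\<bar>(\<integral>x. h n x \<partial>M) - (\<integral>x. min (h n x) L \<partial>M)\<bar> \<le> L powr - e * C"
        using hint[of n] L by blast
      moreover have "\<bar>(\<integral>x. g x \<partial>M) - (\<integral>x. min (g x) L \<partial>M)\<bar> \<le> L powr - e * C"
        using gint L by simp
      moreover note Le n0[OF \<open>n \<ge> n0\<close>]
      ultimately show "norm ((\<integral>x. h n x \<partial>M) - (\<integral>x. g x \<partial>M)) < \<epsilon>"
        using \<epsilon> unfolding real_norm_def by linarith
    qed
  qed
qed

section \<open>Almost everywhere limits in X\<close>

lemma AE_lborel_fst_snd:
  assumes "AE x in lborel. P (x::'a::euclidean_space)"
  shows "AE z in lborel2. P (fst z) \<and> P (snd z)"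
proof -
  obtain N where N: "N \<in> null_sets lborel" "{x. \<not> P x} \<subseteq> N"
    using assms by (auto elim!: AE_E simp: null_sets_def)
  have 1: "N \<times> (UNIV::'a set) \<in> null_sets lborel2"
    by (rule lborel.times_in_null_sets1[OF N(1)]) simp
  have 2: "(UNIV::'a set) \<times> N \<in> null_sets lborel2"
    by (rule lborel.times_in_null_sets2[OF _ N(1)]) simp
  show ?thesis
    by (rule AE_I'[OF null_sets.Un[OF 1 2]]) (use N in auto)
qed

text \<open>Fatou's lemma on the squares gives square integrability, and on the squared quotients it
  gives lower semicontinuity of the energy. Almost everywhere convergence thus takes the place of
  weak convergence in X.\<close>

lemma Xspace_limit:
  fixes w :: "'a::euclidean_space \<Rightarrow> real"
  assumes u: "\<And>n. u n \<in> Xspace s \<Omega>" and [measurable]: "w \<in> borel_measurable borel"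
    and lim: "AE x in lborel. (\<lambda>n. u n x) \<longlonglongrightarrow> w x"
    and A: "(\<lambda>n. X_norm_sq s (u n)) \<longlonglongrightarrow> A"
    and K: "\<And>n. L2sq (u n) \<le> K"
  shows "w \<in> Xspace s \<Omega>" "X_norm_sq s w \<le> A"
proof -
  have [measurable]: "u n \<in> borel_measurable borel" for n using Xspace_borel[OF u] .
  have A0: "A \<ge> 0" by (rule LIMSEQ_le_const[OF A]) (auto simp: X_norm_sq_nonneg)
  have "(\<integral>\<^sup>+x. ennreal ((w x)\<^sup>2) \<partial>lborel) \<le> ennreal K"
  proof (rule nn_integral_le_of_tendsto[where f = "\<lambda>n x. ennreal ((u n x)\<^sup>2)"])
    show "AE x in lborel. (\<lambda>n. ennreal ((u n x)\<^sup>2)) \<longlonglongrightarrow> ennreal ((w x)\<^sup>2)"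
      using lim by eventually_elim (intro tendsto_ennrealI tendsto_power)
    show "(\<integral>\<^sup>+x. ennreal ((u n x)\<^sup>2) \<partial>lborel) \<le> ennreal K" for n
      using nn_integral_eq_integral[OF Xspace_sq[OF u[of n]]] K[of n] by (simp add: ennreal_leI)
  qed measurable
  then have sq: "integrable lborel (\<lambda>x. (w x)\<^sup>2)"
    by (intro integrableI_bounded) (auto simp: order_le_less_trans)
  have limz: "AE z in lborel2. (\<lambda>n. gag_quot s (u n) z) \<longlonglongrightarrow> gag_quot s w z"
    using AE_lborel_fst_snd[OF lim]
  proof eventually_elim
    case (elim z)
    then show ?case unfolding gag_quot_def divide_inverse by (intro tendsto_intros) auto
  qed
  have le: "(\<integral>\<^sup>+z. ennreal ((gag_quot s w z)\<^sup>2) \<partial>lborel2) \<le> ennreal A"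
  proof (rule nn_integral_le_limit[where f = "\<lambda>n z. ennreal ((gag_quot s (u n) z)\<^sup>2)"])
    show "AE z in lborel2. (\<lambda>n. ennreal ((gag_quot s (u n) z)\<^sup>2)) \<longlonglongrightarrow> ennreal ((gag_quot s w z)\<^sup>2)"
      using limz by eventually_elim (intro tendsto_ennrealI tendsto_power)
    show "(\<integral>\<^sup>+z. ennreal ((gag_quot s (u n) z)\<^sup>2) \<partial>lborel2) \<le> ennreal (X_norm_sq s (u n))" for n
      using gagliardo_sq_pair[OF Xspace_borel[OF u]] gagliardo_sq_Xspace[OF u] by simp
    show "(\<lambda>n. ennreal (X_norm_sq s (u n))) \<longlonglongrightarrow> ennreal A" by (intro tendsto_ennrealI A)
  qed measurable
  have gi: "integrable lborel2 (\<lambda>z. (gag_quot s w z)\<^sup>2)"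
    using le by (intro integrableI_bounded) (auto simp: order_le_less_trans)
  have "AE x in lborel. \<forall>n. x \<notin> \<Omega> \<longrightarrow> u n x = 0"
    using Xspace_AE[OF u] by (subst AE_all_countable) auto
  then have z: "AE x in lborel. x \<notin> \<Omega> \<longrightarrow> w x = 0"
    using lim
  proof eventually_elim
    case (elim x)
    show ?case
    proof
      assume "x \<notin> \<Omega>"
      then have "(\<lambda>n. u n x) = (\<lambda>n. 0)" using elim by auto
      then show "w x = 0" using elim(2) by (simp add: LIMSEQ_const_iff)
    qed
  qed
  show wX: "w \<in> Xspace s \<Omega>" unfolding Xspace_iff using sq gi z by simp
  show "X_norm_sq s w \<le> A"
    using le A0 unfolding gagliardo_sq_pair[symmetric, OF Xspace_borel[OF wX]] gagliardo_sq_Xspace[OF wX]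
    by (simp add: ennreal_le_iff)
qed

section \<open>Rellich compactness\<close>

lemma two_times_ennreal: "0 \<le> x \<Longrightarrow> 2 * ennreal x = ennreal (2 * x)"
  by (simp add: ennreal_mult)

text \<open>The approximating function may depend on \<epsilon>; two members close to it are close
  to each other, so the sequence is Cauchy in L2. A subsequence with geometrically small increments
  then converges almost everywhere.\<close>

lemma L2_approximable_AE_subsequence:
  fixes U :: "nat \<Rightarrow> 'a \<Rightarrow> real"
  assumes [measurable]: "\<And>n. U n \<in> borel_measurable M"
    and ap: "\<And>\<epsilon>::real. \<epsilon> > 0 \<Longrightarrow> \<exists>g\<in>borel_measurable M. \<exists>n0. \<forall>n\<ge>n0. (\<integral>\<^sup>+x. ennreal ((U n x - g x)\<^sup>2) \<partial>M) \<le> ennreal \<epsilon>"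
  shows "\<exists>k::nat\<Rightarrow>nat. strict_mono k \<and> (AE x in M. convergent (\<lambda>n. U (k n) x))"
proof -
  have cau: "\<exists>n0. \<forall>n\<ge>n0. \<forall>m\<ge>n0. (\<integral>\<^sup>+x. ennreal ((U n x - U m x)\<^sup>2) \<partial>M) \<le> ennreal \<epsilon>" if \<epsilon>: "\<epsilon> > 0" for \<epsilon> :: real
  proof -
    obtain g n0 where [measurable]: "g \<in> borel_measurable M"
      and n0: "\<And>n. n \<ge> n0 \<Longrightarrow> (\<integral>\<^sup>+x. ennreal ((U n x - g x)\<^sup>2) \<partial>M) \<le> ennreal (\<epsilon> / 4)"
      using ap[of "\<epsilon> / 4"] \<epsilon> by auto
    show ?thesis
    proof (intro exI[of _ n0] allI impI)
      fix n m assume nm: "n0 \<le> n" "n0 \<le> m"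
      have "(\<integral>\<^sup>+x. ennreal ((U n x - U m x)\<^sup>2) \<partial>M) \<le> (\<integral>\<^sup>+x. 2 * ennreal ((U n x - g x)\<^sup>2) + 2 * ennreal ((U m x - g x)\<^sup>2) \<partial>M)"
      proof (rule nn_integral_mono)
        fix x
        have "(U n x - U m x)\<^sup>2 \<le> 2 * (U n x - g x)\<^sup>2 + 2 * (U m x - g x)\<^sup>2"
          using sq_sum_le[of "U n x - g x" "g x - U m x"] by (simp add: power2_commute[of "g x"])
        then have "ennreal ((U n x - U m x)\<^sup>2) \<le> ennreal (2 * (U n x - g x)\<^sup>2 + 2 * (U m x - g x)\<^sup>2)"
          by (rule ennreal_leI)
        then show "ennreal ((U n x - U m x)\<^sup>2) \<le> 2 * ennreal ((U n x - g x)\<^sup>2) + 2 * ennreal ((U m x - g x)\<^sup>2)"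
          by (simp add: ennreal_plus ennreal_mult)
      qed
      also have "\<dots> = 2 * (\<integral>\<^sup>+x. ennreal ((U n x - g x)\<^sup>2) \<partial>M) + 2 * (\<integral>\<^sup>+x. ennreal ((U m x - g x)\<^sup>2) \<partial>M)"
        by (simp add: nn_integral_add nn_integral_cmult)
      also have "\<dots> \<le> 2 * ennreal (\<epsilon> / 4) + 2 * ennreal (\<epsilon> / 4)"
        by (intro add_mono mult_left_mono n0 nm) auto
      also have "\<dots> = ennreal \<epsilon>"
        using \<epsilon> by (simp add: two_times_ennreal ennreal_plus[symmetric] del: ennreal_plus)
      finally show "(\<integral>\<^sup>+x. ennreal ((U n x - U m x)\<^sup>2) \<partial>M) \<le> ennreal \<epsilon>" .
    qed
  qed
  have "\<exists>f. \<forall>j. \<forall>n\<ge>f j. \<forall>m\<ge>f j. (\<integral>\<^sup>+x. ennreal ((U n x - U m x)\<^sup>2) \<partial>M) \<le> ennreal ((1/4)^j)"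
    by (intro choice allI cau) simp
  then obtain f :: "nat \<Rightarrow> nat" where f: "\<And>j n m. n \<ge> f j \<Longrightarrow> m \<ge> f j \<Longrightarrow> (\<integral>\<^sup>+x. ennreal ((U n x - U m x)\<^sup>2) \<partial>M) \<le> ennreal ((1/4)^j)"
    by blast
  \<comment> \<open>The sum makes \<open>k n\<close> dominate \<open>f n\<close>, and the summand
    \<open>n\<close> makes it strictly increasing.\<close>
  define k where "k n = (\<Sum>i\<le>n. f i) + n" for n
  have k: "strict_mono k" unfolding strict_mono_Suc_iff k_def by simp
  have kf: "f n \<le> k n" for n unfolding k_def by (simp add: trans_le_add1 member_le_sum)
  define t where "t n x = U (k (Suc n)) x - U (k n) x" for n x
  have [measurable]: "t n \<in> borel_measurable M" for n unfolding t_def by measurable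
  have ti: "(\<integral>\<^sup>+x. ennreal ((t n x)\<^sup>2) \<partial>M) \<le> ennreal ((1/4)^n)" for n
    unfolding t_def using kf[of n] strict_monoD[OF k, of n "Suc n"] by (intro f) auto
  have "(\<integral>\<^sup>+x. (\<Sum>n. ennreal (2^n * (t n x)\<^sup>2)) \<partial>M) = (\<Sum>n. \<integral>\<^sup>+x. ennreal (2^n * (t n x)\<^sup>2) \<partial>M)"
    by (rule nn_integral_suminf) measurable
  also have "\<dots> \<le> (\<Sum>n. ennreal ((1/2)^n))"
  proof (intro suminf_le)
    fix n
    have "(\<integral>\<^sup>+x. ennreal (2^n * (t n x)\<^sup>2) \<partial>M) = ennreal (2^n) * (\<integral>\<^sup>+x. ennreal ((t n x)\<^sup>2) \<partial>M)"
      by (simp add: ennreal_mult nn_integral_cmult)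
    also have "\<dots> \<le> ennreal (2^n) * ennreal ((1/4)^n)" by (intro mult_left_mono ti) simp
    also have "\<dots> = ennreal ((1/2)^n)"
      by (simp add: ennreal_mult[symmetric] power_mult_distrib[symmetric])
    finally show "(\<integral>\<^sup>+x. ennreal (2^n * (t n x)\<^sup>2) \<partial>M) \<le> ennreal ((1/2)^n)" .
  qed auto
  also have "\<dots> = ennreal (\<Sum>n. (1/2)^n)" by (rule suminf_ennreal2) (auto intro: summable_geometric)
  also have "\<dots> < \<infinity>" by simp
  finally have fin: "(\<integral>\<^sup>+x. (\<Sum>n. ennreal (2^n * (t n x)\<^sup>2)) \<partial>M) < \<infinity>" .
  have "AE x in M. (\<Sum>n. ennreal (2^n * (t n x)\<^sup>2)) \<noteq> \<infinity>"
    by (rule nn_integral_noteq_infinite) (use fin in auto)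
  then have "AE x in M. convergent (\<lambda>n. U (k n) x)"
  proof eventually_elim
    case (elim x)
    then have "summable (\<lambda>n. 2^n * (t n x)\<^sup>2)"
      by (intro summable_suminf_not_top) auto
    then have sm: "summable (\<lambda>n. (1/2)^n + 2^n * (t n x)\<^sup>2)"
      by (intro summable_add summable_geometric) auto
    have "summable (\<lambda>n. t n x)"
    proof (rule summable_comparison_test[OF _ sm], intro exI allI impI)
      fix n
      define y where "y = \<bar>t n x\<bar>"
      \<comment> \<open>The increments have squared norm at most 4^(-n), so weighting the squares by
        2^n still leaves an integrable sum. This inequality converts the weighted squares into
        absolute summability of the increments.\<close>
      have "y \<le> (1/2)^n + 2^n * y\<^sup>2"
      proof (cases "y \<le> (1/2)^n")
        case True then show ?thesis by (simp add: add_increasing2)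
      next
        case False
        then have "1 \<le> 2^n * y" by (simp add: field_simps power_divide)
        moreover have y0: "y \<ge> 0" unfolding y_def by simp
        ultimately have "1 * y \<le> (2^n * y) * y" by (intro mult_right_mono) auto
        then show ?thesis by (simp add: power2_eq_square algebra_simps add_increasing)
      qed
      then show "norm (t n x) \<le> (1/2)^n + 2^n * (t n x)\<^sup>2" unfolding y_def by simp
    qed
    then have "(\<lambda>n. \<Sum>i<n. t i x) \<longlonglongrightarrow> (\<Sum>i. t i x)" by (rule summable_LIMSEQ)
    moreover have "(\<Sum>i<n. t i x) = U (k n) x - U (k 0) x" for n
      unfolding t_def by (rule sum_lessThan_telescope)
    ultimately have "(\<lambda>n. (U (k n) x - U (k 0) x) + U (k 0) x) \<longlonglongrightarrow> (\<Sum>i. t i x) + U (k 0) x"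
      by (intro tendsto_add tendsto_const) simp
    then show ?case unfolding convergent_def by auto
  qed
  then show ?thesis using k by blast
qed

text \<open>Replacing \<open>u n\<close> by its mean over a ball of radius \<rho> near x costs at
  most a constant times \<rho>^(2s) E in squared L2 norm, uniformly in n. The centres come from a
  countable dense set, so only countably many bounded means occur and a diagonal subsequence makes
  all of them converge.\<close>

lemma Rellich_AE:
  fixes \<Omega> :: "'a::euclidean_space set"
  assumes s: "0 < s" and \<Omega>: "bounded \<Omega>" "open \<Omega>"
    and u: "\<And>n. u n \<in> Xspace s \<Omega>" and E: "\<And>n. X_norm_sq s (u n) \<le> E"
  shows "\<exists>k::nat\<Rightarrow>nat. strict_mono k \<and> (AE x in lborel. convergent (\<lambda>n. u (k n) x))"
proof -
  have [measurable]: "\<Omega> \<in> sets borel" using \<Omega> by auto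
  have um[measurable]: "u n \<in> borel_measurable borel" for n using Xspace_borel[OF u] .
  have E0: "E \<ge> 0" using X_norm_sq_nonneg[of s "u 0"] E[of 0] by linarith
  obtain P where P: "P \<ge> 0" "\<And>u. u \<in> Xspace s \<Omega> \<Longrightarrow> L2sq u \<le> P * X_norm_sq s u"
    using fractional_Poincare[OF s \<Omega>(1)] by blast
  have L2: "L2sq (u n) \<le> P * E" for n
    using P(2)[OF u[of n]] mult_left_mono[OF E P(1), of n] by linarith
  obtain D :: "'a set" where D: "countable D" "\<And>X. open X \<Longrightarrow> X \<noteq> {} \<Longrightarrow> \<exists>d\<in>D. d \<in> X"
    using countable_dense_setE by blast
  have Dne: "D \<noteq> {}" using D(2)[of UNIV] by auto
  define d where "d = from_nat_into D"
  define \<rho> where "\<rho> j = 1 / real (Suc j)" for j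
  have \<rho>: "\<rho> j > 0" "\<rho> j \<le> 1" for j unfolding \<rho>_def by auto
  have ex: "\<exists>i. dist x (d i) < \<rho> j" for x j
  proof -
    obtain y where "y \<in> D" "y \<in> ball x (\<rho> j)" using D(2)[of "ball x (\<rho> j)"] \<rho>[of j] by auto
    moreover then obtain i where "d i = y" unfolding d_def using D(1) by (metis from_nat_into_surj)
    ultimately show ?thesis by auto
  qed
  \<comment> \<open>Taking the least admissible index makes the choice of centre measurable in
    x.\<close>
  define idx where "idx j x = (LEAST i. dist x (d i) < \<rho> j)" for j x
  have idx: "dist x (d (idx j x)) < \<rho> j" for j x
    unfolding idx_def using ex[of x j] by (rule LeastI_ex)
  have idxm[measurable]: "idx j \<in> measurable lborel (count_space UNIV)" for j
    unfolding idx_def[abs_def] by measurable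
  define V where "V = unit_ball_vol (real DIM('a))"
  have V: "V > 0" unfolding V_def by simp
  define m where "m j = V * \<rho> j ^ DIM('a)" for j
  have m: "m j > 0" for j unfolding m_def using V \<rho>[of j] by simp
  have mV: "m j \<le> V" for j unfolding m_def using V \<rho>[of j] by (simp add: power_le_one)
  define S where "S j i = ball (d i) (\<rho> j)" for j i
  have Sm[measurable]: "S j i \<in> sets borel" for j i unfolding S_def by simp
  have em: "emeasure lborel (S j i) = ennreal (m j)" for j i
    unfolding S_def m_def V_def using \<rho>[of j] by (simp add: emeasure_ball)
  have iS: "integrable lborel (indicator (S j i) :: 'a \<Rightarrow> real)" for j i
    using em by simp
  define A where "A n z = (\<integral>y. u n y * indicator (S (fst z) (snd z)) y \<partial>lborel)" for n and z :: "nat \<times> nat"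
  have Ab: "norm (A n z) \<le> P * E + V" for n z
  proof -
    have "norm (A n z) \<le> (\<integral>y. norm (u n y * indicator (S (fst z) (snd z)) y) \<partial>lborel)"
      unfolding A_def by (rule integral_norm_bound)
    also have "\<dots> \<le> (\<integral>y. (u n y)\<^sup>2 + indicator (S (fst z) (snd z)) y \<partial>lborel)"
    proof (rule integral_mono')
      show "integrable lborel (\<lambda>y. (u n y)\<^sup>2 + indicator (S (fst z) (snd z)) y)"
        using Xspace_sq[OF u] iS by simp
      fix y
      have "\<bar>u n y\<bar> \<le> (u n y)\<^sup>2 + 1" using sum_squares_bound[of "\<bar>u n y\<bar>" 1] by simp
      then show "norm (u n y * indicator (S (fst z) (snd z)) y) \<le> (u n y)\<^sup>2 + indicator (S (fst z) (snd z)) y"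
        by (simp add: indicator_def)
    qed simp
    also have "\<dots> = (\<integral>y. (u n y)\<^sup>2 \<partial>lborel) + m (fst z)"
      using Xspace_sq[OF u[of n]] iS em m[of "fst z"] by (simp add: measure_def)
    also have "\<dots> \<le> P * E + V" using L2[of n] mV[of "fst z"] by (rule add_mono)
    finally show ?thesis .
  qed
  \<comment> \<open>Diagonal extraction over the countable set of pairs (scale, centre): one
    subsequence works for all means.\<close>
  obtain k where k: "strict_mono (k::nat\<Rightarrow>nat)" "\<And>z. \<exists>l. (\<lambda>n. A (k n) z) \<longlonglongrightarrow> l"
    using function_convergent_subsequence[of "UNIV :: (nat \<times> nat) set" A "P * E + V"] Ab by auto
  define Al where "Al z = lim (\<lambda>n. A (k n) z)" for z
  have Al: "(\<lambda>n. A (k n) z) \<longlonglongrightarrow> Al z" for z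
    using k(2)[of z] unfolding Al_def by (metis limI)
  have AlB: "\<bar>Al z\<bar> \<le> P * E + V" for z
    using Ab by (intro LIMSEQ_le_const2[OF tendsto_rabs[OF Al]]) auto
  define W where "W j n x = A (k n) (j, idx j x) / m j" for j n x
  define Wl where "Wl j x = Al (j, idx j x) / m j" for j x
  have Wm[measurable]: "W j n \<in> borel_measurable lborel" for j n
    unfolding W_def[abs_def] by (intro borel_measurable_divide borel_measurable_const measurable_compose[OF idxm]) simp
  have Wlm[measurable]: "Wl j \<in> borel_measurable lborel" for j
    unfolding Wl_def[abs_def] by (intro borel_measurable_divide borel_measurable_const measurable_compose[OF idxm]) simp
  define c where "c = 2 powr (real DIM('a) + 2 * s) / V"
  have c: "c > 0" unfolding c_def using V by simp
  \<comment> \<open>Both x and the points of the ball lie within \<rho> of its centre, hence the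
    distance 2\<rho>. Dividing \<rho>^(N+2s) by the volume \<rho>^N leaves \<rho>^(2s).\<close>
  have dev: "(\<integral>\<^sup>+x. ennreal ((u (k n) x - W j n x)\<^sup>2) \<partial>lborel) \<le> ennreal (c * \<rho> j powr (2 * s) * E)" for n j
  proof -
    have "ennreal ((u (k n) x - W j n x)\<^sup>2) \<le> ennreal (c * \<rho> j powr (2 * s)) * gag_fun s (u (k n)) x" for x
    proof -
      have "ennreal ((u (k n) x - W j n x)\<^sup>2) \<le> ennreal ((2 * \<rho> j) powr (real DIM('a) + 2 * s) / m j) * gag_fun s (u (k n)) x"
        unfolding W_def A_def fst_conv snd_conv
      proof (rule average_deviation_le[OF um Xspace_sq[OF u] Sm em m])
        fix y assume "y \<in> S j (idx j x)"
        then have "dist (d (idx j x)) y < \<rho> j" by (simp add: S_def)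
        then show "norm (x - y) \<le> 2 * \<rho> j"
          using idx[of x j] dist_triangle[of x y "d (idx j x)"] by (simp add: dist_norm[symmetric])
      qed (use s in simp)
      also have "(2 * \<rho> j) powr (real DIM('a) + 2 * s) / m j = c * \<rho> j powr (2 * s)"
      proof -
        have "(2 * \<rho> j) powr (real DIM('a) + 2 * s) = 2 powr (real DIM('a) + 2 * s) * (\<rho> j powr (real DIM('a)) * \<rho> j powr (2 * s))"
          using \<rho>[of j] by (simp add: powr_mult powr_add)
        also have "\<rho> j powr (real DIM('a)) = \<rho> j ^ DIM('a)" using \<rho>[of j] by (simp add: powr_realpow)
        finally show ?thesis unfolding m_def c_def using \<rho>[of j] V by (simp add: field_simps)
      qed
      finally show ?thesis .
    qed
    then have "(\<integral>\<^sup>+x. ennreal ((u (k n) x - W j n x)\<^sup>2) \<partial>lborel) \<le> (\<integral>\<^sup>+x. ennreal (c * \<rho> j powr (2 * s)) * gag_fun s (u (k n)) x \<partial>lborel)"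
      by (intro nn_integral_mono)
    also have "\<dots> = ennreal (c * \<rho> j powr (2 * s)) * gagliardo_sq s (u (k n))"
      unfolding nn_integral_gag_fun[OF um, symmetric] by (rule nn_integral_cmult) measurable
    also have "\<dots> \<le> ennreal (c * \<rho> j powr (2 * s)) * ennreal E"
      unfolding gagliardo_sq_Xspace[OF u] by (intro mult_left_mono ennreal_leI E) simp
    also have "\<dots> = ennreal (c * \<rho> j powr (2 * s) * E)" using c E0 by (simp add: ennreal_mult)
    finally show ?thesis .
  qed
  have fin\<Omega>: "emeasure lborel \<Omega> < \<infinity>" using emeasure_bounded_finite[OF \<Omega>(1)] by simp
  have conv: "(\<lambda>n. \<integral>\<^sup>+x. ennreal (indicator \<Omega> x * (W j n x - Wl j x)\<^sup>2) \<partial>lborel) \<longlonglongrightarrow> (\<integral>\<^sup>+x. 0 \<partial>(lborel::'a measure))" for j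
  proof (rule nn_integral_dominated_convergence[where w = "\<lambda>x. ennreal ((2 * (P * E + V) / m j)\<^sup>2) * indicator \<Omega> x"])
    have "(\<integral>\<^sup>+x. ennreal ((2 * (P * E + V) / m j)\<^sup>2) * indicator \<Omega> x \<partial>lborel) = ennreal ((2 * (P * E + V) / m j)\<^sup>2) * emeasure lborel \<Omega>"
      by (rule nn_integral_cmult_indicator) simp
    also have "\<dots> < \<infinity>" using fin\<Omega> by (simp add: ennreal_mult_less_top)
    finally show "(\<integral>\<^sup>+x. ennreal ((2 * (P * E + V) / m j)\<^sup>2) * indicator \<Omega> x \<partial>lborel) < \<infinity>" .
    show "AE x in lborel. (\<lambda>n. ennreal (indicator \<Omega> x * (W j n x - Wl j x)\<^sup>2)) \<longlonglongrightarrow> 0"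
    proof (rule AE_I2)
      fix x
      have "(\<lambda>n. W j n x) \<longlonglongrightarrow> Wl j x"
        unfolding W_def Wl_def using m[of j] by (intro tendsto_divide Al tendsto_const) simp
      then have "(\<lambda>n. W j n x - Wl j x) \<longlonglongrightarrow> 0" by (simp add: LIM_zero)
      then have "(\<lambda>n. indicator \<Omega> x * (W j n x - Wl j x)\<^sup>2) \<longlonglongrightarrow> indicator \<Omega> x * 0\<^sup>2"
        by (intro tendsto_intros)
      then show "(\<lambda>n. ennreal (indicator \<Omega> x * (W j n x - Wl j x)\<^sup>2)) \<longlonglongrightarrow> 0"
        by (metis ennreal_0 mult_zero_right tendsto_ennrealI zero_power2)
    qed
    fix n
    show "AE x in lborel. ennreal (indicator \<Omega> x * (W j n x - Wl j x)\<^sup>2) \<le> ennreal ((2 * (P * E + V) / m j)\<^sup>2) * indicator \<Omega> x"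
    proof (rule AE_I2)
      fix x
      have "\<bar>A (k n) (j, idx j x) - Al (j, idx j x)\<bar> \<le> 2 * (P * E + V)"
        using order_trans[OF abs_triangle_ineq4 add_mono[OF Ab[unfolded real_norm_def] AlB]] by (simp add: mult.commute)
      then have "\<bar>W j n x - Wl j x\<bar> \<le> \<bar>2 * (P * E + V) / m j\<bar>"
        unfolding W_def Wl_def using m[of j] by (simp add: diff_divide_distrib[symmetric] divide_right_mono)
      then have "(W j n x - Wl j x)\<^sup>2 \<le> (2 * (P * E + V) / m j)\<^sup>2" by (simp only: abs_le_square_iff)
      then show "ennreal (indicator \<Omega> x * (W j n x - Wl j x)\<^sup>2) \<le> ennreal ((2 * (P * E + V) / m j)\<^sup>2) * indicator \<Omega> x"
        by (auto simp: indicator_def intro: ennreal_leI)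
    qed
  qed auto
  \<comment> \<open>The bounded means converge in L2 only over a set of finite measure, hence the
    restriction to \<Omega>; off \<Omega> all \<open>u n\<close> vanish almost everywhere.\<close>
  define U where "U n x = indicator \<Omega> x * u (k n) x" for n x
  have Um[measurable]: "U n \<in> borel_measurable lborel" for n unfolding U_def by measurable
  have "\<exists>k2::nat\<Rightarrow>nat. strict_mono k2 \<and> (AE x in lborel. convergent (\<lambda>n. U (k2 n) x))"
  proof (rule L2_approximable_AE_subsequence)
    fix \<epsilon> :: real assume \<epsilon>: "\<epsilon> > 0"
    have "(\<lambda>j. c * \<rho> j powr (2 * s) * E) \<longlonglongrightarrow> c * 0 powr (2 * s) * E"
    proof (intro tendsto_intros tendsto_powr' disjI2 conjI)
      show "\<rho> \<longlonglongrightarrow> 0" unfolding \<rho>_def[abs_def] by (rule lim_inverse_n'[THEN LIMSEQ_Suc])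
      show "\<forall>\<^sub>F x in sequentially. 0 \<le> \<rho> x" using \<rho> by (intro always_eventually) (auto intro: less_imp_le)
    qed (use s in auto)
    then have "(\<lambda>j. c * \<rho> j powr (2 * s) * E) \<longlonglongrightarrow> 0" by simp
    then have "\<forall>\<^sub>F j in sequentially. c * \<rho> j powr (2 * s) * E < \<epsilon> / 4"
      using \<epsilon> by (intro order_tendstoD) auto
    then obtain j where j: "c * \<rho> j powr (2 * s) * E < \<epsilon> / 4" by (auto simp: eventually_sequentially)
    have "\<forall>\<^sub>F n in sequentially. (\<integral>\<^sup>+x. ennreal (indicator \<Omega> x * (W j n x - Wl j x)\<^sup>2) \<partial>lborel) < ennreal (\<epsilon> / 4)"
      using conv[of j] \<epsilon> by (intro order_tendstoD) auto
    then obtain n0 where n0: "\<And>n. n \<ge> n0 \<Longrightarrow> (\<integral>\<^sup>+x. ennreal (indicator \<Omega> x * (W j n x - Wl j x)\<^sup>2) \<partial>lborel) < ennreal (\<epsilon> / 4)"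
      by (auto simp: eventually_sequentially)
    show "\<exists>g\<in>borel_measurable lborel. \<exists>n0. \<forall>n\<ge>n0. (\<integral>\<^sup>+x. ennreal ((U n x - g x)\<^sup>2) \<partial>lborel) \<le> ennreal \<epsilon>"
    proof (rule bexI[of _ "\<lambda>x. indicator \<Omega> x * Wl j x"], intro exI[of _ n0] allI impI)
      fix n assume n: "n0 \<le> n"
      have "(\<integral>\<^sup>+x. ennreal ((U n x - indicator \<Omega> x * Wl j x)\<^sup>2) \<partial>lborel)
        \<le> (\<integral>\<^sup>+x. 2 * ennreal ((u (k n) x - W j n x)\<^sup>2) + 2 * ennreal (indicator \<Omega> x * (W j n x - Wl j x)\<^sup>2) \<partial>lborel)"
      proof (rule nn_integral_mono)
        fix x
        have "(U n x - indicator \<Omega> x * Wl j x)\<^sup>2 \<le> 2 * (u (k n) x - W j n x)\<^sup>2 + 2 * (indicator \<Omega> x * (W j n x - Wl j x)\<^sup>2)"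
          using sq_sum_le[of "u (k n) x - W j n x" "W j n x - Wl j x"] by (cases "x \<in> \<Omega>") (auto simp: U_def)
        then have "ennreal ((U n x - indicator \<Omega> x * Wl j x)\<^sup>2) \<le> ennreal (2 * (u (k n) x - W j n x)\<^sup>2 + 2 * (indicator \<Omega> x * (W j n x - Wl j x)\<^sup>2))"
          by (rule ennreal_leI)
        also have "\<dots> = 2 * ennreal ((u (k n) x - W j n x)\<^sup>2) + 2 * ennreal (indicator \<Omega> x * (W j n x - Wl j x)\<^sup>2)"
          by (subst ennreal_plus) (auto simp: ennreal_mult)
        finally show "ennreal ((U n x - indicator \<Omega> x * Wl j x)\<^sup>2) \<le> 2 * ennreal ((u (k n) x - W j n x)\<^sup>2) + 2 * ennreal (indicator \<Omega> x * (W j n x - Wl j x)\<^sup>2)" .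
      qed
      also have "\<dots> = 2 * (\<integral>\<^sup>+x. ennreal ((u (k n) x - W j n x)\<^sup>2) \<partial>lborel) + 2 * (\<integral>\<^sup>+x. ennreal (indicator \<Omega> x * (W j n x - Wl j x)\<^sup>2) \<partial>lborel)"
        by (subst nn_integral_add) (auto simp: nn_integral_cmult)
      also have "\<dots> \<le> 2 * ennreal (\<epsilon> / 4) + 2 * ennreal (\<epsilon> / 4)"
        using n0[OF n] j by (intro add_mono mult_left_mono order_trans[OF dev] ennreal_leI) (auto intro: less_imp_le)
      also have "\<dots> = ennreal \<epsilon>"
        using \<epsilon> by (simp add: two_times_ennreal ennreal_plus[symmetric] del: ennreal_plus)
      finally show "(\<integral>\<^sup>+x. ennreal ((U n x - indicator \<Omega> x * Wl j x)\<^sup>2) \<partial>lborel) \<le> ennreal \<epsilon>" .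
    qed measurable
  qed measurable
  then obtain k2 :: "nat \<Rightarrow> nat" where k2: "strict_mono k2" "AE x in lborel. convergent (\<lambda>n. U (k2 n) x)" by blast
  have "AE x in lborel. \<forall>n. x \<notin> \<Omega> \<longrightarrow> u n x = 0"
    using Xspace_AE[OF u] by (subst AE_all_countable) auto
  with k2(2) have "AE x in lborel. convergent (\<lambda>n. u ((k \<circ> k2) n) x)"
  proof eventually_elim
    case (elim x)
    then have "(\<lambda>n. u ((k \<circ> k2) n) x) = (\<lambda>n. U (k2 n) x)" by (cases "x \<in> \<Omega>") (auto simp: U_def)
    then show ?case using elim(1) by simp
  qed
  then show ?thesis using strict_mono_o[OF k(1) k2(1)] by blast
qed

text \<open>A further subsequence makes the energies converge. Their limit \<open>A\<close> is what
  remains of the energy when the quadratic form is passed to the limit, and it can only exceed the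
  energy of \<open>w\<close>.\<close>

lemma Rellich:
  fixes \<Omega> :: "'a::euclidean_space set"
  assumes s: "0 < s" and \<Omega>: "bounded \<Omega>" "open \<Omega>"
    and u: "\<And>n. u n \<in> Xspace s \<Omega>" and E: "\<And>n. X_norm_sq s (u n) \<le> E"
  shows "\<exists>k w A. strict_mono (k::nat\<Rightarrow>nat) \<and> w \<in> Xspace s \<Omega> \<and> (AE x in lborel. (\<lambda>n. u (k n) x) \<longlonglongrightarrow> w x) \<and>
     (\<lambda>n. X_norm_sq s (u (k n))) \<longlonglongrightarrow> A \<and> X_norm_sq s w \<le> A"
proof -
  obtain k1 :: "nat \<Rightarrow> nat" where k1: "strict_mono k1" "AE x in lborel. convergent (\<lambda>n. u (k1 n) x)"
    using Rellich_AE[of s \<Omega> u E, OF s \<Omega> u E] by auto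
  have "bounded (range (\<lambda>n. X_norm_sq s (u (k1 n))))"
    unfolding bounded_iff using E by (intro exI[of _ E]) (auto simp: abs_of_nonneg[OF X_norm_sq_nonneg])
  then obtain A k2 where k2: "strict_mono (k2::nat\<Rightarrow>nat)" "((\<lambda>n. X_norm_sq s (u (k1 n))) \<circ> k2) \<longlonglongrightarrow> A"
    using bounded_imp_convergent_subsequence by blast
  define k where "k = k1 \<circ> k2"
  have k: "strict_mono k" unfolding k_def by (rule strict_mono_o[OF k1(1) k2(1)])
  define w where "w x = lim (\<lambda>n. u (k n) x)" for x
  have um[measurable]: "u n \<in> borel_measurable borel" for n using Xspace_borel[OF u] .
  have w[measurable]: "w \<in> borel_measurable borel" unfolding w_def[abs_def] by measurable
  have lim: "AE x in lborel. (\<lambda>n. u (k n) x) \<longlonglongrightarrow> w x"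
    using k1(2)
  proof eventually_elim
    case (elim x)
    then have "convergent ((\<lambda>n. u (k1 n) x) \<circ> k2)" using k2(1) by (rule convergent_subseq_convergent)
    then show ?case unfolding w_def k_def by (simp add: convergent_LIMSEQ_iff o_def)
  qed
  have A: "(\<lambda>n. X_norm_sq s (u (k n))) \<longlonglongrightarrow> A" using k2(2) by (simp add: o_def k_def)
  obtain P where P: "P \<ge> 0" "\<And>u. u \<in> Xspace s \<Omega> \<Longrightarrow> L2sq u \<le> P * X_norm_sq s u"
    using fractional_Poincare[OF s \<Omega>(1)] by blast
  have K: "L2sq (u (k n)) \<le> P * E" for n
    using P(2)[OF u[of "k n"]] mult_left_mono[OF E P(1), of "k n"] by linarith
  show ?thesis
    using k lim A Xspace_limit[OF u w lim A K] by blast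
qed

section \<open>The Choquard functional\<close>

text \<open>Integrated over \<open>\<Omega> \<times> \<Omega>\<close>, this replaces the Hardy-Littlewood-Sobolev inequality: below the critical
  exponent the power \<open>\<kappa>\<close> of the Riesz kernel is still locally integrable.\<close>

lemma trilinear_Young:
  fixes f g k t \<tau> \<kappa> :: real
  assumes "0 \<le> f" "0 \<le> g" "0 \<le> k" and t: "t * (1 - \<tau>) = 1" and \<kappa>: "\<kappa> * (2 * \<tau>) = 1" and \<tau>: "0 < \<tau>" "2 * \<tau> \<le> 1"
  shows "f * g * k \<le> f powr t * g powr t + f powr t * k powr \<kappa> + g powr t * k powr \<kappa>"
proof (cases "f = 0 \<or> g = 0 \<or> k = 0")
  case True then show ?thesis by auto
next
  case False
  then have p: "f > 0" "g > 0" "k > 0" using assms by auto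
  define X where "X = f powr t * g powr t"
  define Y where "Y = f powr t * k powr \<kappa>"
  define Z where "Z = g powr t * k powr \<kappa>"
  have pos: "X > 0" "Y > 0" "Z > 0" unfolding X_def Y_def Z_def using p by auto
  define S where "S = X + Y + Z"
  have S: "S > 0" unfolding S_def using pos by simp
  have e1: "t * (1 - 2 * \<tau>) + t * \<tau> = 1" using t by (simp add: algebra_simps)
  have e2: "\<kappa> * \<tau> + \<kappa> * \<tau> = 1" using \<kappa> by simp
  \<comment> \<open>f g k is the geometric mean of the three right-hand terms with weights
    1-2\<tau>, \<tau>, \<tau>, which sum to 1. Each term is at most the total
    \<open>S\<close>.\<close>
  have "X powr (1 - 2 * \<tau>) * Y powr \<tau> * Z powr \<tau>
      = (f powr (t * (1 - 2 * \<tau>)) * f powr (t * \<tau>)) * (g powr (t * (1 - 2 * \<tau>)) * g powr (t * \<tau>)) * (k powr (\<kappa> * \<tau>) * k powr (\<kappa> * \<tau>))"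
    unfolding X_def Y_def Z_def using p by (simp add: powr_mult powr_powr mult_ac)
  also have "\<dots> = f * g * k"
    unfolding powr_add[symmetric] e1 e2 using p by simp
  finally have "f * g * k = X powr (1 - 2 * \<tau>) * Y powr \<tau> * Z powr \<tau>" by simp
  also have "\<dots> \<le> S powr (1 - 2 * \<tau>) * S powr \<tau> * S powr \<tau>"
    using pos \<tau> by (intro mult_mono powr_mono2) (auto simp: S_def)
  also have "\<dots> = S" using S by (simp add: powr_add[symmetric])
  finally show ?thesis unfolding S_def X_def Y_def Z_def .
qed

text \<open>On the diagonal \<open>0 powr - \<mu>\<close> is 0, in agreement with the division by
  zero in \<open>weak_solution\<close>; the two encodings of the kernel coincide everywhere.\<close>

definition choq :: "real \<Rightarrow> real \<Rightarrow> real \<Rightarrow> 'a::euclidean_space set \<Rightarrow> ('a \<Rightarrow> real) \<Rightarrow> ('a \<Rightarrow> real) \<Rightarrow> 'a \<times> 'a \<Rightarrow> real" where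
  "choq \<mu> p q \<Omega> u v z = indicator \<Omega> (fst z) * indicator \<Omega> (snd z) *
     (\<bar>u (fst z)\<bar> powr p * \<bar>v (snd z)\<bar> powr q * norm (fst z - snd z) powr - \<mu>)"

abbreviation choq_int :: "real \<Rightarrow> real \<Rightarrow> real \<Rightarrow> 'a::euclidean_space set \<Rightarrow> ('a \<Rightarrow> real) \<Rightarrow> ('a \<Rightarrow> real) \<Rightarrow> real" where
  "choq_int \<mu> p q \<Omega> u v \<equiv> \<integral>z. choq \<mu> p q \<Omega> u v z \<partial>lborel2"

lemma choq_nonneg: "0 \<le> choq \<mu> p q \<Omega> u v z"
  unfolding choq_def by simp

lemma measurable_choq [measurable]:
  fixes \<Omega> :: "'a::euclidean_space set"
  assumes [measurable]: "\<Omega> \<in> sets borel" "u \<in> borel_measurable borel" "v \<in> borel_measurable borel"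
  shows "choq \<mu> p q \<Omega> u v \<in> borel_measurable lborel2"
proof -
  have [measurable]: "u \<in> borel_measurable lborel" "v \<in> borel_measurable lborel" "\<Omega> \<in> sets lborel" by simp_all
  show ?thesis unfolding choq_def[abs_def] by measurable
qed

text \<open>The trilinear inequality splits the integrand into three terms: one separates into a
  product of single integrals, the other two are integrated first over the variable that occurs only
  in the kernel.\<close>

lemma choq_bound:
  fixes \<Omega> :: "'a::euclidean_space set"
  assumes s: "0 < s" "2 * s < real DIM('a)" and \<mu>: "0 < \<mu>" "\<mu> < real DIM('a)"
    and p: "0 < p" "p < crit_exp DIM('a) s \<mu>" and q: "0 < q" "q < crit_exp DIM('a) s \<mu>"
    and \<Omega>: "bounded \<Omega>" "open \<Omega>" and K: "K \<ge> 0"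
  shows "\<exists>C\<ge>0. \<forall>u\<in>borel_measurable borel. \<forall>v\<in>borel_measurable borel.
     sob_int s u \<le> ennreal K \<longrightarrow>
     sob_int s v \<le> ennreal K \<longrightarrow>
     (\<integral>\<^sup>+z. ennreal (choq \<mu> p q \<Omega> u v z) \<partial>lborel2) \<le> ennreal C"
proof -
  define N where "N = real DIM('a)"
  define r where "r = sob_exp TYPE('a) s"
  have N: "N > 0" "2 * s < N" "\<mu> < N" unfolding N_def using s \<mu> by auto
  have r: "r = 2 * N / (N - 2 * s)" "r > 0" unfolding r_def sob_exp_def N_def using s by auto
  have [measurable]: "\<Omega> \<in> sets borel" using \<Omega> by auto
  \<comment> \<open>Two demands on t compete: p t and q t must not exceed the Sobolev exponent r,
    and \<tau> = 1 - 1/t must exceed \<mu>/(2N), so that the kernel to the power \<kappa> =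
    1/(2\<tau>) is integrable. They are compatible because subcriticality says max p q / r < 1 -
    \<mu>/(2N). The cap 2 keeps 2\<tau> \<le> 1.\<close>
  define t where "t = min 2 (r / max p q)"
  have mx: "max p q > 0" "max p q < (2 * N - \<mu>) / (N - 2 * s)" using p q unfolding crit_exp_def N_def by auto
  have inv: "1 / t < 1 - \<mu> / (2 * N)" "t > 0"
  proof -
    have "r / max p q > 0" using r(2) mx(1) by (rule divide_pos_pos)
    then show "t > 0" unfolding t_def by simp
    show "1 / t < 1 - \<mu> / (2 * N)"
    proof (cases "r / max p q \<le> 2")
      case True
      then have "1 / t = max p q / r" unfolding t_def by (simp add: min_absorb2)
      also have "\<dots> < (2 * N - \<mu>) / (N - 2 * s) / r" using mx r by (intro divide_strict_right_mono) auto
      also have "\<dots> = 1 - \<mu> / (2 * N)" unfolding r using N by (simp add: field_simps)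
      finally show ?thesis .
    next
      case False
      then have "t = 2" unfolding t_def by simp
      then show ?thesis using N by (simp add: field_simps)
    qed
  qed
  define \<tau> where "\<tau> = 1 - 1 / t"
  have \<tau>: "\<mu> / (2 * N) < \<tau>" unfolding \<tau>_def using inv by simp
  have \<tau>0: "\<tau> > 0" using \<tau> \<mu> N by (smt (verit) divide_pos_pos)
  have \<tau>1: "2 * \<tau> \<le> 1"
  proof -
    have "t \<le> 2" unfolding t_def by simp
    then show ?thesis unfolding \<tau>_def using inv(2) by (simp add: field_simps)
  qed
  define \<kappa> where "\<kappa> = 1 / (2 * \<tau>)"
  have \<kappa>: "\<kappa> * (2 * \<tau>) = 1" "\<kappa> > 0" unfolding \<kappa>_def using \<tau>0 by auto
  have t\<tau>: "t * (1 - \<tau>) = 1" unfolding \<tau>_def using inv by simp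
  have \<mu>\<kappa>: "\<mu> * \<kappa> < N" unfolding \<kappa>_def using \<tau> \<tau>0 N by (simp add: field_simps)
  obtain R where R: "R > 0" "\<And>x. x \<in> \<Omega> \<Longrightarrow> norm x < R" using bounded_pos_less[THEN iffD1, OF \<Omega>(1)] by auto
  obtain Ck where Ck: "Ck \<ge> 0" "\<And>x::'a. (\<integral>\<^sup>+y. ennreal (norm (x - y) powr - (\<mu> * \<kappa>)) * indicator (ball x (2 * R)) y \<partial>lborel) \<le> ennreal Ck"
    using nn_integral_powr_ball[of "2 * R" "\<mu> * \<kappa>", where 'a='a] R \<mu>\<kappa> unfolding N_def by auto
  define H where "H z = ennreal (indicator \<Omega> (fst z) * indicator \<Omega> (snd z) * norm (fst z - snd z) powr - (\<mu> * \<kappa>))" for z :: "'a \<times> 'a"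
  have Hm[measurable]: "H \<in> borel_measurable lborel2"
  proof -
    have [measurable]: "\<Omega> \<in> sets lborel" by simp
    show ?thesis unfolding H_def[abs_def] by measurable
  qed
  have Hsym: "H (x, y) = H (y, x)" for x y unfolding H_def by (simp add: norm_minus_commute mult_ac)
  have HC: "(\<integral>\<^sup>+y. H (x, y) \<partial>lborel) \<le> ennreal Ck" for x
  proof -
    have "(\<integral>\<^sup>+y. H (x, y) \<partial>lborel) \<le> (\<integral>\<^sup>+y. ennreal (norm (x - y) powr - (\<mu> * \<kappa>)) * indicator (ball x (2 * R)) y \<partial>lborel)"
    proof (rule nn_integral_mono)
      fix y
      show "H (x, y) \<le> ennreal (norm (x - y) powr - (\<mu> * \<kappa>)) * indicator (ball x (2 * R)) y"
      proof (cases "x \<in> \<Omega> \<and> y \<in> \<Omega>")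
        case True
        then have "norm (x - y) < 2 * R" using R(2)[of x] R(2)[of y] norm_triangle_ineq4[of x y] by linarith
        then show ?thesis using True by (simp add: H_def dist_norm)
      qed (auto simp: H_def)
    qed
    also have "\<dots> \<le> ennreal Ck" by (rule Ck)
    finally show ?thesis .
  qed
  define Om where "Om = measure lborel \<Omega>"
  have Om: "emeasure lborel \<Omega> = ennreal Om"
    unfolding Om_def using emeasure_bounded_finite[OF \<Omega>(1)] by (intro emeasure_eq_ennreal_measure) auto
  define M where "M = Om + K"
  have M0: "M \<ge> 0" unfolding M_def Om_def using K by simp
  \<comment> \<open>The summand 1 covers the points with |u| \<le> 1, so that a single majorant
    serves both exponents p t and q t. Its integral is finite because \<Omega> has finite
    measure.\<close>
  define F where "F u x = ennreal (indicator \<Omega> x * (1 + \<bar>u x\<bar> powr r))" for u :: "'a \<Rightarrow> real" and x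
  have Fm[measurable]: "F u \<in> borel_measurable borel" if [measurable]: "u \<in> borel_measurable borel" for u
    unfolding F_def[abs_def] by measurable
  have FM: "(\<integral>\<^sup>+x. F u x \<partial>lborel) \<le> ennreal M"
    if [measurable]: "u \<in> borel_measurable borel" and k: "(\<integral>\<^sup>+x. ennreal (\<bar>u x\<bar> powr r) \<partial>lborel) \<le> ennreal K" for u
  proof -
    have "(\<integral>\<^sup>+x. F u x \<partial>lborel) \<le> (\<integral>\<^sup>+x. indicator \<Omega> x + ennreal (\<bar>u x\<bar> powr r) \<partial>lborel)"
      by (intro nn_integral_mono) (auto simp: F_def indicator_def)
    also have "\<dots> = ennreal Om + (\<integral>\<^sup>+x. ennreal (\<bar>u x\<bar> powr r) \<partial>lborel)"
      by (subst nn_integral_add) (auto simp: Om)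
    also have "\<dots> \<le> ennreal Om + ennreal K" by (intro add_left_mono k)
    also have "\<dots> = ennreal M" unfolding M_def using K by (simp add: Om_def)
    finally show ?thesis .
  qed
  have powF: "ennreal (indicator \<Omega> x * ((\<bar>u x\<bar> powr p') powr t)) \<le> F u x" if "p' = p \<or> p' = q" for u :: "'a \<Rightarrow> real" and x p'
  proof -
    have p': "0 < p'" "p' \<le> max p q" using that p q by auto
    have "p' * t \<le> max p q * (r / max p q)"
      using p' inv(2) mx by (intro mult_mono) (auto simp: t_def)
    then have pt: "p' * t \<le> r" using mx by simp
    have "\<bar>u x\<bar> powr (p' * t) \<le> 1 + \<bar>u x\<bar> powr r"
    proof (cases "\<bar>u x\<bar> \<le> 1")
      case True
      then have "\<bar>u x\<bar> powr (p' * t) \<le> 1" using p' inv(2) by (intro powr_le1) auto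
      then show ?thesis by (simp add: add_increasing2)
    next
      case False
      then have "\<bar>u x\<bar> powr (p' * t) \<le> \<bar>u x\<bar> powr r" using pt by (intro powr_mono) auto
      then show ?thesis by simp
    qed
    then show ?thesis unfolding F_def powr_powr by (intro ennreal_leI mult_left_mono) auto
  qed
  define C where "C = M * M + M * Ck + M * Ck"
  show ?thesis
  proof (intro exI[of _ C] conjI ballI impI)
    show "C \<ge> 0" unfolding C_def using M0 Ck by simp
    fix u v :: "'a \<Rightarrow> real"
    assume um[measurable]: "u \<in> borel_measurable borel" and vm[measurable]: "v \<in> borel_measurable borel"
      and uK: "sob_int s u \<le> ennreal K"
      and vK: "sob_int s v \<le> ennreal K"
    note FMu = FM[OF um uK[folded r_def]] and FMv = FM[OF vm vK[folded r_def]]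
    have [measurable]: "F u \<in> borel_measurable lborel" "F v \<in> borel_measurable lborel" by simp_all
    have pt: "ennreal (choq \<mu> p q \<Omega> u v z) \<le> F u (fst z) * F v (snd z) + F u (fst z) * H z + F v (snd z) * H z" for z
    proof -
      obtain x y where z: "z = (x, y)" by (cases z)
      define i :: real where "i = indicator \<Omega> x"
      define j :: real where "j = indicator \<Omega> y"
      have ij: "i \<ge> 0" "j \<ge> 0" unfolding i_def j_def by (auto simp: indicator_def)
      define f where "f = (\<bar>u x\<bar> powr p) powr t"
      define g where "g = (\<bar>v y\<bar> powr q) powr t"
      define k where "k = norm (x - y) powr - (\<mu> * \<kappa>)"
      have nn: "f \<ge> 0" "g \<ge> 0" "k \<ge> 0" unfolding f_def g_def k_def by auto
      have "\<bar>u x\<bar> powr p * \<bar>v y\<bar> powr q * norm (x - y) powr - \<mu> \<le> f * g + f * k + g * k"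
        using trilinear_Young[of "\<bar>u x\<bar> powr p" "\<bar>v y\<bar> powr q" "norm (x - y) powr - \<mu>" t \<tau> \<kappa>] t\<tau> \<kappa> \<tau>0 \<tau>1
        unfolding f_def g_def k_def by (simp add: powr_powr)
      then have "choq \<mu> p q \<Omega> u v z \<le> i * j * (f * g + f * k + g * k)"
        unfolding choq_def z i_def j_def by (simp add: mult_left_mono)
      also have "\<dots> = (i * f) * (j * g) + (i * f) * (i * j * k) + (j * g) * (i * j * k)"
        by (auto simp: i_def j_def indicator_def algebra_simps)
      finally have "ennreal (choq \<mu> p q \<Omega> u v z) \<le> ennreal ((i * f) * (j * g) + (i * f) * (i * j * k) + (j * g) * (i * j * k))"
        by (rule ennreal_leI)
      also have "\<dots> = ennreal (i * f) * ennreal (j * g) + ennreal (i * f) * H z + ennreal (j * g) * H z"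
        using nn ij unfolding H_def z by (simp add: ennreal_mult i_def[symmetric] j_def[symmetric] k_def[symmetric])
      also have "\<dots> \<le> F u x * F v y + F u x * H z + F v y * H z"
        unfolding i_def j_def f_def g_def by (intro add_mono mult_mono powF) auto
      finally show ?thesis unfolding z by simp
    qed
    have mm: "(\<lambda>z. F u (fst z) * F v (snd z)) \<in> borel_measurable lborel2"
      "(\<lambda>z. F u (fst z) * H z) \<in> borel_measurable lborel2"
      "(\<lambda>z. F v (snd z) * H z) \<in> borel_measurable lborel2" by measurable
    have I1: "(\<integral>\<^sup>+z. F u (fst z) * F v (snd z) \<partial>lborel2) \<le> ennreal (M * M)"
    proof -
      have "(\<integral>\<^sup>+z. F u (fst z) * F v (snd z) \<partial>lborel2) = (\<integral>\<^sup>+x. (\<integral>\<^sup>+y. F u x * F v y \<partial>lborel) \<partial>lborel)"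
        using lborel.nn_integral_fst[OF mm(1)] by simp
      also have "\<dots> = (\<integral>\<^sup>+x. F u x * (\<integral>\<^sup>+y. F v y \<partial>lborel) \<partial>lborel)"
        by (intro nn_integral_cong nn_integral_cmult) simp
      also have "\<dots> = (\<integral>\<^sup>+x. F u x \<partial>lborel) * (\<integral>\<^sup>+y. F v y \<partial>lborel)"
        by (rule nn_integral_multc) simp
      also have "\<dots> \<le> ennreal M * ennreal M" by (intro mult_mono FMu FMv) auto
      finally show ?thesis using M0 by (simp add: ennreal_mult)
    qed
    have I2: "(\<integral>\<^sup>+x. (\<integral>\<^sup>+y. F w x * H (x, y) \<partial>lborel) \<partial>lborel) \<le> ennreal (M * Ck)"
      if [measurable]: "w \<in> borel_measurable borel" and wM: "(\<integral>\<^sup>+x. F w x \<partial>lborel) \<le> ennreal M" for w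
    proof -
      have "(\<integral>\<^sup>+x. (\<integral>\<^sup>+y. F w x * H (x, y) \<partial>lborel) \<partial>lborel) = (\<integral>\<^sup>+x. F w x * (\<integral>\<^sup>+y. H (x, y) \<partial>lborel) \<partial>lborel)"
        by (intro nn_integral_cong nn_integral_cmult) measurable
      also have "\<dots> \<le> (\<integral>\<^sup>+x. F w x * ennreal Ck \<partial>lborel)"
        by (intro nn_integral_mono mult_left_mono HC) simp
      also have "\<dots> = (\<integral>\<^sup>+x. F w x \<partial>lborel) * ennreal Ck" by (rule nn_integral_multc) simp
      also have "\<dots> \<le> ennreal M * ennreal Ck" by (intro mult_right_mono wM) simp
      finally show ?thesis using M0 Ck by (simp add: ennreal_mult)
    qed
    have I3: "(\<integral>\<^sup>+z. F u (fst z) * H z \<partial>lborel2) \<le> ennreal (M * Ck)"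
      using lborel.nn_integral_fst[OF mm(2)] I2[OF um FMu] by simp
    have I4: "(\<integral>\<^sup>+z. F v (snd z) * H z \<partial>lborel2) \<le> ennreal (M * Ck)"
    proof -
      have "(\<integral>\<^sup>+z. F v (snd z) * H z \<partial>lborel2) = (\<integral>\<^sup>+y. (\<integral>\<^sup>+x. F v y * H (x, y) \<partial>lborel) \<partial>lborel)"
        using lborel_pair.nn_integral_snd[OF mm(3)] by simp
      also have "\<dots> = (\<integral>\<^sup>+y. (\<integral>\<^sup>+x. F v y * H (y, x) \<partial>lborel) \<partial>lborel)"
        by (intro nn_integral_cong arg_cong2[where f="(*)"] refl Hsym)
      also have "\<dots> \<le> ennreal (M * Ck)" by (rule I2[OF vm FMv])
      finally show ?thesis .
    qed
    have "(\<integral>\<^sup>+z. ennreal (choq \<mu> p q \<Omega> u v z) \<partial>lborel2)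
       \<le> (\<integral>\<^sup>+z. F u (fst z) * F v (snd z) + F u (fst z) * H z + F v (snd z) * H z \<partial>lborel2)"
      by (intro nn_integral_mono pt)
    also have "\<dots> = (\<integral>\<^sup>+z. F u (fst z) * F v (snd z) \<partial>lborel2) +
        (\<integral>\<^sup>+z. F u (fst z) * H z \<partial>lborel2) + (\<integral>\<^sup>+z. F v (snd z) * H z \<partial>lborel2)"
      using mm by (simp add: nn_integral_add)
    also have "\<dots> \<le> ennreal (M * M) + ennreal (M * Ck) + ennreal (M * Ck)" by (intro add_mono I1 I3 I4)
    also have "\<dots> = ennreal C" unfolding C_def using M0 Ck(1) by (simp add: ennreal_plus[symmetric] del: ennreal_plus)
    finally show "(\<integral>\<^sup>+z. ennreal (choq \<mu> p q \<Omega> u v z) \<partial>lborel2) \<le> ennreal C" .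
  qed
qed

lemma choq_bound_Xspace:
  fixes \<Omega> :: "'a::euclidean_space set"
  assumes s: "0 < s" "2 * s < real DIM('a)" and \<mu>: "0 < \<mu>" "\<mu> < real DIM('a)"
    and p: "0 < p" "p < crit_exp DIM('a) s \<mu>" and q: "0 < q" "q < crit_exp DIM('a) s \<mu>"
    and \<Omega>: "bounded \<Omega>" "open \<Omega>"
  shows "\<exists>C\<ge>0. \<forall>u\<in>Xspace s \<Omega>. \<forall>v\<in>Xspace s \<Omega>. X_norm_sq s u \<le> E \<longrightarrow> X_norm_sq s v \<le> E \<longrightarrow>
     (\<integral>\<^sup>+z. ennreal (choq \<mu> p q \<Omega> u v z) \<partial>lborel2) \<le> ennreal C"
proof -
  obtain K where K: "K \<ge> 0" "\<And>u. u \<in> Xspace s \<Omega> \<Longrightarrow> X_norm_sq s u \<le> E \<Longrightarrow>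
     sob_int s u \<le> ennreal K"
    using fractional_Sobolev[OF s, of \<Omega> E] by blast
  obtain C where C: "C \<ge> 0" "\<And>u v. u \<in> borel_measurable borel \<Longrightarrow> v \<in> borel_measurable borel \<Longrightarrow>
     sob_int s u \<le> ennreal K \<Longrightarrow>
     sob_int s v \<le> ennreal K \<Longrightarrow>
     (\<integral>\<^sup>+z. ennreal (choq \<mu> p q \<Omega> u v z) \<partial>lborel2) \<le> ennreal C"
    using choq_bound[OF s \<mu> p q \<Omega> K(1)] by blast
  show ?thesis
    by (rule exI[of _ C]) (intro conjI ballI impI C Xspace_borel K; assumption)
qed

lemma choq_integrable:
  fixes \<Omega> :: "'a::euclidean_space set"
  assumes s: "0 < s" "2 * s < real DIM('a)" and \<mu>: "0 < \<mu>" "\<mu> < real DIM('a)"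
    and p: "0 < p" "p < crit_exp DIM('a) s \<mu>" and q: "0 < q" "q < crit_exp DIM('a) s \<mu>"
    and \<Omega>: "bounded \<Omega>" "open \<Omega>" and u: "u \<in> Xspace s \<Omega>" and v: "v \<in> Xspace s \<Omega>"
  shows "integrable lborel2 (choq \<mu> p q \<Omega> u v)"
proof -
  have [measurable]: "\<Omega> \<in> sets borel" "u \<in> borel_measurable borel" "v \<in> borel_measurable borel"
    using \<Omega> u v by (auto intro: Xspace_borel)
  obtain C where "(\<integral>\<^sup>+z. ennreal (choq \<mu> p q \<Omega> u v z) \<partial>lborel2) \<le> ennreal C"
    using choq_bound_Xspace[OF s \<mu> p q \<Omega>, of "max (X_norm_sq s u) (X_norm_sq s v)"] u v
    by (meson max.cobounded1 max.cobounded2)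
  then show ?thesis
    by (intro integrableI_bounded) (auto simp: choq_nonneg order_le_less_trans)
qed

text \<open>The strict inequalities leave room: raising the integrand to a power slightly above 1
  multiplies \<mu>, p and q by it, and the new exponents are still admissible. This bounds the
  moment that Vitali convergence asks for.\<close>

lemma choq_tendsto:
  fixes \<Omega> :: "'a::euclidean_space set"
  assumes s: "0 < s" "2 * s < real DIM('a)" and \<mu>: "0 < \<mu>" "\<mu> < real DIM('a)"
    and p: "0 < p" "p < crit_exp DIM('a) s \<mu>" and q: "0 < q" "q < crit_exp DIM('a) s \<mu>"
    and \<Omega>: "bounded \<Omega>" "open \<Omega>"
    and u: "\<And>n. u n \<in> Xspace s \<Omega>" "\<And>n. X_norm_sq s (u n) \<le> E" "AE x in lborel. (\<lambda>n. u n x) \<longlonglongrightarrow> uu x" "uu \<in> borel_measurable borel"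
    and v: "\<And>n. v n \<in> Xspace s \<Omega>" "\<And>n. X_norm_sq s (v n) \<le> E" "AE x in lborel. (\<lambda>n. v n x) \<longlonglongrightarrow> vv x" "vv \<in> borel_measurable borel"
  shows "(\<lambda>n. \<integral>z. choq \<mu> p q \<Omega> (u n) (v n) z \<partial>lborel2) \<longlonglongrightarrow> choq_int \<mu> p q \<Omega> uu vv"
proof -
  define N where "N = real DIM('a)"
  have N: "N > 0" "2 * s < N" "\<mu> < N" unfolding N_def using s \<mu> by auto
  have [measurable]: "\<Omega> \<in> sets borel" "uu \<in> borel_measurable borel" "vv \<in> borel_measurable borel" using \<Omega> u v by auto
  have [measurable]: "u n \<in> borel_measurable borel" "v n \<in> borel_measurable borel" for n
    using u v by (auto intro: Xspace_borel)
  have dp: "p * (N - 2 * s) + \<mu> > 0" "q * (N - 2 * s) + \<mu> > 0" using p q N \<mu> by (auto intro!: add_nonneg_pos)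
  \<comment> \<open>Solving p e1 < (2N - \<mu> e1)/(N-2s) for e1 gives the first bound, the same for
    q gives the second, and \<mu> e1 < N the third.\<close>
  have "1 < min (2 * N / (p * (N - 2 * s) + \<mu>)) (min (2 * N / (q * (N - 2 * s) + \<mu>)) (N / \<mu>))"
    using p(2) q(2) N \<mu> dp unfolding crit_exp_def N_def[symmetric] by (simp add: field_simps)
  then obtain e1 where e1: "1 < e1" "e1 < min (2 * N / (p * (N - 2 * s) + \<mu>)) (min (2 * N / (q * (N - 2 * s) + \<mu>)) (N / \<mu>))"
    using dense by blast
  define e where "e = e1 - 1"
  have e: "e > 0" "e1 = 1 + e" unfolding e_def using e1 by auto
  have 1: "0 < \<mu> * e1" "\<mu> * e1 < real DIM('a)" "0 < p * e1" "p * e1 < crit_exp DIM('a) s (\<mu> * e1)" "0 < q * e1" "q * e1 < crit_exp DIM('a) s (\<mu> * e1)"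
    using e1 \<mu> p q N dp unfolding crit_exp_def N_def[symmetric] by (auto simp: field_simps)
  obtain C where C: "C \<ge> 0" "\<And>u v. u \<in> Xspace s \<Omega> \<Longrightarrow> v \<in> Xspace s \<Omega> \<Longrightarrow> X_norm_sq s u \<le> E \<Longrightarrow> X_norm_sq s v \<le> E \<Longrightarrow>
     (\<integral>\<^sup>+z. ennreal (choq (\<mu> * e1) (p * e1) (q * e1) \<Omega> u v z) \<partial>lborel2) \<le> ennreal C"
    using choq_bound_Xspace[OF s 1 \<Omega>, of E] by blast
  have pw: "choq \<mu> p q \<Omega> u v z powr (1 + e) = choq (\<mu> * e1) (p * e1) (q * e1) \<Omega> u v z" for u v z
    unfolding choq_def e(2)[symmetric] by (simp add: powr_mult powr_powr indicator_def)
  have \<Omega>f: "emeasure lborel2 (\<Omega> \<times> \<Omega>) < \<infinity>"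
  proof -
    have "emeasure lborel \<Omega> < \<infinity>" using emeasure_bounded_finite[OF \<Omega>(1)] by simp
    then show ?thesis by (subst lborel.emeasure_pair_measure_Times) (auto simp: ennreal_mult_less_top)
  qed
  show ?thesis
  proof (rule Vitali_bounded_moment(2)[where A = "\<Omega> \<times> \<Omega>" and e = e and C = C])
    show "\<Omega> \<times> \<Omega> \<in> sets lborel2" by (intro pair_measureI) auto
    show "choq \<mu> p q \<Omega> (u n) (v n) x = 0" if "x \<notin> \<Omega> \<times> \<Omega>" for x n
      using that by (cases x) (auto simp: choq_def)
    show "(\<integral>\<^sup>+x. ennreal (choq \<mu> p q \<Omega> (u n) (v n) x powr (1 + e)) \<partial>lborel2) \<le> ennreal C" for n
      unfolding pw by (intro C u v)
    show "AE x in lborel2. (\<lambda>n. choq \<mu> p q \<Omega> (u n) (v n) x) \<longlonglongrightarrow> choq \<mu> p q \<Omega> uu vv x"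
      using AE_lborel_fst_snd[OF u(3)] AE_lborel_fst_snd[OF v(3)]
    proof eventually_elim
      case (elim z)
      show ?case unfolding choq_def using elim p q
        by (intro tendsto_mult tendsto_const tendsto_powr' tendsto_rabs) auto
    qed
  qed (use \<Omega>f choq_nonneg e C in auto)
qed

text \<open>Vitali convergence for the squares: with 1+e equal to half the Sobolev exponent, the
  moment of u^2 is the Sobolev integral, which is bounded along the sequence.\<close>

lemma L2_tendsto:
  fixes \<Omega> :: "'a::euclidean_space set"
  assumes s: "0 < s" "2 * s < real DIM('a)" and \<Omega>: "bounded \<Omega>" "open \<Omega>"
    and u: "\<And>n. u n \<in> Xspace s \<Omega>" "\<And>n. X_norm_sq s (u n) \<le> E" "AE x in lborel. (\<lambda>n. u n x) \<longlonglongrightarrow> uu x" "uu \<in> Xspace s \<Omega>"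
  shows "(\<lambda>n. \<integral>x. (u n x)\<^sup>2 \<partial>lborel) \<longlonglongrightarrow> L2sq uu"
proof -
  have [measurable]: "\<Omega> \<in> sets borel" "uu \<in> borel_measurable borel" "\<And>n. u n \<in> borel_measurable borel"
    using \<Omega> u by (auto intro: Xspace_borel)
  obtain K where K: "K \<ge> 0" "\<And>u. u \<in> Xspace s \<Omega> \<Longrightarrow> X_norm_sq s u \<le> E \<Longrightarrow>
     sob_int s u \<le> ennreal K"
    using fractional_Sobolev[OF s, of \<Omega> E] by blast
  define e where "e = sob_exp TYPE('a) s / 2 - 1"
  have e: "e > 0" unfolding e_def sob_exp_def using s by (simp add: field_simps)
  have eq: "L2sq w = (\<integral>x. indicator \<Omega> x * (w x)\<^sup>2 \<partial>lborel)" if w: "w \<in> Xspace s \<Omega>" for w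
  proof (rule integral_cong_AE)
    have [measurable]: "w \<in> borel_measurable borel" using w by (rule Xspace_borel)
    show "(\<lambda>x. (w x)\<^sup>2) \<in> borel_measurable lborel" "(\<lambda>x. indicator \<Omega> x * (w x)\<^sup>2) \<in> borel_measurable lborel" by measurable
    show "AE x in lborel. (w x)\<^sup>2 = indicator \<Omega> x * (w x)\<^sup>2"
      using Xspace_AE[OF w] by eventually_elim (auto simp: indicator_def)
  qed
  show ?thesis unfolding eq[OF u(1)] eq[OF u(4)]
  proof (rule Vitali_bounded_moment(2)[where A = \<Omega> and e = e and C = K])
    show "emeasure lborel \<Omega> < \<infinity>" using emeasure_bounded_finite[OF \<Omega>(1)] by simp
    show "AE x in lborel. (\<lambda>n. indicator \<Omega> x * (u n x)\<^sup>2) \<longlonglongrightarrow> indicator \<Omega> x * (uu x)\<^sup>2"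
      using u(3) by eventually_elim (intro tendsto_intros)
    fix n
    have "(\<integral>\<^sup>+x. ennreal ((indicator \<Omega> x * (u n x)\<^sup>2) powr (1 + e)) \<partial>lborel) \<le> (\<integral>\<^sup>+x. ennreal (\<bar>u n x\<bar> powr sob_exp TYPE('a) s) \<partial>lborel)"
    proof (rule nn_integral_mono, rule ennreal_leI)
      fix x
      have "(u n x)\<^sup>2 = \<bar>u n x\<bar> powr 2" by simp
      then have "((u n x)\<^sup>2) powr (1 + e) = \<bar>u n x\<bar> powr (2 * (1 + e))" by (simp only: powr_powr)
      also have "2 * (1 + e) = sob_exp TYPE('a) s" unfolding e_def by simp
      finally show "(indicator \<Omega> x * (u n x)\<^sup>2) powr (1 + e) \<le> \<bar>u n x\<bar> powr sob_exp TYPE('a) s"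
        by (simp add: indicator_def)
    qed
    also have "\<dots> \<le> ennreal K" by (intro K u)
    finally show "(\<integral>\<^sup>+x. ennreal ((indicator \<Omega> x * (u n x)\<^sup>2) powr (1 + e)) \<partial>lborel) \<le> ennreal K" .
  qed (use e K in auto)
qed

section \<open>The quadratic form and the maximisation problem\<close>

lemma matA_mult: "matA a b c *v w = vector [a * w$1 + b * w$2, b * w$1 + c * w$2]"
  unfolding matA_def vec_eq_iff forall_2 by (simp add: matrix_vector_mult_def sum_2)

text \<open>The larger root m of the characteristic polynomial satisfies m \<ge> a, m \<ge> c and
  (m-a)(m-c) = b^2, so completing the square shows that m I - A is positive semidefinite. The rest
  identifies m as a member of the set under \<open>Max\<close>.\<close>

lemma quadratic_form_le_largest_eigenvalue:
  fixes a b c x y :: real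
  shows "a * x\<^sup>2 + 2 * b * (x * y) + c * y\<^sup>2 \<le> largest_eigenvalue (matA a b c) * (x\<^sup>2 + y\<^sup>2)"
proof -
  define D where "D = sqrt ((a - c)\<^sup>2 + 4 * b\<^sup>2)"
  have D2: "D * D = (a - c) * (a - c) + 4 * (b * b)"
    unfolding D_def by (simp add: power2_eq_square[symmetric])
  have D0: "D \<ge> 0" unfolding D_def by simp
  have Dge: "\<bar>a - c\<bar> \<le> D" unfolding D_def by (rule real_le_rsqrt) simp
  define m where "m = ((a + c) + D) / 2"
  define E where "E = {l. \<exists>w::real^2. w \<noteq> 0 \<and> matA a b c *v w = l *\<^sub>R w}"
  have A: "m - a \<ge> 0" "m - c \<ge> 0" using Dge unfolding m_def by (auto simp: field_simps abs_le_iff)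
  have AC: "(m - a) * (m - c) = b * b" unfolding m_def using D2 by (simp add: field_simps)
  have iff: "l \<in> E \<longleftrightarrow> (\<exists>x y. (x \<noteq> 0 \<or> y \<noteq> 0) \<and> a * x + b * y = l * x \<and> b * x + c * y = l * y)" for l
  proof
    assume "l \<in> E"
    then obtain w :: "real^2" where w: "w \<noteq> 0" "matA a b c *v w = l *\<^sub>R w" unfolding E_def by auto
    have "w$1 \<noteq> 0 \<or> w$2 \<noteq> 0" using w(1) unfolding vec_eq_iff forall_2 by auto
    moreover have "a * w$1 + b * w$2 = l * w$1" "b * w$1 + c * w$2 = l * w$2"
      using w(2) unfolding matA_mult vec_eq_iff forall_2 by auto
    ultimately show "\<exists>x y. (x \<noteq> 0 \<or> y \<noteq> 0) \<and> a * x + b * y = l * x \<and> b * x + c * y = l * y" by blast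
  next
    assume "\<exists>x y. (x \<noteq> 0 \<or> y \<noteq> 0) \<and> a * x + b * y = l * x \<and> b * x + c * y = l * y"
    then obtain x y where xy: "x \<noteq> 0 \<or> y \<noteq> 0" "a * x + b * y = l * x" "b * x + c * y = l * y" by blast
    have "vector [x, y] \<noteq> (0::real^2)" "matA a b c *v vector [x, y] = l *\<^sub>R vector [x, y]"
      using xy unfolding matA_mult vec_eq_iff forall_2 by auto
    then show "l \<in> E" unfolding E_def by blast
  qed
  have "m \<in> E"
  proof (cases "b = 0")
    case False
    \<comment> \<open>The eigenvector is (b, m-a); it is nonzero because b is.\<close>
    then show ?thesis unfolding iff using AC
      by (intro exI[of _ b] exI[of _ "m - a"]) (auto simp: algebra_simps)
  next
    case True
    then have "m = a \<or> m = c" using AC by auto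
    then show ?thesis
    proof
      assume "m = a" then show ?thesis unfolding iff using True by (intro exI[of _ 1] exI[of _ 0]) auto
    next
      assume "m = c" then show ?thesis unfolding iff using True by (intro exI[of _ 0] exI[of _ 1]) auto
    qed
  qed
  \<comment> \<open>The bound by \<open>Max\<close> requires a finite set: each eigenvalue solves
    (l-a)(l-c) = b^2 and is one of two roots.\<close>
  moreover have "finite E"
  proof (rule finite_subset)
    show "E \<subseteq> {((a + c) + D) / 2, ((a + c) - D) / 2}"
    proof
      fix l assume "l \<in> E"
      then obtain x y where xy: "x \<noteq> 0 \<or> y \<noteq> 0" "a * x + b * y = l * x" "b * x + c * y = l * y" using iff by auto
      have e1: "(l - a) * x = b * y" "(l - c) * y = b * x" using xy by (auto simp: algebra_simps)
      have "(l - a) * (l - c) * x = b * b * x"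
      proof -
        have "(l - a) * (l - c) * x = (l - c) * ((l - a) * x)" by (simp add: mult_ac)
        also have "\<dots> = b * ((l - c) * y)" by (simp only: e1(1)) simp
        also have "\<dots> = b * b * x" by (simp only: e1(2) mult.assoc)
        finally show ?thesis .
      qed
      moreover have "(l - a) * (l - c) * y = b * b * y"
      proof -
        have "(l - a) * (l - c) * y = (l - a) * ((l - c) * y)" by (simp add: mult_ac)
        also have "\<dots> = b * ((l - a) * x)" by (simp only: e1(2)) simp
        also have "\<dots> = b * b * y" by (simp only: e1(1) mult.assoc)
        finally show ?thesis .
      qed
      ultimately have "(l - a) * (l - c) = b * b" using xy(1) by auto
      then have "(2 * l - (a + c)) * (2 * l - (a + c)) = D * D" unfolding D2 by (simp add: algebra_simps)
      then have "2 * l - (a + c) = D \<or> 2 * l - (a + c) = - D" by (simp only: square_eq_iff)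
      then show "l \<in> {((a + c) + D) / 2, ((a + c) - D) / 2}" by (auto simp: field_simps)
    qed
  qed simp
  ultimately have m_le: "m \<le> largest_eigenvalue (matA a b c)"
    unfolding largest_eigenvalue_def E_def[symmetric] by (rule Max_ge[rotated])
  have "0 \<le> (m - a) * x\<^sup>2 - 2 * b * (x * y) + (m - c) * y\<^sup>2"
  proof (cases "m - a = 0")
    case True
    then have "b = 0" using AC by simp
    then show ?thesis using True A by simp
  next
    case False
    then have pos: "m - a > 0" using A by simp
    have "(m - a) * ((m - a) * x\<^sup>2 - 2 * b * (x * y) + (m - c) * y\<^sup>2) = ((m - a) * x)\<^sup>2 - 2 * ((m - a) * x) * (b * y) + ((m - a) * (m - c)) * y\<^sup>2"
      by (simp add: power2_eq_square algebra_simps)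
    also have "\<dots> = ((m - a) * x - b * y)\<^sup>2" unfolding AC by (simp add: power2_eq_square algebra_simps)
    finally have "0 \<le> (m - a) * ((m - a) * x\<^sup>2 - 2 * b * (x * y) + (m - c) * y\<^sup>2)" by simp
    then show ?thesis using pos by (simp add: zero_le_mult_iff)
  qed
  then have "a * x\<^sup>2 + 2 * b * (x * y) + c * y\<^sup>2 \<le> m * (x\<^sup>2 + y\<^sup>2)" by (simp add: algebra_simps)
  also have "\<dots> \<le> largest_eigenvalue (matA a b c) * (x\<^sup>2 + y\<^sup>2)" using m_le by (rule mult_right_mono) simp
  finally show ?thesis .
qed

section \<open>The quadratic form: coercivity, absolute values and limits\<close>

lemma lambda1_le:
  assumes u: "u \<in> Xspace s \<Omega>"
  shows "lambda1 s \<Omega> * L2sq u \<le> X_norm_sq s u"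
proof (cases "L2sq u = 0")
  case True then show ?thesis using X_norm_sq_nonneg by simp
next
  case False
  have pos: "L2sq u > 0" using False by (simp add: order_less_le)
  have "lambda1 s \<Omega> \<le> X_norm_sq s u / L2sq u"
    unfolding lambda1_def
  proof (rule cInf_lower)
    show "bdd_below {X_norm_sq s u / L2sq u | u. u \<in> Xspace s \<Omega> \<and> L2sq u \<noteq> 0}"
      by (rule bdd_belowI[of _ 0]) (auto intro!: divide_nonneg_nonneg X_norm_sq_nonneg)
  qed (use u False in blast)
  then show ?thesis using pos by (simp add: field_simps)
qed

text \<open>Integrals run over the whole space, which is harmless for functions vanishing almost
  everywhere off \<Omega>; \<open>integral_eq_set_integral_Xspace\<close> restores the restriction
  to \<Omega>.\<close>

definition QF :: "real \<Rightarrow> real \<Rightarrow> real \<Rightarrow> real \<Rightarrow> ('a::euclidean_space \<Rightarrow> real) \<Rightarrow> ('a \<Rightarrow> real) \<Rightarrow> real" where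
  "QF s a b c u v = X_norm_sq s u + X_norm_sq s v -
     (a * L2sq u + 2 * b * (\<integral>x. u x * v x \<partial>lborel) + c * L2sq v)"

lemma QF_commute: "QF s a b c u v = QF s c b a v u"
  unfolding QF_def by (simp add: mult.commute)

lemma QF_cmult:
  fixes u v :: "'a::euclidean_space \<Rightarrow> real"
  assumes u: "u \<in> Xspace s \<Omega>" and v: "v \<in> Xspace s \<Omega>"
  shows "QF s a b c (\<lambda>x. t * u x) (\<lambda>x. t * v x) = t\<^sup>2 * QF s a b c u v"
proof -
  have "(\<integral>x. t * u x * (t * v x) \<partial>lborel) = (\<integral>x. t\<^sup>2 * (u x * v x) \<partial>lborel)"
    by (rule Bochner_Integration.integral_cong) (auto simp: power2_eq_square)
  then have 1: "(\<integral>x. t * u x * (t * v x) \<partial>lborel) = t\<^sup>2 * (\<integral>x. u x * v x \<partial>lborel)" by simp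
  have 2: "(\<integral>x. (t * w x)\<^sup>2 \<partial>lborel) = t\<^sup>2 * L2sq w" for w :: "'a \<Rightarrow> real"
    by (simp add: power_mult_distrib)
  show ?thesis
    unfolding QF_def X_norm_sq_cmult[OF u] X_norm_sq_cmult[OF v] 1 2 by (simp add: algebra_simps)
qed

lemma QF_coercive:
  assumes lt: "largest_eigenvalue (matA a b c) < lambda1 s \<Omega>"
  shows "\<exists>\<delta>>0. \<forall>u\<in>Xspace s \<Omega>. \<forall>v\<in>Xspace s \<Omega>. \<delta> * (X_norm_sq s u + X_norm_sq s v) \<le> QF s a b c u v"
proof -
  define m where "m = largest_eigenvalue (matA a b c)"
  define l where "l = lambda1 s \<Omega>"
  have ml: "m < l" using lt unfolding m_def l_def .
  define \<delta> where "\<delta> = (if m \<le> 0 then 1 else 1 - m / l)"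
  have \<delta>: "\<delta> > 0" unfolding \<delta>_def using ml by (auto simp: field_simps)
  have one: "m * L2sq u \<le> (1 - \<delta>) * X_norm_sq s u" if u: "u \<in> Xspace s \<Omega>" for u
  proof (cases "m \<le> 0")
    case True
    then have "m * L2sq u \<le> 0" by (intro mult_nonpos_nonneg) auto
    then show ?thesis unfolding \<delta>_def using True by simp
  next
    case False
    then have pos: "m > 0" "l > 0" using ml by auto
    have "m / l * (l * L2sq u) \<le> m / l * X_norm_sq s u"
      using lambda1_le[OF u] pos unfolding l_def by (intro mult_left_mono) auto
    then show ?thesis unfolding \<delta>_def using False pos by simp
  qed
  show ?thesis
  proof (intro exI[of _ \<delta>] conjI ballI \<delta>)
    fix u v assume u: "u \<in> Xspace s \<Omega>" and v: "v \<in> Xspace s \<Omega>"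
    note i = Xspace_sq[OF u] Xspace_sq[OF v] Xspace_mult[OF u v]
    have "a * L2sq u + 2 * b * (\<integral>x. u x * v x \<partial>lborel) + c * L2sq v
       = (\<integral>x. a * (u x)\<^sup>2 + 2 * b * (u x * v x) + c * (v x)\<^sup>2 \<partial>lborel)"
      using i by simp
    also have "\<dots> \<le> (\<integral>x. m * ((u x)\<^sup>2 + (v x)\<^sup>2) \<partial>lborel)"
      using i unfolding m_def
      by (intro integral_mono quadratic_form_le_largest_eigenvalue) auto
    also have "\<dots> = m * L2sq u + m * L2sq v"
      using i by (simp add: algebra_simps)
    also have "\<dots> \<le> (1 - \<delta>) * X_norm_sq s u + (1 - \<delta>) * X_norm_sq s v"
      by (intro add_mono one u v)
    finally show "\<delta> * (X_norm_sq s u + X_norm_sq s v) \<le> QF s a b c u v"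
      unfolding QF_def by (simp add: algebra_simps)
  qed
qed

text \<open>The energies decrease by contraction, while the coupling integral, entering with weight
  -2b \<le> 0, can only grow.\<close>

lemma QF_abs_le:
  fixes u v :: "'a::euclidean_space \<Rightarrow> real"
  assumes u: "u \<in> Xspace s \<Omega>" and v: "v \<in> Xspace s \<Omega>" and b: "b \<ge> 0"
  shows "QF s a b c (\<lambda>x. \<bar>u x\<bar>) (\<lambda>x. \<bar>v x\<bar>) \<le> QF s a b c u v"
proof -
  have 1: "X_norm_sq s (\<lambda>x. \<bar>w x\<bar>) \<le> X_norm_sq s w" if w: "w \<in> Xspace s \<Omega>" for w :: "'a \<Rightarrow> real"
    by (rule X_norm_sq_mono[OF w Xspace_borel[OF Xspace_abs[OF w]] abs_triangle_ineq3])
  have "(\<integral>x. u x * v x \<partial>lborel) \<le> (\<integral>x. \<bar>u x\<bar> * \<bar>v x\<bar> \<partial>lborel)"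
    by (rule integral_mono[OF Xspace_mult[OF u v] Xspace_mult[OF Xspace_abs[OF u] Xspace_abs[OF v]]])
      (metis abs_ge_self abs_mult)
  then have "2 * b * (\<integral>x. u x * v x \<partial>lborel) \<le> 2 * b * (\<integral>x. \<bar>u x\<bar> * \<bar>v x\<bar> \<partial>lborel)"
    using b by (intro mult_left_mono) auto
  then show ?thesis unfolding QF_def power2_abs using 1[OF u] 1[OF v] by linarith
qed

lemma X_norm_sq_add_le:
  fixes u v :: "'a::euclidean_space \<Rightarrow> real"
  assumes u: "u \<in> Xspace s \<Omega>" and v: "v \<in> Xspace s \<Omega>"
  shows "X_norm_sq s (\<lambda>x. u x + v x) \<le> 2 * X_norm_sq s u + 2 * X_norm_sq s v"
  using X_norm_sq_add[OF u v, of 1] X_norm_sq_add[OF u v, of "-1"] X_norm_sq_nonneg[of s "\<lambda>x. u x + (-1) * v x"]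
  by simp

text \<open>By polarisation the mixed integral is a combination of three squared L2 norms; the
  energy of the sum stays bounded by the parallelogram law.\<close>

lemma integral_mult_tendsto:
  fixes \<Omega> :: "'a::euclidean_space set"
  assumes s: "0 < s" "2 * s < real DIM('a)" and \<Omega>: "bounded \<Omega>" "open \<Omega>"
    and u: "\<And>n. u n \<in> Xspace s \<Omega>" "\<And>n. X_norm_sq s (u n) \<le> E" "AE x in lborel. (\<lambda>n. u n x) \<longlonglongrightarrow> uu x" "uu \<in> Xspace s \<Omega>"
    and v: "\<And>n. v n \<in> Xspace s \<Omega>" "\<And>n. X_norm_sq s (v n) \<le> E" "AE x in lborel. (\<lambda>n. v n x) \<longlonglongrightarrow> vv x" "vv \<in> Xspace s \<Omega>"
  shows "(\<lambda>n. \<integral>x. u n x * v n x \<partial>lborel) \<longlonglongrightarrow> (\<integral>x. uu x * vv x \<partial>lborel)"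
proof -
  have polar: "(\<integral>x. f x * g x \<partial>lborel) = ((\<integral>x. (f x + g x)\<^sup>2 \<partial>lborel) - L2sq f - L2sq g) / 2"
    if f: "f \<in> Xspace s \<Omega>" and g: "g \<in> Xspace s \<Omega>" for f g
    using Xspace_sq[OF f] Xspace_sq[OF g] Xspace_mult[OF f g] by (simp add: power2_sum mult.assoc)
  have sum: "(\<lambda>x. f x + g x) \<in> Xspace s \<Omega>" if f: "f \<in> Xspace s \<Omega>" and g: "g \<in> Xspace s \<Omega>" for f g
    using Xspace_add_mult[OF f g, of 1 1] by simp
  have "(\<lambda>n. \<integral>x. (u n x + v n x)\<^sup>2 \<partial>lborel) \<longlonglongrightarrow> (\<integral>x. (uu x + vv x)\<^sup>2 \<partial>lborel)"
  proof (rule L2_tendsto[OF s \<Omega>, where E = "4 * E"])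
    show "X_norm_sq s (\<lambda>x. u n x + v n x) \<le> 4 * E" for n
      using X_norm_sq_add_le[OF u(1) v(1), of n n] u(2)[of n] v(2)[of n] by linarith
    show "AE x in lborel. (\<lambda>n. u n x + v n x) \<longlonglongrightarrow> uu x + vv x"
      using u(3) v(3) by eventually_elim (rule tendsto_add)
  qed (use sum u v in auto)
  then show ?thesis unfolding polar[OF u(1) v(1)] polar[OF u(4) v(4)]
    by (intro tendsto_intros L2_tendsto[OF s \<Omega> u] L2_tendsto[OF s \<Omega> v]) auto
qed

section \<open>Attainment of the maximum\<close>

lemma open_not_AE_null:
  assumes "open \<Omega>" "\<Omega> \<noteq> {}"
  shows "\<not> (AE x in lborel. x \<notin> (\<Omega> :: 'a::euclidean_space set))"
proof
  assume ae: "AE x in lborel. x \<notin> \<Omega>"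
  obtain x e where e: "e > 0" "ball x e \<subseteq> \<Omega>" using assms by (meson all_not_in_conv openE)
  have "AE y in lborel. y \<notin> ball x e" using ae by eventually_elim (use e in auto)
  then have "emeasure lborel (ball x e) = 0" by (subst (asm) AE_iff_measurable[OF _ refl]) (auto simp: ball_def)
  moreover have "unit_ball_vol (real DIM('a)) * e ^ DIM('a) > 0" using e(1) by (intro mult_pos_pos unit_ball_vol_pos) auto
  ultimately show False using e(1) by (auto simp: emeasure_ball)
qed

lemma choq_integral_pos:
  fixes \<Omega> :: "'a::euclidean_space set"
  assumes \<Omega>: "open \<Omega>" "\<Omega> \<noteq> {}" and int: "integrable lborel2 (choq \<mu> p q \<Omega> u v)"
    and pos: "\<And>x. x \<in> \<Omega> \<Longrightarrow> u x > 0" "\<And>x. x \<in> \<Omega> \<Longrightarrow> v x > 0"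
  shows "choq_int \<mu> p q \<Omega> u v > 0"
proof (rule ccontr)
  assume "\<not> ?thesis"
  then have "choq_int \<mu> p q \<Omega> u v = 0"
    by (simp add: order_less_le choq_nonneg)
  then have "AE z in lborel2. choq \<mu> p q \<Omega> u v z = 0"
    using int by (subst (asm) integral_nonneg_eq_0_iff_AE) (auto simp: choq_nonneg)
  then have "AE x in lborel. AE y in lborel. choq \<mu> p q \<Omega> u v (x, y) = 0"
    by (rule lborel_pair.AE_pair)
  then have "AE x in lborel. x \<notin> \<Omega>"
  proof eventually_elim
    case (elim x)
    show ?case
    proof
      assume x: "x \<in> \<Omega>"
      \<comment> \<open>The point y = x is excluded because the integrand is 0 on the
        diagonal.\<close>
      have "AE y in lborel. y \<notin> \<Omega>"
        using elim AE_lborel_singleton[of x]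
      proof eventually_elim
        case (elim y)
        show ?case
        proof
          assume "y \<in> \<Omega>"
          then have "choq \<mu> p q \<Omega> u v (x, y) > 0"
            unfolding choq_def using x elim(2) pos(1)[of x] pos(2)[of y] by simp
          then show False using elim(1) by simp
        qed
      qed
      then show False using open_not_AE_null[OF \<Omega>] by simp
    qed
  qed
  then show False using open_not_AE_null[OF \<Omega>] by simp
qed

lemma choq_cmult:
  assumes "t \<ge> 0"
  shows "choq \<mu> p q \<Omega> (\<lambda>x. t * u x) (\<lambda>x. t * v x) z = t powr (p + q) * choq \<mu> p q \<Omega> u v z"
  unfolding choq_def using assms by (simp add: abs_mult powr_mult powr_add)

text \<open>Direct method: coercivity bounds the energies on the constraint set, a common
  subsequence converges almost everywhere, \<open>choq_int\<close> is continuous along it and the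
  sublevel set of \<open>QF\<close> is closed under such limits.\<close>

lemma choq_maximizer:
  fixes \<Omega> :: "'a::euclidean_space set"
  assumes s: "0 < s" "s < 1" "2 * s < real DIM('a)" and \<mu>: "0 < \<mu>" "\<mu> < real DIM('a)"
    and p: "0 < p" "p < crit_exp DIM('a) s \<mu>" and q: "0 < q" "q < crit_exp DIM('a) s \<mu>"
    and \<Omega>: "bounded \<Omega>" "open \<Omega>" "\<Omega> \<noteq> {}" and b: "b \<ge> 0"
    and lt: "largest_eigenvalue (matA a b c) < lambda1 s \<Omega>"
  shows "\<exists>u v S. u \<in> Xspace s \<Omega> \<and> v \<in> Xspace s \<Omega> \<and> (\<forall>x. 0 \<le> u x) \<and> (\<forall>x. 0 \<le> v x) \<and> S > 0 \<and>
     QF s a b c u v \<le> 1 \<and> choq_int \<mu> p q \<Omega> u v = S \<and>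
     (\<forall>u'\<in>Xspace s \<Omega>. \<forall>v'\<in>Xspace s \<Omega>. QF s a b c u' v' \<le> 1 \<longrightarrow> choq_int \<mu> p q \<Omega> u' v' \<le> S)"
proof -
  let ?I = "choq_int \<mu> p q \<Omega>"
  note ci = choq_integrable[OF s(1,3) \<mu> p q \<Omega>(1,2)]
  obtain \<delta> where \<delta>: "\<delta> > 0" "\<And>u v. u \<in> Xspace s \<Omega> \<Longrightarrow> v \<in> Xspace s \<Omega> \<Longrightarrow> \<delta> * (X_norm_sq s u + X_norm_sq s v) \<le> QF s a b c u v"
    using QF_coercive[OF lt] by blast
  define E where "E = 1 / \<delta>"
  have XE: "X_norm_sq s u \<le> E" "X_norm_sq s v \<le> E"
    if "u \<in> Xspace s \<Omega>" "v \<in> Xspace s \<Omega>" "QF s a b c u v \<le> 1" for u v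
  proof -
    have "X_norm_sq s u + X_norm_sq s v \<le> E"
      using \<delta>(2)[OF that(1,2)] that(3) \<delta>(1) unfolding E_def by (simp add: field_simps)
    then show "X_norm_sq s u \<le> E" "X_norm_sq s v \<le> E" using X_norm_sq_nonneg[of s u] X_norm_sq_nonneg[of s v] by linarith+
  qed
  obtain C where C: "C \<ge> 0" "\<And>u v. u \<in> Xspace s \<Omega> \<Longrightarrow> v \<in> Xspace s \<Omega> \<Longrightarrow> X_norm_sq s u \<le> E \<Longrightarrow> X_norm_sq s v \<le> E \<Longrightarrow>
     (\<integral>\<^sup>+z. ennreal (choq \<mu> p q \<Omega> u v z) \<partial>lborel2) \<le> ennreal C"
    using choq_bound_Xspace[OF s(1,3) \<mu> p q \<Omega>(1,2), of E] by blast
  define T where "T = {?I u v | u v. u \<in> Xspace s \<Omega> \<and> v \<in> Xspace s \<Omega> \<and> QF s a b c u v \<le> 1}"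
  have "t \<le> C" if tT: "t \<in> T" for t
  proof -
    obtain u v where uv: "u \<in> Xspace s \<Omega>" "v \<in> Xspace s \<Omega>" "QF s a b c u v \<le> 1" "t = ?I u v" using tT unfolding T_def by blast
    have "ennreal t = (\<integral>\<^sup>+z. ennreal (choq \<mu> p q \<Omega> u v z) \<partial>lborel2)"
      unfolding uv(4) by (rule nn_integral_eq_integral[symmetric, OF ci[OF uv(1,2)]]) (simp add: choq_nonneg)
    also have "\<dots> \<le> ennreal C" using C(2) uv XE by blast
    finally show ?thesis using C(1) by (simp add: ennreal_le_iff)
  qed
  then have bdd: "bdd_above T" by (rule bdd_aboveI)
  obtain \<eta> where \<eta>: "\<eta> \<in> Xspace s \<Omega>" "\<And>x. x \<in> \<Omega> \<Longrightarrow> \<eta> x > 0"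
    using Xspace_positive_function[OF s(1,2) \<Omega>(1,2)] by blast
  obtain \<epsilon> where \<epsilon>: "\<epsilon> > 0" "\<epsilon>\<^sup>2 * QF s a b c \<eta> \<eta> \<le> 1"
  proof
    \<comment> \<open>Scaling by 1/sqrt k puts the positive competitor inside the constraint set;
      the maximum with 1 keeps k positive.\<close>
    define k where "k = max 1 (QF s a b c \<eta> \<eta>)"
    show "1 / sqrt k > 0" unfolding k_def by simp
    show "(1 / sqrt k)\<^sup>2 * QF s a b c \<eta> \<eta> \<le> 1" unfolding k_def by (simp add: power_divide field_simps)
  qed
  define t1 where "t1 = ?I (\<lambda>x. \<epsilon> * \<eta> x) (\<lambda>x. \<epsilon> * \<eta> x)"
  have t1: "t1 \<in> T"
    unfolding T_def t1_def using Xspace_cmult[OF \<eta>(1), of \<epsilon>] QF_cmult[OF \<eta>(1) \<eta>(1), of a b c \<epsilon>] \<epsilon>(2) by force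
  have t1pos: "t1 > 0" unfolding t1_def
    using \<epsilon>(1) \<eta>(2) by (intro choq_integral_pos[OF \<Omega>(2,3)] ci Xspace_cmult \<eta>(1)) auto
  define S where "S = Sup T"
  have S: "S > 0" unfolding S_def using cSup_upper[OF t1 bdd] t1pos by linarith
  have "\<exists>u v. u \<in> Xspace s \<Omega> \<and> v \<in> Xspace s \<Omega> \<and> QF s a b c u v \<le> 1 \<and> S - 1 / real (Suc n) < ?I u v" for n
  proof -
    have "S - 1 / real (Suc n) < Sup T" unfolding S_def by simp
    then obtain t where "t \<in> T" "S - 1 / real (Suc n) < t" using less_cSupD[of T] t1 by blast
    then show ?thesis unfolding T_def by auto
  qed
  then obtain u v where uv: "\<And>n. u n \<in> Xspace s \<Omega>" "\<And>n. v n \<in> Xspace s \<Omega>" "\<And>n. QF s a b c (u n) (v n) \<le> 1"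
     "\<And>n. S - 1 / real (Suc n) < ?I (u n) (v n)" by metis
  have E: "X_norm_sq s (u n) \<le> E" "X_norm_sq s (v n) \<le> E" for n using XE uv by blast+
  obtain k1 w1 A1 where 1: "strict_mono (k1::nat\<Rightarrow>nat)" "w1 \<in> Xspace s \<Omega>" "AE x in lborel. (\<lambda>n. u (k1 n) x) \<longlonglongrightarrow> w1 x"
     "(\<lambda>n. X_norm_sq s (u (k1 n))) \<longlonglongrightarrow> A1" "X_norm_sq s w1 \<le> A1"
    using Rellich[of s \<Omega> u E, OF s(1) \<Omega>(1,2) uv(1) E(1)] by blast
  \<comment> \<open>The extraction for \<open>v\<close> runs along \<open>k1\<close>, so that the
    composite sequence serves both components.\<close>
  obtain k2 w2 A2 where 2: "strict_mono (k2::nat\<Rightarrow>nat)" "w2 \<in> Xspace s \<Omega>" "AE x in lborel. (\<lambda>n. v (k1 (k2 n)) x) \<longlonglongrightarrow> w2 x"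
     "(\<lambda>n. X_norm_sq s (v (k1 (k2 n)))) \<longlonglongrightarrow> A2" "X_norm_sq s w2 \<le> A2"
    using Rellich[of s \<Omega> "\<lambda>n. v (k1 n)" E, OF s(1) \<Omega>(1,2) uv(2) E(2)] by blast
  define k where "k n = k1 (k2 n)" for n
  have k: "strict_mono k" using strict_mono_o[OF 1(1) 2(1)] unfolding k_def o_def .
  have l1: "AE x in lborel. (\<lambda>n. u (k n) x) \<longlonglongrightarrow> w1 x"
    using 1(3)
  proof eventually_elim
    case (elim x)
    from LIMSEQ_subseq_LIMSEQ[OF elim 2(1)] show ?case by (simp add: k_def o_def)
  qed
  have l2: "AE x in lborel. (\<lambda>n. v (k n) x) \<longlonglongrightarrow> w2 x" using 2(3) unfolding k_def .
  have X1: "(\<lambda>n. X_norm_sq s (u (k n))) \<longlonglongrightarrow> A1"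
    using LIMSEQ_subseq_LIMSEQ[OF 1(4) 2(1)] by (simp add: k_def o_def)
  have X2: "(\<lambda>n. X_norm_sq s (v (k n))) \<longlonglongrightarrow> A2" using 2(4) unfolding k_def .
  have "(\<lambda>n. QF s a b c (u (k n)) (v (k n))) \<longlonglongrightarrow>
     A1 + A2 - (a * L2sq w1 + 2 * b * (\<integral>x. w1 x * w2 x \<partial>lborel) + c * L2sq w2)"
    unfolding QF_def
    by (intro tendsto_intros X1 X2 L2_tendsto[OF s(1,3) \<Omega>(1,2) uv(1) E(1) l1 1(2)] L2_tendsto[OF s(1,3) \<Omega>(1,2) uv(2) E(2) l2 2(2)]
        integral_mult_tendsto[OF s(1,3) \<Omega>(1,2) uv(1) E(1) l1 1(2) uv(2) E(2) l2 2(2)])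
  then have "A1 + A2 - (a * L2sq w1 + 2 * b * (\<integral>x. w1 x * w2 x \<partial>lborel) + c * L2sq w2) \<le> 1"
    by (rule LIMSEQ_le_const2) (use uv(3) in auto)
  \<comment> \<open>The lower order terms converge and the limits of the energies dominate those of
    \<open>w1\<close> and \<open>w2\<close>; only this inequality is available, not
    equality.\<close>
  then have QFw: "QF s a b c w1 w2 \<le> 1" unfolding QF_def using 1(5) 2(5) by linarith
  have Iw: "(\<lambda>n. ?I (u (k n)) (v (k n))) \<longlonglongrightarrow> ?I w1 w2"
    by (rule choq_tendsto[OF s(1,3) \<mu> p q \<Omega>(1,2) uv(1) E(1) l1 Xspace_borel[OF 1(2)] uv(2) E(2) l2 Xspace_borel[OF 2(2)]])
  have up: "?I u' v' \<le> S" if "u' \<in> Xspace s \<Omega>" "v' \<in> Xspace s \<Omega>" "QF s a b c u' v' \<le> 1" for u' v'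
    unfolding S_def using that by (intro cSup_upper[OF _ bdd]) (auto simp: T_def)
  have "S \<le> ?I w1 w2"
  proof (rule LIMSEQ_le[OF _ Iw])
    have "(\<lambda>n. S - 1 / real (Suc n)) \<longlonglongrightarrow> S - 0"
      by (intro tendsto_diff tendsto_const lim_inverse_n'[THEN LIMSEQ_Suc])
    from LIMSEQ_subseq_LIMSEQ[OF this k] show "(\<lambda>n. S - 1 / real (Suc (k n))) \<longlonglongrightarrow> S" by (simp add: o_def)
    show "\<exists>N. \<forall>n\<ge>N. S - 1 / real (Suc (k n)) \<le> ?I (u (k n)) (v (k n))"
      using uv(4) by (intro exI[of _ 0]) (auto intro: less_imp_le)
  qed
  then have IwS: "?I w1 w2 = S" using up[OF 1(2) 2(2) QFw] by simp
  have "?I (\<lambda>x. \<bar>w1 x\<bar>) (\<lambda>x. \<bar>w2 x\<bar>) = S" using IwS unfolding choq_def by simp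
  moreover have "QF s a b c (\<lambda>x. \<bar>w1 x\<bar>) (\<lambda>x. \<bar>w2 x\<bar>) \<le> 1" using QF_abs_le[OF 1(2) 2(2) b, of a c] QFw by linarith
  ultimately show ?thesis
    using up S Xspace_abs[OF 1(2)] Xspace_abs[OF 2(2)]
    by (intro exI[of _ "\<lambda>x. \<bar>w1 x\<bar>"] exI[of _ "\<lambda>x. \<bar>w2 x\<bar>"] exI[of _ S]) auto
qed

section \<open>Euler-Lagrange equations\<close>

text \<open>On the positive half-line this is convexity. The slope at x \<ge> 0 is nonnegative, so
  replacing w by |w| only raises the left side, which covers negative w; x = 0 and w = 0 lie on the
  boundary of the half-line and are treated directly.\<close>

lemma powr_above_tangent:
  fixes x w p :: real
  assumes x: "x \<ge> 0" and p: "p > 1"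
  shows "x powr p + p * x powr (p - 1) * (w - x) \<le> \<bar>w\<bar> powr p"
proof (cases "x = 0")
  case True then show ?thesis by simp
next
  case False
  then have x: "x > 0" using assms by simp
  show ?thesis
  proof (cases "w = 0")
    case True
    have "x powr p = x powr (p - 1) * x" using x powr_add[of x "p - 1" 1] by simp
    moreover have "x powr (p - 1) * x * (1 - p) \<le> 0" using x p by (intro mult_nonneg_nonpos) auto
    ultimately show ?thesis using True by (simp add: algebra_simps)
  next
    case False
    then have w: "\<bar>w\<bar> > 0" by simp
    have "p * x powr (p - 1) * (\<bar>w\<bar> - x) \<le> \<bar>w\<bar> powr p - x powr p"
    proof (rule convex_on_imp_above_tangent[where A = "{0<..}" and f = "\<lambda>x. x powr p"])
      show "convex_on {0<..} (\<lambda>x. x powr p)" using p by (intro powr_convex) simp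
      show "((\<lambda>x. x powr p) has_field_derivative p * x powr (p - 1)) (at x within {0<..})"
        using x by (auto intro!: derivative_eq_intros)
    qed (use x w in \<open>auto simp: interior_open\<close>)
    moreover have "p * x powr (p - 1) * (w - x) \<le> p * x powr (p - 1) * (\<bar>w\<bar> - x)"
      using p by (intro mult_left_mono) auto
    ultimately show ?thesis by linarith
  qed
qed

text \<open>Integrand of the derivative in the first argument, without the factor p. Using |u|^(p-1)
  in place of |u|^(p-2) u is correct for nonnegative \<open>u\<close>.\<close>

definition choq_deriv :: "real \<Rightarrow> real \<Rightarrow> real \<Rightarrow> 'a::euclidean_space set \<Rightarrow> ('a \<Rightarrow> real) \<Rightarrow> ('a \<Rightarrow> real) \<Rightarrow> ('a \<Rightarrow> real) \<Rightarrow> 'a \<times> 'a \<Rightarrow> real" where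
  "choq_deriv \<mu> p q \<Omega> u v \<phi> z = indicator \<Omega> (fst z) * indicator \<Omega> (snd z) *
     (\<bar>u (fst z)\<bar> powr (p - 1) * \<phi> (fst z) * \<bar>v (snd z)\<bar> powr q * norm (fst z - snd z) powr - \<mu>)"

abbreviation choq_deriv_int :: "real \<Rightarrow> real \<Rightarrow> real \<Rightarrow> 'a::euclidean_space set \<Rightarrow> ('a \<Rightarrow> real) \<Rightarrow> ('a \<Rightarrow> real) \<Rightarrow> ('a \<Rightarrow> real) \<Rightarrow> real" where
  "choq_deriv_int \<mu> p q \<Omega> u v \<phi> \<equiv> \<integral>z. choq_deriv \<mu> p q \<Omega> u v \<phi> z \<partial>lborel2"

lemma measurable_choq_deriv [measurable]:
  fixes \<Omega> :: "'a::euclidean_space set"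
  assumes [measurable]: "\<Omega> \<in> sets borel" "u \<in> borel_measurable borel" "v \<in> borel_measurable borel" "\<phi> \<in> borel_measurable borel"
  shows "choq_deriv \<mu> p q \<Omega> u v \<phi> \<in> borel_measurable lborel2"
proof -
  have [measurable]: "u \<in> borel_measurable lborel" "v \<in> borel_measurable lborel" "\<phi> \<in> borel_measurable lborel" "\<Omega> \<in> sets lborel" by simp_all
  show ?thesis unfolding choq_deriv_def[abs_def] by measurable
qed

text \<open>x^(p-1) y is at most the p-th power of the larger of x and y, so no constant is lost and
  integrability follows from that of \<open>choq\<close>.\<close>

lemma choq_deriv_abs_le:
  assumes p: "p > 1"
  shows "\<bar>choq_deriv \<mu> p q \<Omega> u v \<phi> z\<bar> \<le> choq \<mu> p q \<Omega> u v z + choq \<mu> p q \<Omega> \<phi> v z"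
proof -
  have Y: "x powr (p - 1) * y \<le> x powr p + y powr p" if "x \<ge> 0" "y \<ge> 0" for x y :: real
  proof (cases "y \<le> x")
    case True
    then have "x powr (p - 1) * y \<le> x powr (p - 1) * x" using that by (intro mult_left_mono) auto
    also have "\<dots> = x powr p" using that powr_add[of x "p - 1" 1] by (cases "x = 0") auto
    finally show ?thesis by (simp add: add_increasing2)
  next
    case False
    then have "x powr (p - 1) * y \<le> y powr (p - 1) * y" using that p by (intro mult_right_mono powr_mono2) auto
    also have "\<dots> = y powr p" using that False powr_add[of y "p - 1" 1] by (cases "y = 0") auto
    finally show ?thesis by (simp add: add_increasing)
  qed
  define k where "k = indicator \<Omega> (fst z) * indicator \<Omega> (snd z) * (\<bar>v (snd z)\<bar> powr q * norm (fst z - snd z) powr - \<mu>)"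
  have k: "k \<ge> 0" unfolding k_def by simp
  have "\<bar>choq_deriv \<mu> p q \<Omega> u v \<phi> z\<bar> = k * (\<bar>u (fst z)\<bar> powr (p - 1) * \<bar>\<phi> (fst z)\<bar>)"
    unfolding choq_deriv_def k_def by (simp add: abs_mult)
  also have "\<dots> \<le> k * (\<bar>u (fst z)\<bar> powr p + \<bar>\<phi> (fst z)\<bar> powr p)"
    by (intro mult_left_mono Y k) auto
  also have "\<dots> = choq \<mu> p q \<Omega> u v z + choq \<mu> p q \<Omega> \<phi> v z"
    unfolding choq_def k_def by (simp add: algebra_simps)
  finally show ?thesis .
qed

lemma choq_deriv_integrable:
  fixes \<Omega> :: "'a::euclidean_space set"
  assumes s: "0 < s" "2 * s < real DIM('a)" and \<mu>: "0 < \<mu>" "\<mu> < real DIM('a)"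
    and p: "1 < p" "p < crit_exp DIM('a) s \<mu>" and q: "0 < q" "q < crit_exp DIM('a) s \<mu>"
    and \<Omega>: "bounded \<Omega>" "open \<Omega>" and u: "u \<in> Xspace s \<Omega>" and v: "v \<in> Xspace s \<Omega>" and \<phi>: "\<phi> \<in> Xspace s \<Omega>"
  shows "integrable lborel2 (choq_deriv \<mu> p q \<Omega> u v \<phi>)"
proof (rule Bochner_Integration.integrable_bound)
  have [measurable]: "\<Omega> \<in> sets borel" "u \<in> borel_measurable borel" "v \<in> borel_measurable borel" "\<phi> \<in> borel_measurable borel"
    using \<Omega> u v \<phi> by (auto intro: Xspace_borel)
  have p0: "0 < p" using p by simp
  show "integrable lborel2 (\<lambda>z. choq \<mu> p q \<Omega> u v z + choq \<mu> p q \<Omega> \<phi> v z)"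
    by (intro Bochner_Integration.integrable_add choq_integrable[OF s \<mu> p0 p(2) q \<Omega>] u v \<phi>)
  show "choq_deriv \<mu> p q \<Omega> u v \<phi> \<in> borel_measurable lborel2" by measurable
  show "AE z in lborel2. norm (choq_deriv \<mu> p q \<Omega> u v \<phi> z) \<le> norm (choq \<mu> p q \<Omega> u v z + choq \<mu> p q \<Omega> \<phi> v z)"
    by (rule AE_I2) (simp add: order_trans[OF choq_deriv_abs_le[OF p(1)] abs_ge_self])
qed

text \<open>The perturbed form is a quadratic polynomial in t, and half its linear coefficient is
  the tested left-hand side of the equation.\<close>

lemma QF_add:
  fixes u v \<phi> :: "'a::euclidean_space \<Rightarrow> real"
  assumes u: "u \<in> Xspace s \<Omega>" and v: "v \<in> Xspace s \<Omega>" and \<phi>: "\<phi> \<in> Xspace s \<Omega>"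
  shows "QF s a b c (\<lambda>x. u x + t * \<phi> x) v = QF s a b c u v +
     2 * t * (X_inner s u \<phi> - (\<integral>x. (a * u x + b * v x) * \<phi> x \<partial>lborel)) + t\<^sup>2 * (X_norm_sq s \<phi> - a * L2sq \<phi>)"
proof -
  note i = Xspace_sq[OF u] Xspace_sq[OF \<phi>] Xspace_mult[OF u \<phi>] Xspace_mult[OF u v] Xspace_mult[OF \<phi> v] Xspace_mult[OF v \<phi>]
  have 1: "(\<integral>x. (u x + t * \<phi> x)\<^sup>2 \<partial>lborel) = L2sq u + 2 * t * (\<integral>x. u x * \<phi> x \<partial>lborel) + t\<^sup>2 * L2sq \<phi>"
  proof -
    have "(u x + t * \<phi> x)\<^sup>2 = (u x)\<^sup>2 + 2 * t * (u x * \<phi> x) + t\<^sup>2 * (\<phi> x)\<^sup>2" for x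
      by (simp add: power2_eq_square algebra_simps)
    then show ?thesis using i by simp
  qed
  have 2: "(\<integral>x. (u x + t * \<phi> x) * v x \<partial>lborel) = (\<integral>x. u x * v x \<partial>lborel) + t * (\<integral>x. v x * \<phi> x \<partial>lborel)"
  proof -
    have "(u x + t * \<phi> x) * v x = u x * v x + t * (v x * \<phi> x)" for x by (simp add: algebra_simps)
    then show ?thesis using i by simp
  qed
  have 3: "(\<integral>x. (a * u x + b * v x) * \<phi> x \<partial>lborel) = a * (\<integral>x. u x * \<phi> x \<partial>lborel) + b * (\<integral>x. v x * \<phi> x \<partial>lborel)"
  proof -
    have "(a * u x + b * v x) * \<phi> x = a * (u x * \<phi> x) + b * (v x * \<phi> x)" for x by (simp add: algebra_simps)
    then show ?thesis using i by simp
  qed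
  show ?thesis unfolding QF_def 1 2 3 X_norm_sq_add[OF u \<phi>] by (simp add: algebra_simps)
qed

text \<open>\<open>choq_int\<close> itself is never differentiated: the tangent bound gives an
  affine minorant in t, which already touches the upper bound from maximality at t = 0. The
  homogeneous form of maximality frees the perturbation from the constraint.\<close>

lemma Euler_Lagrange_component:
  fixes \<Omega> :: "'a::euclidean_space set"
  assumes s: "0 < s" "2 * s < real DIM('a)" and \<mu>: "0 < \<mu>" "\<mu> < real DIM('a)"
    and p: "1 < p" "p < crit_exp DIM('a) s \<mu>" and q: "0 < q" "q < crit_exp DIM('a) s \<mu>"
    and \<Omega>: "bounded \<Omega>" "open \<Omega>"
    and u: "u \<in> Xspace s \<Omega>" "\<And>x. 0 \<le> u x" and v: "v \<in> Xspace s \<Omega>" and \<phi>: "\<phi> \<in> Xspace s \<Omega>"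
    and Q1: "QF s a b c u v = 1" and S: "choq_int \<mu> p q \<Omega> u v = S"
    and max: "\<And>w. w \<in> Xspace s \<Omega> \<Longrightarrow> QF s a b c w v > 0 \<Longrightarrow>
        choq_int \<mu> p q \<Omega> w v \<le> S * QF s a b c w v powr ((p + q) / 2)"
  shows "S * (p + q) * (X_inner s u \<phi> - (\<integral>x. (a * u x + b * v x) * \<phi> x \<partial>lborel))
      = p * choq_deriv_int \<mu> p q \<Omega> u v \<phi>"
proof -
  have p0: "0 < p" using p by simp
  define q1 where "q1 = X_inner s u \<phi> - (\<integral>x. (a * u x + b * v x) * \<phi> x \<partial>lborel)"
  define q2 where "q2 = X_norm_sq s \<phi> - a * L2sq \<phi>"
  define D where "D = choq_deriv_int \<mu> p q \<Omega> u v \<phi>"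
  define Q where "Q t = 1 + 2 * t * q1 + t\<^sup>2 * q2" for t
  have Q: "QF s a b c (\<lambda>x. u x + t * \<phi> x) v = Q t" for t
    unfolding QF_add[OF u(1) v \<phi>] Q_def q1_def q2_def Q1 by simp
  have X: "(\<lambda>x. u x + t * \<phi> x) \<in> Xspace s \<Omega>" for t
    using Xspace_add_mult[OF u(1) \<phi>, of 1 t] by simp
  note ci = choq_integrable[OF s \<mu> p0 p(2) q \<Omega> _ v] and di = choq_deriv_integrable[OF s \<mu> p q \<Omega> u(1) v \<phi>]
  have lower: "S + t * p * D \<le> choq_int \<mu> p q \<Omega> (\<lambda>x. u x + t * \<phi> x) v" for t
  proof -
    have "S + t * p * D = (\<integral>z. choq \<mu> p q \<Omega> u v z + t * p * choq_deriv \<mu> p q \<Omega> u v \<phi> z \<partial>lborel2)"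
      unfolding S[symmetric] D_def using ci[OF u(1)] di by simp
    also have "\<dots> \<le> choq_int \<mu> p q \<Omega> (\<lambda>x. u x + t * \<phi> x) v"
    proof (rule integral_mono)
      show "integrable lborel2 (\<lambda>z. choq \<mu> p q \<Omega> u v z + t * p * choq_deriv \<mu> p q \<Omega> u v \<phi> z)"
        using ci[OF u(1)] di by simp
      show "integrable lborel2 (choq \<mu> p q \<Omega> (\<lambda>x. u x + t * \<phi> x) v)" by (rule ci[OF X])
      fix z :: "'a \<times> 'a"
      define k where "k = indicator \<Omega> (fst z) * indicator \<Omega> (snd z) * (\<bar>v (snd z)\<bar> powr q * norm (fst z - snd z) powr - \<mu>)"
      have k: "k \<ge> 0" unfolding k_def by simp
      have "choq \<mu> p q \<Omega> u v z + t * p * choq_deriv \<mu> p q \<Omega> u v \<phi> z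
         = k * (u (fst z) powr p + p * u (fst z) powr (p - 1) * ((u (fst z) + t * \<phi> (fst z)) - u (fst z)))"
        unfolding choq_def choq_deriv_def k_def using u(2)[of "fst z"] by (simp add: algebra_simps)
      also have "\<dots> \<le> k * (\<bar>u (fst z) + t * \<phi> (fst z)\<bar> powr p)"
        by (intro mult_left_mono powr_above_tangent u(2) p(1) k)
      also have "\<dots> = choq \<mu> p q \<Omega> (\<lambda>x. u x + t * \<phi> x) v z"
        unfolding choq_def k_def by (simp add: algebra_simps)
      finally show "choq \<mu> p q \<Omega> u v z + t * p * choq_deriv \<mu> p q \<Omega> u v \<phi> z \<le> choq \<mu> p q \<Omega> (\<lambda>x. u x + t * \<phi> x) v z" .
    qed
    finally show ?thesis .
  qed
  \<comment> \<open>The gap between the upper bound and the affine minorant: nonnegative near 0 for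
    both signs of t and zero at t = 0, so its derivative there vanishes.\<close>
  define h where "h t = S * Q t powr ((p + q) / 2) - (S + t * p * D)" for t
  have "isCont Q 0" unfolding Q_def[abs_def] by (intro continuous_intros)
  moreover have Q0: "Q 0 > 0" unfolding Q_def by simp
  ultimately have "\<forall>\<^sub>F t in at 0. 0 < Q t" unfolding isCont_def by (rule order_tendstoD(1))
  then obtain d where d: "d > 0" "\<And>t. t \<noteq> 0 \<Longrightarrow> dist t 0 < d \<Longrightarrow> 0 < Q t" unfolding eventually_at by auto
  have "(h has_field_derivative S * ((p + q) / 2 * (2 * q1)) - p * D) (at 0)"
    unfolding h_def[abs_def] Q_def[abs_def] by (auto intro!: derivative_eq_intros)
  moreover have "\<forall>t. \<bar>0 - t\<bar> < d \<longrightarrow> h 0 \<le> h t"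
  proof (intro allI impI)
    fix t assume "\<bar>0 - t\<bar> < d"
    then have "0 < Q t" using d(2)[of t] Q0 by (cases "t = 0") auto
    then have "choq_int \<mu> p q \<Omega> (\<lambda>x. u x + t * \<phi> x) v \<le> S * Q t powr ((p + q) / 2)"
      using max[OF X, of t] unfolding Q by simp
    then have "0 \<le> h t" using lower[of t] unfolding h_def by linarith
    moreover have "h 0 = 0" unfolding h_def Q_def by simp
    ultimately show "h 0 \<le> h t" by simp
  qed
  ultimately have "S * ((p + q) / 2 * (2 * q1)) - p * D = 0" using d(1) DERIV_local_min by blast
  then have "S * (p + q) * q1 = p * D" by (simp add: field_simps)
  then show ?thesis unfolding q1_def D_def .
qed

lemma choq_swap:
  fixes \<Omega> :: "'a::euclidean_space set"
  assumes [measurable]: "\<Omega> \<in> sets borel" "u \<in> borel_measurable borel" "v \<in> borel_measurable borel"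
  shows "choq_int \<mu> p q \<Omega> u v = choq_int \<mu> q p \<Omega> v u"
proof -
  have "choq_int \<mu> p q \<Omega> u v = (\<integral>(x,y). choq \<mu> p q \<Omega> u v (y, x) \<partial>lborel2)"
    by (rule lborel_pair.integral_product_swap[symmetric]) measurable
  also have "\<dots> = choq_int \<mu> q p \<Omega> v u"
    by (rule Bochner_Integration.integral_cong) (auto simp: choq_def norm_minus_commute mult_ac)
  finally show ?thesis .
qed

text \<open>Connects the product integral of the variational argument with the iterated set
  integrals of \<open>weak_solution\<close>.\<close>

lemma choq_deriv_Fubini:
  fixes \<Omega> :: "'a::euclidean_space set"
  assumes i: "integrable lborel2 (choq_deriv \<mu> p q \<Omega> u v \<phi>)" and u: "\<And>x. 0 \<le> u x"
  shows "choq_deriv_int \<mu> p q \<Omega> u v \<phi> =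
    (LINT x:\<Omega>|lborel. (LINT y:\<Omega>|lborel. \<bar>v y\<bar> powr q / norm (x - y) powr \<mu>) * (\<bar>u x\<bar> powr (p - 2) * u x) * \<phi> x)"
proof -
  have "choq_deriv_int \<mu> p q \<Omega> u v \<phi> = (\<integral>x. (\<integral>y. choq_deriv \<mu> p q \<Omega> u v \<phi> (x, y) \<partial>lborel) \<partial>lborel)"
    by (rule lborel_pair.integral_fst'[OF i, symmetric])
  also have "\<dots> = (\<integral>x. indicator \<Omega> x *\<^sub>R ((LINT y:\<Omega>|lborel. \<bar>v y\<bar> powr q / norm (x - y) powr \<mu>) * (\<bar>u x\<bar> powr (p - 2) * u x) * \<phi> x) \<partial>lborel)"
  proof (rule Bochner_Integration.integral_cong[OF refl])
    fix x
    \<comment> \<open>This needs \<open>u x \<ge> 0\<close>; where \<open>u\<close> vanishes, both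
      sides are 0 even for p < 2.\<close>
    have ux: "\<bar>u x\<bar> powr (p - 2) * u x = \<bar>u x\<bar> powr (p - 1)"
      using u[of x] powr_add[of "u x" "p - 2" 1] by (cases "u x = 0") auto
    have "choq_deriv \<mu> p q \<Omega> u v \<phi> (x, y) = (indicator \<Omega> x * (\<bar>u x\<bar> powr (p - 1) * \<phi> x)) * (indicator \<Omega> y *\<^sub>R (\<bar>v y\<bar> powr q / norm (x - y) powr \<mu>))" for y
      unfolding choq_deriv_def by (simp add: powr_minus_divide)
    then have "(\<integral>y. choq_deriv \<mu> p q \<Omega> u v \<phi> (x, y) \<partial>lborel) = (indicator \<Omega> x * (\<bar>u x\<bar> powr (p - 1) * \<phi> x)) * (LINT y:\<Omega>|lborel. \<bar>v y\<bar> powr q / norm (x - y) powr \<mu>)"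
      unfolding set_lebesgue_integral_def by (simp only: integral_mult_right_zero)
    then show "(\<integral>y. choq_deriv \<mu> p q \<Omega> u v \<phi> (x, y) \<partial>lborel) = indicator \<Omega> x *\<^sub>R ((LINT y:\<Omega>|lborel. \<bar>v y\<bar> powr q / norm (x - y) powr \<mu>) * (\<bar>u x\<bar> powr (p - 2) * u x) * \<phi> x)"
      unfolding ux by simp
  qed
  finally show ?thesis unfolding set_lebesgue_integral_def .
qed

section \<open>Strong maximum principle\<close>

text \<open>In the limit the integral of \<open>Tl\<close> is nonnegative although
  \<open>Tl \<le> 0\<close> pointwise, so \<open>Tl\<close> vanishes almost everywhere. At a zero x
  of \<open>u\<close> in \<Omega> and a point y with u(y) > 0 it is strictly negative. By
  nonlocality a zero set of positive measure in \<Omega> therefore forces \<open>u\<close> to vanish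
  almost everywhere in one step.\<close>

lemma strong_maximum_principle:
  fixes \<Omega> :: "'a::euclidean_space set"
  assumes s: "0 < s" "s < 1" and \<Omega>: "bounded \<Omega>" "open \<Omega>"
    and u: "u \<in> Xspace s \<Omega>" "\<And>x. 0 \<le> u x"
    and sup: "\<And>\<phi>. \<phi> \<in> Xspace s \<Omega> \<Longrightarrow> (\<And>x. 0 \<le> \<phi> x) \<Longrightarrow> X_inner s u \<phi> \<ge> - K * (\<integral>x. u x * \<phi> x \<partial>lborel)"
  shows "(AE x in lborel. u x = 0) \<or> (AE x in lborel. x \<in> \<Omega> \<longrightarrow> 0 < u x)"
proof -
  obtain \<eta> B where \<eta>: "\<eta> \<in> Xspace s \<Omega>" "\<And>x. x \<in> \<Omega> \<Longrightarrow> \<eta> x > 0" "\<And>x. 0 \<le> \<eta> x" "\<And>x. \<eta> x \<le> B"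
    using Xspace_positive_function[OF s \<Omega>] by blast
  have [measurable]: "u \<in> borel_measurable borel" "\<eta> \<in> borel_measurable borel" using u \<eta> by (auto intro: Xspace_borel)
  have B0: "B \<ge> 0" using \<eta>(3)[of 0] \<eta>(4)[of 0] by linarith
  \<comment> \<open>The test functions \<open>\<eta> g\<^sub>n(u)\<close> equal \<open>\<eta>\<close> on the zero set of \<open>u\<close> and decrease to \<open>0\<close> elsewhere.\<close>
  define g where "g n t = max 0 (1 - real (Suc n) * t)" for n :: nat and t :: real
  have g01: "0 \<le> g n t" "t \<ge> 0 \<Longrightarrow> g n t \<le> 1" for n t unfolding g_def by auto
  have gl: "\<bar>g n t - g n t'\<bar> \<le> real (Suc n) * \<bar>t - t'\<bar>" for n t t'
  proof -
    have "\<bar>g n t - g n t'\<bar> \<le> \<bar>real (Suc n) * t - real (Suc n) * t'\<bar>" unfolding g_def by linarith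
    also have "\<dots> = real (Suc n) * \<bar>t - t'\<bar>" by (simp only: right_diff_distrib[symmetric] abs_mult abs_of_nat)
    finally show ?thesis .
  qed
  have gm: "g n t' \<le> g n t" if "t \<le> t'" for n t t'
    unfolding g_def using that by (intro max.mono order_refl diff_left_mono mult_left_mono) auto
  have glim: "(\<lambda>n. g n t) \<longlonglongrightarrow> (if t = 0 then 1 else 0)" if t: "t \<ge> 0" for t
  proof (cases "t = 0")
    case True then show ?thesis unfolding g_def by simp
  next
    case False
    then obtain n0 where n0: "1 < real n0 * t" using ex_less_of_nat_mult[of t 1] t by auto
    have "g n t = 0" if "n \<ge> n0" for n
    proof -
      have "real n0 * t \<le> real (Suc n) * t" using that t by (intro mult_right_mono) auto
      then show ?thesis unfolding g_def using n0 by linarith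
    qed
    then show ?thesis using False by (intro tendsto_eventually eventually_sequentiallyI[of n0]) auto
  qed
  define \<phi> where "\<phi> n x = \<eta> x * g n (u x)" for n x
  have [measurable]: "\<phi> n \<in> borel_measurable borel" for n unfolding \<phi>_def[abs_def] g_def by measurable
  have \<phi>0: "0 \<le> \<phi> n x" for n x unfolding \<phi>_def using \<eta>(3) g01 by simp
  have \<phi>le: "\<phi> n x \<le> \<eta> x" for n x unfolding \<phi>_def using \<eta>(3)[of x] g01(2)[OF u(2)] by (intro mult_left_le) auto
  have \<phi>X: "\<phi> n \<in> Xspace s \<Omega>" for n
  proof (rule Xspace_dominated[OF \<eta>(1) u(1), where C = "1 + B * real (Suc n)"])
    have C1: "1 \<le> 1 + B * real (Suc n)" using B0 by simp
    fix x y
    have "\<bar>\<phi> n x\<bar> \<le> 1 * (\<bar>\<eta> x\<bar> + \<bar>u x\<bar>)" using \<phi>0[of n x] \<phi>le[of n x] by simp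
    also have "\<dots> \<le> (1 + B * real (Suc n)) * (\<bar>\<eta> x\<bar> + \<bar>u x\<bar>)" using C1 by (rule mult_right_mono) simp
    finally show "\<bar>\<phi> n x\<bar> \<le> (1 + B * real (Suc n)) * (\<bar>\<eta> x\<bar> + \<bar>u x\<bar>)" .
    have "\<phi> n x - \<phi> n y = (\<eta> x - \<eta> y) * g n (u x) + \<eta> y * (g n (u x) - g n (u y))"
      unfolding \<phi>_def by (simp add: algebra_simps)
    then have "\<bar>\<phi> n x - \<phi> n y\<bar> \<le> \<bar>(\<eta> x - \<eta> y) * g n (u x)\<bar> + \<bar>\<eta> y * (g n (u x) - g n (u y))\<bar>"
      by (simp only: abs_triangle_ineq)
    also have "\<dots> = \<bar>\<eta> x - \<eta> y\<bar> * g n (u x) + \<eta> y * \<bar>g n (u x) - g n (u y)\<bar>"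
      using g01(1)[of n "u x"] \<eta>(3)[of y] by (simp add: abs_mult)
    also have "\<dots> \<le> \<bar>\<eta> x - \<eta> y\<bar> * 1 + B * (real (Suc n) * \<bar>u x - u y\<bar>)"
      using g01(2)[OF u(2)] g01(1) \<eta>(3,4) B0 by (intro add_mono mult_mono gl) auto
    also have "\<dots> \<le> (1 + B * real (Suc n)) * (\<bar>\<eta> x - \<eta> y\<bar> + \<bar>u x - u y\<bar>)"
    proof -
      have *: "A * 1 + B * (k * D) \<le> (1 + B * k) * (A + D)" if "A \<ge> 0" "D \<ge> 0" "k \<ge> 0" for A D k :: real
      proof -
        have "(1 + B * k) * (A + D) = (A * 1 + B * (k * D)) + (D + B * k * A)" by (simp add: algebra_simps)
        moreover have "0 \<le> D + B * k * A" using that B0 by simp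
        ultimately show ?thesis by linarith
      qed
      show ?thesis by (rule *) auto
    qed
    finally show "\<bar>\<phi> n x - \<phi> n y\<bar> \<le> (1 + B * real (Suc n)) * (\<bar>\<eta> x - \<eta> y\<bar> + \<bar>u x - u y\<bar>)" .
  qed measurable
  define \<phi>l where "\<phi>l x = (if u x = 0 then \<eta> x else 0)" for x
  have [measurable]: "\<phi>l \<in> borel_measurable borel" unfolding \<phi>l_def[abs_def] by measurable
  have \<phi>lim: "(\<lambda>n. \<phi> n x) \<longlonglongrightarrow> \<phi>l x" for x
    using tendsto_mult[OF tendsto_const[of "\<eta> x"] glim[OF u(2)[of x]]] unfolding \<phi>_def \<phi>l_def by (simp split: if_splits)
  define T where "T n z = gag_quot s u z * gag_quot s (\<phi> n) z" for n z
  define Tl where "Tl z = gag_quot s u z * gag_quot s \<phi>l z" for z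
  define W where "W z = \<bar>gag_quot s u z * gag_quot s \<eta> z\<bar>" for z
  have [measurable]: "T n \<in> borel_measurable lborel2" for n unfolding T_def[abs_def] by measurable
  have [measurable]: "Tl \<in> borel_measurable lborel2" unfolding Tl_def[abs_def] by measurable
  have [measurable]: "W \<in> borel_measurable lborel2" unfolding W_def[abs_def] by measurable
  have Wi: "integrable lborel2 W"
    unfolding W_def[abs_def] using Xspace_gag_mult[OF u(1) \<eta>(1)] by (rule integrable_abs)
  have Ti: "integrable lborel2 (T n)" for n
    unfolding T_def[abs_def] by (rule Xspace_gag_mult[OF u(1) \<phi>X])
  \<comment> \<open>The energies of the test functions need not stay bounded in n, but a one-sided
    bound suffices. In the symmetric product rule the part with the difference of g(u) is
    nonpositive since g is nonincreasing, and the other part is controlled by the differences of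
    \<eta>.\<close>
  have TW: "T n z \<le> W z" for n z
  proof -
    obtain x y where z: "z = (x, y)" by (cases z)
    have "(u x - u y) * (\<phi> n x - \<phi> n y) = (u x - u y) * (g n (u x) - g n (u y)) * ((\<eta> x + \<eta> y) / 2)
       + ((u x - u y) * (\<eta> x - \<eta> y)) * ((g n (u x) + g n (u y)) / 2)"
      unfolding \<phi>_def by (simp add: field_simps)
    moreover have "(u x - u y) * (g n (u x) - g n (u y)) * ((\<eta> x + \<eta> y) / 2) \<le> 0"
    proof (rule mult_nonpos_nonneg)
      show "(u x - u y) * (g n (u x) - g n (u y)) \<le> 0"
        using gm[of "u x" "u y" n] gm[of "u y" "u x" n] by (cases "u x \<le> u y") (auto simp: mult_le_0_iff)
      show "0 \<le> (\<eta> x + \<eta> y) / 2" using \<eta>(3) by simp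
    qed
    moreover have "((u x - u y) * (\<eta> x - \<eta> y)) * ((g n (u x) + g n (u y)) / 2) \<le> \<bar>(u x - u y) * (\<eta> x - \<eta> y)\<bar> * 1"
    proof -
      have "((u x - u y) * (\<eta> x - \<eta> y)) * ((g n (u x) + g n (u y)) / 2) \<le> \<bar>(u x - u y) * (\<eta> x - \<eta> y)\<bar> * ((g n (u x) + g n (u y)) / 2)"
        using g01(1)[of n "u x"] g01(1)[of n "u y"] by (intro mult_right_mono) auto
      also have "\<dots> \<le> \<bar>(u x - u y) * (\<eta> x - \<eta> y)\<bar> * 1"
        using g01(2)[OF u(2), of n x] g01(2)[OF u(2), of n y] by (intro mult_left_mono) auto
      finally show ?thesis .
    qed
    ultimately have "(u x - u y) * (\<phi> n x - \<phi> n y) \<le> \<bar>(u x - u y) * (\<eta> x - \<eta> y)\<bar>" by linarith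
    then have "(u x - u y) * (\<phi> n x - \<phi> n y) / norm (x - y) powr (real DIM('a) + 2 * s) \<le> \<bar>(u x - u y) * (\<eta> x - \<eta> y)\<bar> / norm (x - y) powr (real DIM('a) + 2 * s)"
      by (rule divide_right_mono) simp
    then show ?thesis unfolding T_def W_def gag_quot_mult z by simp
  qed
  \<comment> \<open>The limit function lives on the zero set of \<open>u\<close>, hence is ordered
    oppositely to \<open>u\<close>.\<close>
  have Tneg: "Tl z \<le> 0" for z
  proof -
    obtain x y where z: "z = (x, y)" by (cases z)
    have "(u x - u y) * (\<phi>l x - \<phi>l y) \<le> 0"
      unfolding \<phi>l_def using u(2)[of x] u(2)[of y] \<eta>(3)[of x] \<eta>(3)[of y] by (auto simp: mult_le_0_iff)
    then show ?thesis unfolding Tl_def gag_quot_mult z by (simp add: divide_nonpos_nonneg)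
  qed
  \<comment> \<open>The products converge to u times a function supported where u = 0. The
    right-hand side of the supersolution inequality thus disappears, and Fatou's lemma applies to
    the nonnegative functions \<open>W - T n\<close>.\<close>
  have lim0: "(\<lambda>n. \<integral>x. u x * \<phi> n x \<partial>lborel) \<longlonglongrightarrow> (\<integral>x. 0 \<partial>(lborel::'a measure))"
  proof (rule integral_dominated_convergence[where w = "\<lambda>x. u x * \<eta> x"])
    show "integrable lborel (\<lambda>x. u x * \<eta> x)" by (rule Xspace_mult[OF u(1) \<eta>(1)])
    show "AE x in lborel. (\<lambda>n. u x * \<phi> n x) \<longlonglongrightarrow> 0"
    proof (rule AE_I2)
      fix x
      have "(\<lambda>n. u x * \<phi> n x) \<longlonglongrightarrow> u x * \<phi>l x" by (intro tendsto_intros \<phi>lim)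
      then show "(\<lambda>n. u x * \<phi> n x) \<longlonglongrightarrow> 0" unfolding \<phi>l_def by (simp split: if_splits)
    qed
    show "AE x in lborel. norm (u x * \<phi> n x) \<le> u x * \<eta> x" for n
      using u(2) \<phi>0 \<phi>le by (intro AE_I2) (simp add: abs_mult mult_left_mono)
  qed measurable
  have "(\<integral>\<^sup>+z. ennreal (W z - Tl z) \<partial>lborel2) \<le> ennreal (\<integral>z. W z \<partial>lborel2)"
  proof (rule nn_integral_le_limit[where f = "\<lambda>n z. ennreal (W z - T n z)" and
        c = "\<lambda>n. ennreal ((\<integral>z. W z \<partial>lborel2) + K * (\<integral>x. u x * \<phi> n x \<partial>lborel))"])
    show "AE z in lborel2. (\<lambda>n. ennreal (W z - T n z)) \<longlonglongrightarrow> ennreal (W z - Tl z)"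
      unfolding T_def Tl_def gag_quot_def divide_inverse
      by (intro AE_I2 tendsto_ennrealI tendsto_intros \<phi>lim)
    have "(\<lambda>n. (\<integral>z. W z \<partial>lborel2) + K * (\<integral>x. u x * \<phi> n x \<partial>lborel)) \<longlonglongrightarrow> (\<integral>z. W z \<partial>lborel2) + K * 0"
      using lim0 by (intro tendsto_intros) simp
    then show "(\<lambda>n. ennreal ((\<integral>z. W z \<partial>lborel2) + K * (\<integral>x. u x * \<phi> n x \<partial>lborel))) \<longlonglongrightarrow> ennreal (\<integral>z. W z \<partial>lborel2)"
      by (intro tendsto_ennrealI) simp
    fix n
    have "(\<integral>\<^sup>+z. ennreal (W z - T n z) \<partial>lborel2) = ennreal (\<integral>z. W z - T n z \<partial>lborel2)"
      using Wi Ti TW by (intro nn_integral_eq_integral) auto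
    also have "(\<integral>z. W z - T n z \<partial>lborel2) = (\<integral>z. W z \<partial>lborel2) - X_inner s u (\<phi> n)"
      using Wi Ti unfolding X_inner_eq T_def[abs_def] by simp
    also have "ennreal \<dots> \<le> ennreal ((\<integral>z. W z \<partial>lborel2) + K * (\<integral>x. u x * \<phi> n x \<partial>lborel))"
      using sup[OF \<phi>X \<phi>0, of n] by (intro ennreal_leI) simp
    finally show "(\<integral>\<^sup>+z. ennreal (W z - T n z) \<partial>lborel2) \<le> ennreal ((\<integral>z. W z \<partial>lborel2) + K * (\<integral>x. u x * \<phi> n x \<partial>lborel))" .
  qed measurable
  also have "ennreal (\<integral>z. W z \<partial>lborel2) = (\<integral>\<^sup>+z. ennreal (W z) \<partial>lborel2)"
    by (rule nn_integral_eq_integral[symmetric, OF Wi]) (simp add: W_def)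
  also have "(\<integral>\<^sup>+z. ennreal (W z - Tl z) \<partial>lborel2) = (\<integral>\<^sup>+z. ennreal (W z) + ennreal (- Tl z) \<partial>lborel2)"
    using Tneg by (intro nn_integral_cong) (simp add: ennreal_plus[symmetric] W_def del: ennreal_plus)
  also have "\<dots> = (\<integral>\<^sup>+z. ennreal (W z) \<partial>lborel2) + (\<integral>\<^sup>+z. ennreal (- Tl z) \<partial>lborel2)"
    by (rule nn_integral_add) measurable
  finally have "(\<integral>\<^sup>+z. ennreal (W z) \<partial>lborel2) + (\<integral>\<^sup>+z. ennreal (- Tl z) \<partial>lborel2) \<le> (\<integral>\<^sup>+z. ennreal (W z) \<partial>lborel2) + 0" by simp
  moreover have "(\<integral>\<^sup>+z. ennreal (W z) \<partial>lborel2) \<noteq> top"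
    using Wi by (subst nn_integral_eq_integral) (auto simp: W_def)
  ultimately have "(\<integral>\<^sup>+z. ennreal (- Tl z) \<partial>lborel2) \<le> 0"
    by (simp only: ennreal_add_left_cancel_le) auto
  then have "(\<integral>\<^sup>+z. ennreal (- Tl z) \<partial>lborel2) = 0" by simp
  then have "AE z in lborel2. ennreal (- Tl z) = 0"
    by (subst (asm) nn_integral_0_iff_AE) auto
  then have "AE x in lborel. AE y in lborel. ennreal (- Tl (x, y)) = 0"
    by (rule lborel_pair.AE_pair)
  \<comment> \<open>For such x and u(y) > 0 the numerator of \<open>Tl\<close> equals -u(y)
    \<eta>(x) or is larger in absolute value, hence is nonzero.\<close>
  then have dich: "AE x in lborel. x \<in> \<Omega> \<and> u x = 0 \<longrightarrow> (AE y in lborel. u y = 0)"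
  proof eventually_elim
    case (elim x)
    show ?case
    proof
      assume x: "x \<in> \<Omega> \<and> u x = 0"
      show "AE y in lborel. u y = 0"
        using elim AE_lborel_singleton[of x]
      proof eventually_elim
        case (elim y)
        have Tz: "Tl (x, y) = 0" using elim(1) Tneg[of "(x, y)"] by (simp add: ennreal_eq_0_iff)
        show "u y = 0"
        proof (rule ccontr)
          assume "u y \<noteq> 0"
          then have "(u x - u y) * (\<phi>l x - \<phi>l y) \<noteq> 0" unfolding \<phi>l_def using x \<eta>(2)[of x] by auto
          moreover have "norm (x - y) powr (real DIM('a) + 2 * s) \<noteq> 0" using elim(2) by auto
          ultimately show False using Tz unfolding Tl_def gag_quot_mult by simp
        qed
      qed
    qed
  qed
  show ?thesis
  proof (cases "AE y in lborel. u y = 0")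
    case False
    have "AE x in lborel. x \<in> \<Omega> \<longrightarrow> 0 < u x"
      using dich
    proof eventually_elim
      case (elim x) then show ?case using False u(2)[of x] by (auto simp: order_less_le)
    qed
    then show ?thesis ..
  qed simp
qed

section \<open>Invariance under changes on null sets\<close>

lemma Xspace_cong_AE:
  fixes u u' :: "'a::euclidean_space \<Rightarrow> real"
  assumes u: "u \<in> Xspace s \<Omega>" and [measurable]: "u' \<in> borel_measurable borel" and ae: "AE x in lborel. u x = u' x"
  shows "u' \<in> Xspace s \<Omega>"
proof -
  have [measurable]: "u \<in> borel_measurable borel" using u by (rule Xspace_borel)
  have "integrable lborel (\<lambda>x. (u x)\<^sup>2) = integrable lborel (\<lambda>x. (u' x)\<^sup>2)"
    by (rule integrable_cong_AE, measurable, measurable) (use ae in \<open>eventually_elim, simp\<close>)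
  moreover have "integrable lborel2 (\<lambda>z. (gag_quot s u z)\<^sup>2) = integrable lborel2 (\<lambda>z. (gag_quot s u' z)\<^sup>2)"
    by (rule integrable_cong_AE, measurable, measurable) (use AE_lborel_fst_snd[OF ae] in \<open>eventually_elim, simp add: gag_quot_def\<close>)
  moreover have "AE x in lborel. x \<notin> \<Omega> \<longrightarrow> u' x = 0"
    using Xspace_AE[OF u] ae by eventually_elim auto
  ultimately show ?thesis using u unfolding Xspace_iff by simp
qed

lemma X_inner_cong_AE:
  fixes u u' \<phi> :: "'a::euclidean_space \<Rightarrow> real"
  assumes [measurable]: "u \<in> borel_measurable borel" "u' \<in> borel_measurable borel" "\<phi> \<in> borel_measurable borel"
    and ae: "AE x in lborel. u x = u' x"
  shows "X_inner s u \<phi> = X_inner s u' \<phi>"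
  unfolding X_inner_eq
  by (rule integral_cong_AE, measurable, measurable) (use AE_lborel_fst_snd[OF ae] in \<open>eventually_elim, simp add: gag_quot_def\<close>)

lemma choq_deriv_cong_AE:
  fixes \<Omega> :: "'a::euclidean_space set"
  assumes [measurable]: "\<Omega> \<in> sets borel" "u \<in> borel_measurable borel" "u' \<in> borel_measurable borel"
    "v \<in> borel_measurable borel" "v' \<in> borel_measurable borel" "\<phi> \<in> borel_measurable borel"
    and u: "AE x in lborel. u x = u' x" and v: "AE x in lborel. v x = v' x"
  shows "choq_deriv_int \<mu> p q \<Omega> u v \<phi> = choq_deriv_int \<mu> p q \<Omega> u' v' \<phi>"
proof (rule integral_cong_AE)
  show "AE z in lborel2. choq_deriv \<mu> p q \<Omega> u v \<phi> z = choq_deriv \<mu> p q \<Omega> u' v' \<phi> z"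
    using AE_lborel_fst_snd[OF u] AE_lborel_fst_snd[OF v] by eventually_elim (simp add: choq_deriv_def)
qed measurable

section \<open>Existence of a positive solution\<close>

text \<open>Dividing by sqrt k moves the pair into the constraint set, and \<open>choq_int\<close>
  is homogeneous of degree p+q. Admitting any positive upper bound k of the form lets the lemma
  serve both the Euler-Lagrange argument and the proof that the maximiser saturates the
  constraint.\<close>

lemma maximizer_scaling:
  fixes u v :: "'a::euclidean_space \<Rightarrow> real"
  assumes max: "\<And>u' v'. u' \<in> Xspace s \<Omega> \<Longrightarrow> v' \<in> Xspace s \<Omega> \<Longrightarrow> QF s a b c u' v' \<le> 1 \<Longrightarrow>
      choq_int \<mu> p q \<Omega> u' v' \<le> S"
    and u: "u \<in> Xspace s \<Omega>" and v: "v \<in> Xspace s \<Omega>" and k: "k > 0" "QF s a b c u v \<le> k"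
  shows "choq_int \<mu> p q \<Omega> u v \<le> S * k powr ((p + q) / 2)"
proof -
  define t where "t = 1 / sqrt k"
  have t: "t > 0" unfolding t_def using k by simp
  have "t\<^sup>2 * QF s a b c u v \<le> 1" unfolding t_def using k by (simp add: power_divide field_simps)
  then have "choq_int \<mu> p q \<Omega> (\<lambda>x. t * u x) (\<lambda>x. t * v x) \<le> S"
    by (intro max Xspace_cmult u v) (simp add: QF_cmult[OF u v])
  then have "t powr (p + q) * choq_int \<mu> p q \<Omega> u v \<le> S"
    using t by (simp add: choq_cmult)
  moreover have "t powr (p + q) = 1 / k powr ((p + q) / 2)"
    unfolding t_def using k by (simp add: powr_divide powr_half_sqrt[symmetric] powr_powr)
  ultimately show ?thesis using k by (simp add: field_simps)
qed

lemma integral_eq_set_integral_Xspace: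
  fixes f :: "'a::euclidean_space \<Rightarrow> real"
  assumes \<phi>: "\<phi> \<in> Xspace s \<Omega>" and [measurable]: "\<Omega> \<in> sets borel" "f \<in> borel_measurable borel"
  shows "(\<integral>x. f x * \<phi> x \<partial>lborel) = (LINT x:\<Omega>|lborel. f x * \<phi> x)"
  unfolding set_lebesgue_integral_def
proof (rule integral_cong_AE)
  have [measurable]: "\<phi> \<in> borel_measurable borel" using \<phi> by (rule Xspace_borel)
  show "(\<lambda>x. f x * \<phi> x) \<in> borel_measurable lborel" "(\<lambda>x. indicat_real \<Omega> x *\<^sub>R (f x * \<phi> x)) \<in> borel_measurable lborel"
    by measurable
  show "AE x in lborel. f x * \<phi> x = indicat_real \<Omega> x *\<^sub>R (f x * \<phi> x)"
    using Xspace_AE[OF \<phi>] by eventually_elim (auto simp: indicator_def)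
qed

lemma choq_deriv_cmult:
  assumes t: "t \<ge> 0"
  shows "choq_deriv \<mu> p q \<Omega> (\<lambda>x. t * u x) (\<lambda>x. t * v x) \<phi> z = t powr (p + q - 1) * choq_deriv \<mu> p q \<Omega> u v \<phi> z"
proof -
  have "t powr (p + q - 1) = t powr (p - 1) * t powr q" using powr_add[of t "p - 1" q] by (simp add: algebra_simps)
  then show ?thesis unfolding choq_deriv_def using t by (simp add: abs_mult powr_mult)
qed

text \<open>The weak equation of one component. The other one is the same statement with p and q, a
  and c, and the two functions exchanged.\<close>

definition choq_eq :: "real \<Rightarrow> real \<Rightarrow> real \<Rightarrow> real \<Rightarrow> real \<Rightarrow> real \<Rightarrow> 'a::euclidean_space set \<Rightarrow> ('a \<Rightarrow> real) \<Rightarrow> ('a \<Rightarrow> real) \<Rightarrow> bool" where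
  "choq_eq s \<mu> p q a b \<Omega> u v \<longleftrightarrow> (\<forall>\<phi>\<in>Xspace s \<Omega>. X_inner s u \<phi> - (\<integral>x. (a * u x + b * v x) * \<phi> x \<partial>lborel)
     = 2 * p / (p + q) * choq_deriv_int \<mu> p q \<Omega> u v \<phi>)"

lemma choq_eq_cong_AE:
  fixes \<Omega> :: "'a::euclidean_space set"
  assumes eq: "choq_eq s \<mu> p q a b \<Omega> u v"
    and [measurable]: "\<Omega> \<in> sets borel" "u \<in> borel_measurable borel" "u' \<in> borel_measurable borel"
      "v \<in> borel_measurable borel" "v' \<in> borel_measurable borel"
    and u: "AE x in lborel. u x = u' x" and v: "AE x in lborel. v x = v' x"
  shows "choq_eq s \<mu> p q a b \<Omega> u' v'"
  unfolding choq_eq_def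
proof
  fix \<phi> assume \<phi>: "\<phi> \<in> Xspace s \<Omega>"
  then have [measurable]: "\<phi> \<in> borel_measurable borel" by (rule Xspace_borel)
  have 1: "X_inner s u \<phi> = X_inner s u' \<phi>" using u by (intro X_inner_cong_AE) measurable
  have 2: "(\<integral>x. (a * u x + b * v x) * \<phi> x \<partial>lborel) = (\<integral>x. (a * u' x + b * v' x) * \<phi> x \<partial>lborel)"
    by (rule integral_cong_AE, measurable, measurable) (use u v in \<open>eventually_elim, simp\<close>)
  have 3: "choq_deriv_int \<mu> p q \<Omega> u v \<phi> = choq_deriv_int \<mu> p q \<Omega> u' v' \<phi>"
    using u v by (intro choq_deriv_cong_AE) measurable
  show "X_inner s u' \<phi> - (\<integral>x. (a * u' x + b * v' x) * \<phi> x \<partial>lborel)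
     = 2 * p / (p + q) * choq_deriv_int \<mu> p q \<Omega> u' v' \<phi>"
    using eq \<phi> unfolding choq_eq_def 1[symmetric] 2[symmetric] 3[symmetric] by blast
qed

lemma choq_eq_positive:
  fixes \<Omega> :: "'a::euclidean_space set"
  assumes s: "0 < s" "s < 1" and \<Omega>: "bounded \<Omega>" "open \<Omega>"
    and u: "u \<in> Xspace s \<Omega>" "\<And>x. 0 \<le> u x" and v: "v \<in> Xspace s \<Omega>" "\<And>x. 0 \<le> v x"
    and p: "0 < p" "0 < q" and b: "b \<ge> 0" and eq: "choq_eq s \<mu> p q a b \<Omega> u v"
    and nz: "\<not> (AE x in lborel. u x = 0)"
  shows "AE x in lborel. x \<in> \<Omega> \<longrightarrow> 0 < u x"
proof -
  have "(AE x in lborel. u x = 0) \<or> (AE x in lborel. x \<in> \<Omega> \<longrightarrow> 0 < u x)"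
  \<comment> \<open>The coupling term and the nonlinear term are nonnegative and are discarded; the
    term with a, of either sign, is kept as K = -a.\<close>
  proof (rule strong_maximum_principle[OF s \<Omega> u, where K = "- a"])
    fix \<phi> assume \<phi>: "\<phi> \<in> Xspace s \<Omega>" and \<phi>0: "\<And>x. 0 \<le> \<phi> x"
    have "(a * u x + b * v x) * \<phi> x = a * (u x * \<phi> x) + b * (v x * \<phi> x)" for x by (simp add: algebra_simps)
    then have "(\<integral>x. (a * u x + b * v x) * \<phi> x \<partial>lborel) = a * (\<integral>x. u x * \<phi> x \<partial>lborel) + b * (\<integral>x. v x * \<phi> x \<partial>lborel)"
      using Xspace_mult[OF u(1) \<phi>] Xspace_mult[OF v(1) \<phi>] by simp
    moreover have "0 \<le> b * (\<integral>x. v x * \<phi> x \<partial>lborel)" using b v(2) \<phi>0 by simp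
    moreover have "0 \<le> 2 * p / (p + q) * choq_deriv_int \<mu> p q \<Omega> u v \<phi>"
    proof -
      have "0 \<le> choq_deriv \<mu> p q \<Omega> u v \<phi> z" for z unfolding choq_deriv_def using \<phi>0 by simp
      then have "0 \<le> choq_deriv_int \<mu> p q \<Omega> u v \<phi>" by (rule Bochner_Integration.integral_nonneg)
      then show ?thesis using p by (intro mult_nonneg_nonneg) auto
    qed
    moreover have "X_inner s u \<phi> - (\<integral>x. (a * u x + b * v x) * \<phi> x \<partial>lborel)
       = 2 * p / (p + q) * choq_deriv_int \<mu> p q \<Omega> u v \<phi>"
      using eq \<phi> unfolding choq_eq_def by blast
    ultimately show "- (- a) * (\<integral>x. u x * \<phi> x \<partial>lborel) \<le> X_inner s u \<phi>" by simp
  qed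
  then show ?thesis using nz by blast
qed

lemma weak_solution_of_choq_eq:
  fixes \<Omega> :: "'a::euclidean_space set"
  assumes s: "0 < s" "2 * s < real DIM('a)" and \<mu>: "0 < \<mu>" "\<mu> < real DIM('a)"
    and p: "1 < p" "p < crit_exp DIM('a) s \<mu>" and q: "1 < q" "q < crit_exp DIM('a) s \<mu>"
    and \<Omega>: "bounded \<Omega>" "open \<Omega>"
    and u: "u \<in> Xspace s \<Omega>" "\<And>x. 0 \<le> u x" and v: "v \<in> Xspace s \<Omega>" "\<And>x. 0 \<le> v x"
    and eq1: "choq_eq s \<mu> p q a b \<Omega> u v" and eq2: "choq_eq s \<mu> q p c b \<Omega> v u"
  shows "weak_solution s \<mu> p q a b c \<Omega> u v"
  unfolding weak_solution_def
proof (intro conjI ballI u(1) v(1))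
  have p0: "0 < p" "0 < q" using p q by auto
  have [measurable]: "\<Omega> \<in> sets borel" using \<Omega> by auto
  have [measurable]: "u \<in> borel_measurable borel" "v \<in> borel_measurable borel" using u v by (auto intro: Xspace_borel)
  fix \<phi> \<psi> assume \<phi>: "\<phi> \<in> Xspace s \<Omega>" and \<psi>: "\<psi> \<in> Xspace s \<Omega>"
  have ilin: "integrable lborel (\<lambda>x. (k * f x + l * g x) * h x)"
    if "f \<in> Xspace s \<Omega>" "g \<in> Xspace s \<Omega>" "h \<in> Xspace s \<Omega>" for f g h and k l :: real
    by (rule Xspace_mult[OF Xspace_add_mult[OF that(1,2)] that(3)])
  have set: "set_integrable lborel \<Omega> f" if "integrable lborel f" for f :: "'a \<Rightarrow> real"
    unfolding set_integrable_def by (rule integrable_mult_indicator[OF _ that]) simp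
  have lin: "(LINT x:\<Omega>|lborel. (a * u x + b * v x) * \<phi> x + (b * u x + c * v x) * \<psi> x)
     = (\<integral>x. (a * u x + b * v x) * \<phi> x \<partial>lborel) + (\<integral>x. (c * v x + b * u x) * \<psi> x \<partial>lborel)"
  proof -
    have "(LINT x:\<Omega>|lborel. (a * u x + b * v x) * \<phi> x + (b * u x + c * v x) * \<psi> x)
       = (LINT x:\<Omega>|lborel. (a * u x + b * v x) * \<phi> x) + (LINT x:\<Omega>|lborel. (b * u x + c * v x) * \<psi> x)"
      by (rule set_integral_add(2)[OF set[OF ilin[OF u(1) v(1) \<phi>]] set[OF ilin[OF u(1) v(1) \<psi>]]])
    also have "(LINT x:\<Omega>|lborel. (a * u x + b * v x) * \<phi> x) = (\<integral>x. (a * u x + b * v x) * \<phi> x \<partial>lborel)"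
      by (rule integral_eq_set_integral_Xspace[OF \<phi>, symmetric]) measurable
    also have "(LINT x:\<Omega>|lborel. (b * u x + c * v x) * \<psi> x) = (\<integral>x. (b * u x + c * v x) * \<psi> x \<partial>lborel)"
      by (rule integral_eq_set_integral_Xspace[OF \<psi>, symmetric]) measurable
    finally show ?thesis by (simp add: add.commute)
  qed
  have D1: "(LINT x:\<Omega>|lborel. (2*p/(p+q)) * (LINT y:\<Omega>|lborel. \<bar>v y\<bar> powr q / norm (x - y) powr \<mu>) * (\<bar>u x\<bar> powr (p - 2) * u x) * \<phi> x)
     = 2 * p / (p + q) * choq_deriv_int \<mu> p q \<Omega> u v \<phi>"
    unfolding choq_deriv_Fubini[OF choq_deriv_integrable[OF s \<mu> p p0(2) q(2) \<Omega> u(1) v(1) \<phi>] u(2)]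
    by (simp only: mult.assoc set_integral_mult_right)
  have D2: "(LINT x:\<Omega>|lborel. (2*q/(p+q)) * (LINT y:\<Omega>|lborel. \<bar>u y\<bar> powr p / norm (x - y) powr \<mu>) * (\<bar>v x\<bar> powr (q - 2) * v x) * \<psi> x)
     = 2 * q / (q + p) * choq_deriv_int \<mu> q p \<Omega> v u \<psi>"
    unfolding choq_deriv_Fubini[OF choq_deriv_integrable[OF s \<mu> q p0(1) p(2) \<Omega> v(1) u(1) \<psi>] v(2)]
    by (simp only: mult.assoc set_integral_mult_right add.commute[of q p])
  have "X_inner s u \<phi> - (\<integral>x. (a * u x + b * v x) * \<phi> x \<partial>lborel) = 2 * p / (p + q) * choq_deriv_int \<mu> p q \<Omega> u v \<phi>"
    using eq1 \<phi> unfolding choq_eq_def by blast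
  moreover have "X_inner s v \<psi> - (\<integral>x. (c * v x + b * u x) * \<psi> x \<partial>lborel) = 2 * q / (q + p) * choq_deriv_int \<mu> q p \<Omega> v u \<psi>"
    using eq2 \<psi> unfolding choq_eq_def by blast
  ultimately show "X_inner s u \<phi> + X_inner s v \<psi>
         - (LINT x:\<Omega>|lborel. (a * u x + b * v x) * \<phi> x + (b * u x + c * v x) * \<psi> x)
       = (LINT x:\<Omega>|lborel. (2*p/(p+q)) * (LINT y:\<Omega>|lborel. \<bar>v y\<bar> powr q / norm (x - y) powr \<mu>)
              * (\<bar>u x\<bar> powr (p - 2) * u x) * \<phi> x)
       + (LINT x:\<Omega>|lborel. (2*q/(p+q)) * (LINT y:\<Omega>|lborel. \<bar>u y\<bar> powr p / norm (x - y) powr \<mu>)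
              * (\<bar>v x\<bar> powr (q - 2) * v x) * \<psi> x)"
    unfolding lin D1 D2 by linarith
qed

text \<open>The Euler-Lagrange equation has right side p D / (S (p+q)). Scaling by \<theta>
  multiplies the left side by \<theta> and D by \<theta>^(p+q-1), so the prescribed weight 2p/(p+q)
  requires \<theta>^(p+q-2) = 1/(2S), solvable since p+q > 2. The formula is symmetric in p and q,
  hence the same \<theta> normalises both equations.\<close>

lemma choq_eq_of_maximizer:
  fixes \<Omega> :: "'a::euclidean_space set"
  assumes s: "0 < s" "2 * s < real DIM('a)" and \<mu>: "0 < \<mu>" "\<mu> < real DIM('a)"
    and p: "1 < p" "p < crit_exp DIM('a) s \<mu>" and q: "1 < q" "q < crit_exp DIM('a) s \<mu>"
    and \<Omega>: "bounded \<Omega>" "open \<Omega>"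
    and u: "u \<in> Xspace s \<Omega>" "\<And>x. 0 \<le> u x" and v: "v \<in> Xspace s \<Omega>"
    and Q1: "QF s a b c u v = 1" and S: "choq_int \<mu> p q \<Omega> u v = S" "S > 0"
    and max: "\<And>u' v'. u' \<in> Xspace s \<Omega> \<Longrightarrow> v' \<in> Xspace s \<Omega> \<Longrightarrow> QF s a b c u' v' \<le> 1 \<Longrightarrow>
      choq_int \<mu> p q \<Omega> u' v' \<le> S"
    and \<theta>: "\<theta> = (1 / (2 * S)) powr (1 / (p + q - 2))"
  shows "choq_eq s \<mu> p q a b \<Omega> (\<lambda>x. \<theta> * u x) (\<lambda>x. \<theta> * v x)"
  unfolding choq_eq_def
proof
  fix \<phi> assume \<phi>: "\<phi> \<in> Xspace s \<Omega>"
  have q0: "0 < q" using q by simp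
  have \<theta>0: "\<theta> > 0" unfolding \<theta> using S by simp
  have \<theta>p: "\<theta> powr (p + q - 1) = \<theta> / (2 * S)"
  proof -
    have "\<theta> powr (p + q - 2) = 1 / (2 * S)" unfolding \<theta> powr_powr using p q S by simp
    then show ?thesis using powr_add[of \<theta> "p + q - 2" 1] \<theta>0 by simp
  qed
  define D where "D = choq_deriv_int \<mu> p q \<Omega> u v \<phi>"
  have "S * (p + q) * (X_inner s u \<phi> - (\<integral>x. (a * u x + b * v x) * \<phi> x \<partial>lborel)) = p * D"
    unfolding D_def
  proof (rule Euler_Lagrange_component[OF s \<mu> p q0 q(2) \<Omega> u v \<phi> Q1 S(1)])
    fix w assume w: "w \<in> Xspace s \<Omega>" and pos: "0 < QF s a b c w v"
    show "choq_int \<mu> p q \<Omega> w v \<le> S * QF s a b c w v powr ((p + q) / 2)"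
      using pos by (intro maximizer_scaling[OF max w v]) auto
  qed
  then have "X_inner s u \<phi> - (\<integral>x. (a * u x + b * v x) * \<phi> x \<partial>lborel) = p * D / (S * (p + q))"
    using S p q by (simp add: eq_divide_eq mult.commute)
  moreover have "(\<integral>x. (a * (\<theta> * u x) + b * (\<theta> * v x)) * \<phi> x \<partial>lborel) = \<theta> * (\<integral>x. (a * u x + b * v x) * \<phi> x \<partial>lborel)"
  proof -
    have "(a * (\<theta> * u x) + b * (\<theta> * v x)) * \<phi> x = \<theta> * ((a * u x + b * v x) * \<phi> x)" for x by (simp add: algebra_simps)
    then show ?thesis by (simp only: integral_mult_right_zero)
  qed
  ultimately have "X_inner s (\<lambda>x. \<theta> * u x) \<phi> - (\<integral>x. (a * (\<theta> * u x) + b * (\<theta> * v x)) * \<phi> x \<partial>lborel) = \<theta> * (p * D / (S * (p + q)))"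
    unfolding X_inner_cmult_left by (simp add: right_diff_distrib[symmetric])
  also have "\<dots> = 2 * p / (p + q) * (\<theta> / (2 * S) * D)" by (simp add: mult_ac)
  also have "\<theta> / (2 * S) * D = choq_deriv_int \<mu> p q \<Omega> (\<lambda>x. \<theta> * u x) (\<lambda>x. \<theta> * v x) \<phi>"
    unfolding D_def choq_deriv_cmult[OF less_imp_le[OF \<theta>0]] \<theta>p by simp
  finally show "X_inner s (\<lambda>x. \<theta> * u x) \<phi> - (\<integral>x. (a * (\<theta> * u x) + b * (\<theta> * v x)) * \<phi> x \<partial>lborel)
     = 2 * p / (p + q) * choq_deriv_int \<mu> p q \<Omega> (\<lambda>x. \<theta> * u x) (\<lambda>x. \<theta> * v x) \<phi>" .
qed

lemma choq_integral_nonzero_imp: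
  fixes \<Omega> :: "'a::euclidean_space set"
  assumes [measurable]: "\<Omega> \<in> sets borel" "u \<in> borel_measurable borel" "v \<in> borel_measurable borel"
    and nz: "choq_int \<mu> p q \<Omega> u v \<noteq> 0"
  shows "\<not> (AE x in lborel. u x = 0)"
proof
  assume "AE x in lborel. u x = 0"
  then have z: "AE z in lborel2. choq \<mu> p q \<Omega> u v z = 0"
    using AE_lborel_fst_snd[of "\<lambda>x. u x = 0"] by (auto simp: choq_def elim: eventually_mono)
  from integral_eq_zero_AE[OF z] show False using nz by simp
qed

theorem theorem1p2:
  fixes \<Omega> :: "'a::euclidean_space set"
    and s \<mu> p q a b c :: real
  assumes "bounded_smooth_domain \<Omega>"
    and "0 < s" "s < 1" "real DIM('a) > 2 * s"
    and "0 < \<mu>" "\<mu> < real DIM('a)"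
    and "1 < p" "p < crit_exp DIM('a) s \<mu>"
    and "1 < q" "q < crit_exp DIM('a) s \<mu>"
    and "b \<ge> 0"
    and "largest_eigenvalue (matA a b c) < lambda1 s \<Omega>"
  shows "\<exists>u v. weak_solution s \<mu> p q a b c \<Omega> u v \<and> (\<forall>x\<in>\<Omega>. u x > 0 \<and> v x > 0)"
proof -
  have \<Omega>: "bounded \<Omega>" "open \<Omega>" "\<Omega> \<noteq> {}" using assms(1) unfolding bounded_smooth_domain_def by auto
  have [measurable]: "\<Omega> \<in> sets borel" using \<Omega> by auto
  note s = assms(2,3,4) and s' = assms(2,4) and \<mu> = assms(5,6) and p = assms(7,8) and q = assms(9,10) and b = assms(11)
  have p0: "0 < p" "0 < q" using p q by auto
  let ?I = "choq_int \<mu> p q \<Omega>"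
  obtain u v S where u: "u \<in> Xspace s \<Omega>" "\<And>x. 0 \<le> u x" and v: "v \<in> Xspace s \<Omega>" "\<And>x. 0 \<le> v x"
    and S: "S > 0" "QF s a b c u v \<le> 1" "?I u v = S"
    and max: "\<And>u' v'. u' \<in> Xspace s \<Omega> \<Longrightarrow> v' \<in> Xspace s \<Omega> \<Longrightarrow> QF s a b c u' v' \<le> 1 \<Longrightarrow> ?I u' v' \<le> S"
    using choq_maximizer[OF s \<mu> p0(1) p(2) p0(2) q(2) \<Omega> b assms(12)] by blast
  have um[measurable]: "u \<in> borel_measurable borel" and vm[measurable]: "v \<in> borel_measurable borel"
    using u v by (auto intro: Xspace_borel)
  \<comment> \<open>If the constraint were slack, enlarging the pair would exceed the maximum,
    because S > 0.\<close>
  have Q1: "QF s a b c u v = 1"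
  proof (rule ccontr)
    assume "QF s a b c u v \<noteq> 1"
    \<comment> \<open>The 1/4 only ensures k > 0 without consulting the sign of the form; any number
      strictly between 0 and 1 would serve.\<close>
    define k where "k = max (QF s a b c u v) (1 / 4)"
    have k: "0 < k" "k < 1" "QF s a b c u v \<le> k" unfolding k_def using S(2) \<open>QF s a b c u v \<noteq> 1\<close> by auto
    have "S \<le> S * k powr ((p + q) / 2)" using maximizer_scaling[OF max u(1) v(1) k(1,3)] S(3) by simp
    moreover have "k powr ((p + q) / 2) < 1" using k p0 powr_less_mono2[of "(p + q) / 2" k 1] by simp
    ultimately show False using mult_strict_left_mono[of "k powr ((p + q) / 2)" 1 S] S(1) by simp
  qed
  define \<theta> where "\<theta> = (1 / (2 * S)) powr (1 / (p + q - 2))"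
  have \<theta>0: "\<theta> > 0" unfolding \<theta>_def using S by simp
  define U where "U x = \<theta> * u x" for x
  define V where "V x = \<theta> * v x" for x
  have U: "U \<in> Xspace s \<Omega>" "\<And>x. 0 \<le> U x" and V: "V \<in> Xspace s \<Omega>" "\<And>x. 0 \<le> V x"
    unfolding U_def[abs_def] V_def[abs_def] using u v \<theta>0 by (auto intro: Xspace_cmult)
  have [measurable]: "U \<in> borel_measurable borel" "V \<in> borel_measurable borel" using U V by (auto intro: Xspace_borel)
  have swap: "choq_int \<mu> q p \<Omega> f g = ?I g f" if "f \<in> Xspace s \<Omega>" "g \<in> Xspace s \<Omega>" for f g
    using that by (intro choq_swap) (auto intro: Xspace_borel)
  have eq1: "choq_eq s \<mu> p q a b \<Omega> U V"
    unfolding U_def[abs_def] V_def[abs_def]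
    by (rule choq_eq_of_maximizer[OF s' \<mu> p q \<Omega>(1,2) u v(1) Q1 S(3,1) max \<theta>_def])
  \<comment> \<open>The first-component lemma is reused with the roles exchanged; maximality
    transfers through the symmetry of the kernel and of \<open>QF\<close>.\<close>
  have eq2: "choq_eq s \<mu> q p c b \<Omega> V U"
    unfolding U_def[abs_def] V_def[abs_def]
  proof (rule choq_eq_of_maximizer[OF s' \<mu> q p \<Omega>(1,2) v u(1) _ _ S(1)])
    show "QF s c b a v u = 1" using Q1 by (simp add: QF_commute[of s c b a v u])
    show "choq_int \<mu> q p \<Omega> v u = S" using swap[OF v(1) u(1)] S(3) by simp
    show "\<theta> = (1 / (2 * S)) powr (1 / (q + p - 2))" unfolding \<theta>_def by (simp add: add.commute)
    fix f g assume fg: "f \<in> Xspace s \<Omega>" "g \<in> Xspace s \<Omega>" "QF s c b a f g \<le> 1"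
    then show "choq_int \<mu> q p \<Omega> f g \<le> S"
      using max[OF fg(2,1)] swap[OF fg(1,2)] by (simp add: QF_commute[of s c b a f g])
  qed
  have "\<not> (AE x in lborel. u x = 0)"
    using S by (intro choq_integral_nonzero_imp[of \<Omega> u v \<mu> p q]) auto
  then have nzU: "\<not> (AE x in lborel. U x = 0)" unfolding U_def using \<theta>0 by simp
  have "\<not> (AE x in lborel. v x = 0)"
    using S swap[OF v(1) u(1)] by (intro choq_integral_nonzero_imp[of \<Omega> v u \<mu> q p]) auto
  then have nzV: "\<not> (AE x in lborel. V x = 0)" unfolding V_def using \<theta>0 by simp
  have Upos: "AE x in lborel. x \<in> \<Omega> \<longrightarrow> 0 < U x"
    by (rule choq_eq_positive[OF s(1,2) \<Omega>(1,2) U V p0 b eq1 nzU])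
  have Vpos: "AE x in lborel. x \<in> \<Omega> \<longrightarrow> 0 < V x"
    by (rule choq_eq_positive[OF s(1,2) \<Omega>(1,2) V U p0(2,1) b eq2 nzV])
  \<comment> \<open>The value 1 is an arbitrary positive number. The points changed form a null set
    by \<open>Upos\<close>, and nonnegativity everywhere, which the passage to
    \<open>weak_solution\<close> uses, is kept.\<close>
  define U' where "U' x = (if x \<in> \<Omega> \<and> U x = 0 then 1 else U x)" for x
  define V' where "V' x = (if x \<in> \<Omega> \<and> V x = 0 then 1 else V x)" for x
  have m[measurable]: "U' \<in> borel_measurable borel" "V' \<in> borel_measurable borel"
    unfolding U'_def[abs_def] V'_def[abs_def] by measurable
  have UU': "AE x in lborel. U x = U' x" using Upos by eventually_elim (auto simp: U'_def)
  have VV': "AE x in lborel. V x = V' x" using Vpos by eventually_elim (auto simp: V'_def)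
  have U'0: "0 \<le> U' x" "0 \<le> V' x" for x unfolding U'_def V'_def using U(2) V(2) by auto
  have "weak_solution s \<mu> p q a b c \<Omega> U' V'"
  proof (rule weak_solution_of_choq_eq[OF s' \<mu> p q \<Omega>(1,2)])
    show "U' \<in> Xspace s \<Omega>" by (rule Xspace_cong_AE[OF U(1) m(1) UU'])
    show "V' \<in> Xspace s \<Omega>" by (rule Xspace_cong_AE[OF V(1) m(2) VV'])
    show "choq_eq s \<mu> p q a b \<Omega> U' V'" by (rule choq_eq_cong_AE[OF eq1 _ _ _ _ _ UU' VV']) measurable
    show "choq_eq s \<mu> q p c b \<Omega> V' U'" by (rule choq_eq_cong_AE[OF eq2 _ _ _ _ _ VV' UU']) measurable
  qed (rule U'0)+
  moreover have "\<forall>x\<in>\<Omega>. U' x > 0 \<and> V' x > 0"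
  proof
    fix x assume "x \<in> \<Omega>"
    then show "U' x > 0 \<and> V' x > 0" unfolding U'_def V'_def using U(2)[of x] V(2)[of x] by auto
  qed
  ultimately show ?thesis by blast
qed

end
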